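(* Let $\Gamma$ be a countable group with property (T). (1) Two free ergodic pmp $\Gamma$-actions are approximately conjugate if and only if they are conjugate. (2) Let $\Gamma\curvearrowright^\sigma(X,\mu)$ be a pmp $\Gamma$-action. If $(\theta_n)_n\subset\mathrm{Aut}(X,\mu)$ are such that $\lim_n\|[\theta_n,\sigma_g]\|_2=0$ for all $g\in\Gamma$, then there exist $(\theta_n')_n\subset\mathrm{Aut}(X,\mu)$ such that $[\theta_n',\sigma_g]=0$ for all $n$ and all $g\in\Gamma$, and $\lim_n\|\theta_n'-\theta_n\|_2=0$.
   Context: Probability spaces are standard; pmp means probability measure preserving; $\mathrm{Aut}(X,\mu)$ is the group of measure preserving automorphisms modulo null sets. For $\alpha,\beta\in\mathrm{Aut}(X,\mu)$, $\|\alpha-\beta\|_2=(2-2\mu(\{t\in X:\alpha(t)=\beta(t)\}))^{1/2}$. The notation $\|[\theta,\sigma_g]\|_2$ means $\|\theta\sigma_g-\sigma_g\theta\|_2$, and $[\theta,\sigma_g]=0$ means $\theta\sigma_g=\sigma_g\theta$. Two pmp actions $\Gamma\curvearrowright^\sigma(X,\mu)$, $\Lambda\curvearrowright^\rho(Y,\nu)$ of countable groups are conjugate if there are a measure preserving isomorphism $\Delta:(X,\mu)\simeq(Y,\nu)$ and a group isomorphism $\delta:\Gamma\simeq\Lambda$ with $\Delta\sigma_g=\rho_{\delta(g)}\Delta$ for all $g\in\Gamma$. They are approximately conjugate if there are a group isomorphism $\delta:\Gamma\simeq\Lambda$ and measure preserving isomorphisms $\theta_n:(X,\mu)\simeq(Y,\nu)$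 with $\lim_n\|\theta_n\sigma_g\theta_n^{-1}-\rho_{\delta(g)}\|_2=0$ for all $g\in\Gamma$. *)

theory Defs
  imports "HOL-Probability.Probability" "HOL-Algebra.Group"
begin

section \<open>Property (T)\<close>

text \<open>
  The Hilbert spaces are the closed subspaces of the complex space \<open>\<ell>\<^sup>2(\<nat>)\<close>, that is, up to
  unitary isomorphism, all separable complex Hilbert spaces (including the finite-dimensional
  ones). Nothing is lost for a countable group: the closed linear span of the orbit of an almost
  invariant vector is a separable subrepresentation, and an invariant vector in it is invariant in
  the whole space.
\<close>

definition ell2 :: "(nat \<Rightarrow> complex) set" where
  "ell2 = {x. summable (\<lambda>n. (cmod (x n))\<^sup>2)}"

definition ell2_inner :: "(nat \<Rightarrow> complex) \<Rightarrow> (nat \<Rightarrow> complex) \<Rightarrow> complex" where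
  "ell2_inner x y = (\<Sum>n. x n * cnj (y n))"

definition ell2_norm :: "(nat \<Rightarrow> complex) \<Rightarrow> real" where
  "ell2_norm x = sqrt (\<Sum>n. (cmod (x n))\<^sup>2)"

definition closed_subspace_ell2 :: "(nat \<Rightarrow> complex) set \<Rightarrow> bool" where
  "closed_subspace_ell2 H \<longleftrightarrow>
     H \<subseteq> ell2 \<and>
     (\<lambda>_. 0) \<in> H \<and>
     (\<forall>x\<in>H. \<forall>y\<in>H. (\<lambda>n. x n + y n) \<in> H) \<and>
     (\<forall>c. \<forall>x\<in>H. (\<lambda>n. c * x n) \<in> H) \<and>
     (\<forall>s. \<forall>x\<in>ell2. (\<forall>k. s k \<in> H) \<longrightarrow>
        (\<lambda>k. ell2_norm (\<lambda>n. s k n - x n)) \<longlonglongrightarrow> 0 \<longrightarrow> x \<in> H)"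

definition unitary_on ::
  "(nat \<Rightarrow> complex) set \<Rightarrow> ((nat \<Rightarrow> complex) \<Rightarrow> (nat \<Rightarrow> complex)) \<Rightarrow> bool" where
  "unitary_on H U \<longleftrightarrow>
     bij_betw U H H \<and>
     (\<forall>x\<in>H. \<forall>y\<in>H. U (\<lambda>n. x n + y n) = (\<lambda>n. U x n + U y n)) \<and>
     (\<forall>c. \<forall>x\<in>H. U (\<lambda>n. c * x n) = (\<lambda>n. c * U x n)) \<and>
     (\<forall>x\<in>H. \<forall>y\<in>H. ell2_inner (U x) (U y) = ell2_inner x y)"

definition unitary_rep ::
  "('g, 'm) monoid_scheme \<Rightarrow> (nat \<Rightarrow> complex) set \<Rightarrow>
   ('g \<Rightarrow> (nat \<Rightarrow> complex) \<Rightarrow> (nat \<Rightarrow> complex)) \<Rightarrow> bool" where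
  "unitary_rep G H \<pi> \<longleftrightarrow>
     closed_subspace_ell2 H \<and>
     (\<forall>g\<in>carrier G. unitary_on H (\<pi> g)) \<and>
     (\<forall>g\<in>carrier G. \<forall>h\<in>carrier G. \<forall>x\<in>H. \<pi> (g \<otimes>\<^bsub>G\<^esub> h) x = \<pi> g (\<pi> h x))"

definition property_T :: "('g, 'm) monoid_scheme \<Rightarrow> bool" where
  "property_T G \<longleftrightarrow>
     (\<exists>F \<epsilon>. finite F \<and> F \<subseteq> carrier G \<and> \<epsilon> > 0 \<and>
       (\<forall>H \<pi>. unitary_rep G H \<pi> \<longrightarrow>
          (\<exists>\<xi>\<in>H. ell2_norm \<xi> = 1 \<and> (\<forall>g\<in>F. ell2_norm (\<lambda>n. \<pi> g \<xi> n - \<xi> n) < \<epsilon>)) \<longrightarrow>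
          (\<exists>\<eta>\<in>H. \<eta> \<noteq> (\<lambda>_. 0) \<and> (\<forall>g\<in>carrier G. \<pi> g \<eta> = \<eta>))))"

section \<open>Standard probability spaces and their isomorphisms\<close>

definition standard_prob_space :: "'a measure \<Rightarrow> bool" where
  "standard_prob_space M \<longleftrightarrow>
     prob_space M \<and>
     (\<exists>T. topspace T = space M \<and> completely_metrizable_space T \<and> second_countable T \<and>
          sets M = sigma_sets (space M) {U. openin T U})"

text \<open>
  Isomorphisms are represented by everywhere defined measurable maps that are invertible only up
  to null sets; two of them are the same isomorphism iff they agree almost everywhere. All notions
  below are invariant under changing the maps on null sets.
\<close>

definition ae_inverse :: "'a measure \<Rightarrow> 'b measure \<Rightarrow> ('a \<Rightarrow> 'b) \<Rightarrow> ('b \<Rightarrow> 'a) \<Rightarrow> bool" where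
  "ae_inverse M N f k \<longleftrightarrow>
     k \<in> measurable N M \<and> (AE x in M. k (f x) = x) \<and> (AE y in N. f (k y) = y)"

definition mp_isos :: "'a measure \<Rightarrow> 'b measure \<Rightarrow> ('a \<Rightarrow> 'b) set" where
  "mp_isos M N = {f. f \<in> measurable M N \<and> distr M N f = N \<and> (\<exists>k. ae_inverse M N f k)}"

abbreviation mp_auts :: "'a measure \<Rightarrow> ('a \<Rightarrow> 'a) set" where
  "mp_auts M \<equiv> mp_isos M M"

text \<open>For \<open>f \<in> mp_isos M N\<close> the almost everywhere inverse is unique up to null sets.\<close>

definition mp_inv :: "'a measure \<Rightarrow> 'b measure \<Rightarrow> ('a \<Rightarrow> 'b) \<Rightarrow> ('b \<Rightarrow> 'a)" where
  "mp_inv M N f = (SOME k. ae_inverse M N f k)"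

definition aut_dist :: "'a measure \<Rightarrow> ('a \<Rightarrow> 'a) \<Rightarrow> ('a \<Rightarrow> 'a) \<Rightarrow> real" where
  "aut_dist M \<alpha> \<beta> = sqrt (2 - 2 * measure M {t \<in> space M. \<alpha> t = \<beta> t})"

section \<open>Probability measure preserving actions\<close>

text \<open>
  A homomorphism into the automorphism group modulo null sets. That the unit acts trivially almost
  everywhere is a consequence.
\<close>

definition pmp_action :: "('g, 'm) monoid_scheme \<Rightarrow> 'a measure \<Rightarrow> ('g \<Rightarrow> 'a \<Rightarrow> 'a) \<Rightarrow> bool" where
  "pmp_action G M \<sigma> \<longleftrightarrow>
     (\<forall>g\<in>carrier G. \<sigma> g \<in> mp_auts M) \<and>
     (\<forall>g\<in>carrier G. \<forall>h\<in>carrier G. AE x in M. \<sigma> (g \<otimes>\<^bsub>G\<^esub> h) x = \<sigma> g (\<sigma> h x))"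

definition free_action :: "('g, 'm) monoid_scheme \<Rightarrow> 'a measure \<Rightarrow> ('g \<Rightarrow> 'a \<Rightarrow> 'a) \<Rightarrow> bool" where
  "free_action G M \<sigma> \<longleftrightarrow> (\<forall>g\<in>carrier G. g \<noteq> \<one>\<^bsub>G\<^esub> \<longrightarrow> (AE x in M. \<sigma> g x \<noteq> x))"

definition ergodic_action :: "('g, 'm) monoid_scheme \<Rightarrow> 'a measure \<Rightarrow> ('g \<Rightarrow> 'a \<Rightarrow> 'a) \<Rightarrow> bool" where
  "ergodic_action G M \<sigma> \<longleftrightarrow>
     (\<forall>A\<in>sets M. (\<forall>g\<in>carrier G. AE x in M. \<sigma> g x \<in> A \<longleftrightarrow> x \<in> A) \<longrightarrow>
        measure M A = 0 \<or> measure M A = 1)"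

definition conjugate_actions ::
  "('g, 'm) monoid_scheme \<Rightarrow> 'a measure \<Rightarrow> ('g \<Rightarrow> 'a \<Rightarrow> 'a) \<Rightarrow>
   ('h, 'n) monoid_scheme \<Rightarrow> 'b measure \<Rightarrow> ('h \<Rightarrow> 'b \<Rightarrow> 'b) \<Rightarrow> bool" where
  "conjugate_actions G M \<sigma> H N \<rho> \<longleftrightarrow>
     (\<exists>\<Delta>\<in>mp_isos M N. \<exists>\<delta>\<in>iso G H.
        \<forall>g\<in>carrier G. AE x in M. \<Delta> (\<sigma> g x) = \<rho> (\<delta> g) (\<Delta> x))"

definition approx_conjugate_actions ::
  "('g, 'm) monoid_scheme \<Rightarrow> 'a measure \<Rightarrow> ('g \<Rightarrow> 'a \<Rightarrow> 'a) \<Rightarrow>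
   ('h, 'n) monoid_scheme \<Rightarrow> 'b measure \<Rightarrow> ('h \<Rightarrow> 'b \<Rightarrow> 'b) \<Rightarrow> bool" where
  "approx_conjugate_actions G M \<sigma> H N \<rho> \<longleftrightarrow>
     (\<exists>\<delta>\<in>iso G H. \<exists>\<theta>::nat \<Rightarrow> 'a \<Rightarrow> 'b. (\<forall>n. \<theta> n \<in> mp_isos M N) \<and>
        (\<forall>g\<in>carrier G.
           (\<lambda>n. aut_dist N (\<theta> n \<circ> \<sigma> g \<circ> mp_inv M N (\<theta> n)) (\<rho> (\<delta> g))) \<longlonglongrightarrow> 0))"

end

theory Submission
  imports Defs
begin

text \<open>
  Let \<open>\<theta>\<close> be an isomorphism from \<open>(X, \<mu>)\<close> to \<open>(Y, \<nu>)\<close> that almost intertwines two actions of a group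
  with property (T). Functions on \<open>X \<times> Y\<close> that live on the countable union of the graphs of
  \<open>\<rho>\<^sub>g \<theta> \<sigma>\<^sub>g\<^sup>-\<^sup>1\<close> form a Hilbert space: integrate over \<open>X\<close> the sum over the countable fibre. The diagonal
  action preserves this measure, the indicator \<open>\<xi>\<close> of the graph of \<open>\<theta>\<close> is a unit vector, and
  \<open>\<parallel>g \<xi> - \<xi>\<parallel>\<close> is controlled by the measure of the set where \<open>\<theta>\<close> fails to intertwine \<open>g\<close>. So \<open>\<xi>\<close> is almost
  invariant, and property (T) yields an invariant vector \<open>\<eta>\<close> close to \<open>\<xi>\<close>
  (\<open>almost_invariant_near_invariant\<close>).

  The set \<open>{\<bar>\<eta> - 1\<bar> < 1/2}\<close> is an invariant subset of \<open>X \<times> Y\<close> that differs little from the graph of \<open>\<theta>\<close>.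
  Its points that are alone in their row and in their column form the graph of an equivariant
  partial isomorphism between invariant subsets of \<open>X\<close> and \<open>Y\<close>, and this partial isomorphism agrees
  with \<open>\<theta>\<close> off a small set (\<open>near_equivariant_partial_iso\<close>). If the action on \<open>X\<close> is ergodic, its domain,
  being invariant and of positive measure, has full measure: this is the conjugacy. If \<open>X = Y\<close>, an
  equivariant partial isomorphism \<open>f\<close> from \<open>A\<close> to \<open>B\<close> extends to an equivariant automorphism: a point
  outside \<open>A\<close> is moved by \<open>f\<^sup>-\<^sup>1\<close> until it leaves \<open>B\<close>, which happens almost surely because the measure is finite
  (\<open>extend_equivariant_partial_iso\<close>).

  Property (T) is stated for closed subspaces of \<open>\<ell>\<^sup>2(\<nat>)\<close>, so the closed span of an orbit in \<open>L\<^sup>2\<close> is carried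
  there by Gram-Schmidt coordinates. Passing from the mere existence of an invariant vector to one
  near \<open>\<xi>\<close> rests on the fact that the invariant vectors of a cyclic representation form a space
  of dimension at most one.
\<close>

section \<open>Square-integrable functions\<close>

text \<open>
  Elements of \<open>L\<^sup>2\<close> are represented by functions, so \<open>nrm\<close> is a seminorm whose kernel consists of
  the functions that vanish almost everywhere.
\<close>

definition sq_int :: "'z measure \<Rightarrow> ('z \<Rightarrow> complex) set" where
  "sq_int Z = {f \<in> borel_measurable Z. integrable Z (\<lambda>z. (cmod (f z))\<^sup>2)}"

definition dot :: "'z measure \<Rightarrow> ('z \<Rightarrow> complex) \<Rightarrow> ('z \<Rightarrow> complex) \<Rightarrow> complex" where
  "dot Z f g = (\<integral>z. f z * cnj (g z) \<partial>Z)"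

definition nrm :: "'z measure \<Rightarrow> ('z \<Rightarrow> complex) \<Rightarrow> real" where
  "nrm Z f = sqrt (\<integral>z. (cmod (f z))\<^sup>2 \<partial>Z)"

lemma sq_int_measurable [measurable_dest]: "f \<in> sq_int Z \<Longrightarrow> f \<in> borel_measurable Z"
  by (simp add: sq_int_def)

lemma sq_int_integrable: "f \<in> sq_int Z \<Longrightarrow> integrable Z (\<lambda>z. (cmod (f z))\<^sup>2)"
  by (simp add: sq_int_def)

lemma cmod_add_sq_le: "(cmod (a + b))\<^sup>2 \<le> 2 * (cmod a)\<^sup>2 + 2 * (cmod b)\<^sup>2"
proof -
  have "(cmod (a + b))\<^sup>2 \<le> (cmod a + cmod b)\<^sup>2"
    by (intro power_mono norm_triangle_ineq) auto
  also have "\<dots> \<le> 2 * (cmod a)\<^sup>2 + 2 * (cmod b)\<^sup>2"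
    using sum_squares_bound[of "cmod a" "cmod b"] by (simp add: power2_sum)
  finally show ?thesis .
qed

lemma sq_int_add:
  assumes f: "f \<in> sq_int Z" and g: "g \<in> sq_int Z"
  shows "(\<lambda>z. f z + g z) \<in> sq_int Z"
proof -
  note [measurable] = sq_int_measurable[OF f] sq_int_measurable[OF g]
  have "integrable Z (\<lambda>z. (cmod (f z + g z))\<^sup>2)"
  proof (rule Bochner_Integration.integrable_bound)
    show "integrable Z (\<lambda>z. 2 * (cmod (f z))\<^sup>2 + 2 * (cmod (g z))\<^sup>2)"
      using sq_int_integrable[OF f] sq_int_integrable[OF g] by simp
    show "AE z in Z. norm ((cmod (f z + g z))\<^sup>2) \<le> norm (2 * (cmod (f z))\<^sup>2 + 2 * (cmod (g z))\<^sup>2)"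
      using cmod_add_sq_le by (intro AE_I2) auto
  qed measurable
  then show ?thesis by (simp add: sq_int_def)
qed

lemma sq_int_scale: "f \<in> sq_int Z \<Longrightarrow> (\<lambda>z. c * f z) \<in> sq_int Z"
  by (auto simp: sq_int_def norm_mult power_mult_distrib)

lemma sq_int_diff:
  assumes f: "f \<in> sq_int Z" and g: "g \<in> sq_int Z"
  shows "(\<lambda>z. f z - g z) \<in> sq_int Z"
  using sq_int_add[OF f sq_int_scale[OF g, of "-1"]] by simp

lemma sq_int_zero: "(\<lambda>_. 0) \<in> sq_int Z"
  by (simp add: sq_int_def)

lemma sq_int_sum: "(\<And>i. i \<in> I \<Longrightarrow> f i \<in> sq_int Z) \<Longrightarrow> (\<lambda>z. \<Sum>i\<in>I. f i z) \<in> sq_int Z"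
  by (induction I rule: infinite_finite_induct) (auto intro: sq_int_add sq_int_zero)

lemma sq_int_absmult:
  assumes f: "f \<in> sq_int Z" and g: "g \<in> sq_int Z"
  shows "integrable Z (\<lambda>z. cmod (f z) * cmod (g z))"
proof (rule Bochner_Integration.integrable_bound)
  note [measurable] = sq_int_measurable[OF f] sq_int_measurable[OF g]
  show "integrable Z (\<lambda>z. (cmod (f z))\<^sup>2 + (cmod (g z))\<^sup>2)"
    using sq_int_integrable[OF f] sq_int_integrable[OF g] by simp
  show "(\<lambda>z. cmod (f z) * cmod (g z)) \<in> borel_measurable Z" by measurable
  have "cmod (f z) * cmod (g z) \<le> (cmod (f z))\<^sup>2 + (cmod (g z))\<^sup>2" for z
    using sum_squares_bound[of "cmod (f z)" "cmod (g z)"]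
      mult_nonneg_nonneg[of "cmod (f z)" "cmod (g z)"] by (simp del: zero_le_mult_iff mult_nonneg_nonneg)
  then show "AE z in Z. norm (cmod (f z) * cmod (g z)) \<le> norm ((cmod (f z))\<^sup>2 + (cmod (g z))\<^sup>2)"
    by (intro AE_I2) auto
qed

lemma cnj_borel_measurable [measurable]: "cnj \<in> borel \<rightarrow>\<^sub>M borel"
  by (intro borel_measurable_continuous_onI continuous_intros)

lemma dot_integrable:
  assumes f: "f \<in> sq_int Z" and g: "g \<in> sq_int Z"
  shows "integrable Z (\<lambda>z. f z * cnj (g z))"
proof (rule Bochner_Integration.integrable_bound[OF sq_int_absmult[OF f g]])
  note [measurable] = sq_int_measurable[OF f] sq_int_measurable[OF g]
  show "(\<lambda>z. f z * cnj (g z)) \<in> borel_measurable Z"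
    by measurable
qed (auto simp: norm_mult)

lemma nrm_nonneg [simp]: "0 \<le> nrm Z f"
  by (simp add: nrm_def)

lemma nrm_sq: "(nrm Z f)\<^sup>2 = (\<integral>z. (cmod (f z))\<^sup>2 \<partial>Z)"
  by (simp add: nrm_def)

lemma dot_self: "dot Z f f = of_real ((nrm Z f)\<^sup>2)"
  unfolding dot_def nrm_sq by (simp add: complex_norm_square[symmetric] flip: of_real_power)

lemma dot_cnj: "dot Z g f = cnj (dot Z f g)"
  unfolding dot_def by (simp add: mult.commute flip: Bochner_Integration.integral_cnj)

lemma dot_add_left:
  "f \<in> sq_int Z \<Longrightarrow> g \<in> sq_int Z \<Longrightarrow> h \<in> sq_int Z \<Longrightarrow> dot Z (\<lambda>z. f z + g z) h = dot Z f h + dot Z g h"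
  unfolding dot_def by (simp add: distrib_right dot_integrable)

lemma dot_diff_left:
  "f \<in> sq_int Z \<Longrightarrow> g \<in> sq_int Z \<Longrightarrow> h \<in> sq_int Z \<Longrightarrow> dot Z (\<lambda>z. f z - g z) h = dot Z f h - dot Z g h"
  unfolding dot_def by (simp add: left_diff_distrib dot_integrable)

lemma dot_scale_left: "dot Z (\<lambda>z. c * f z) h = c * dot Z f h"
  unfolding dot_def by (simp add: mult.assoc)

lemma dot_add_right:
  "f \<in> sq_int Z \<Longrightarrow> g \<in> sq_int Z \<Longrightarrow> h \<in> sq_int Z \<Longrightarrow> dot Z h (\<lambda>z. f z + g z) = dot Z h f + dot Z h g"
  using dot_add_left[of f Z g h] by (simp add: dot_cnj[of Z h])

lemma dot_scale_right: "dot Z h (\<lambda>z. c * f z) = cnj c * dot Z h f"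
  by (simp add: dot_cnj[of Z h] dot_scale_left)

lemma dot_sum_left:
  assumes "\<And>i. i \<in> I \<Longrightarrow> f i \<in> sq_int Z" and "h \<in> sq_int Z"
  shows "dot Z (\<lambda>z. \<Sum>i\<in>I. f i z) h = (\<Sum>i\<in>I. dot Z (f i) h)"
  using assms(1)
  by (induction I rule: infinite_finite_induct)
     (simp_all add: dot_add_left sq_int_sum assms(2) dot_def[of Z "\<lambda>_. 0"])

lemma nrm_scale: "nrm Z (\<lambda>z. c * f z) = cmod c * nrm Z f"
  unfolding nrm_def by (simp add: norm_mult power_mult_distrib real_sqrt_mult)

lemma nrm_diff_commute: "nrm Z (\<lambda>z. f z - g z) = nrm Z (\<lambda>z. g z - f z)"
  by (simp add: nrm_def norm_minus_commute)

lemma nrm_eq_0_iff: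
  assumes f: "f \<in> sq_int Z"
  shows "nrm Z f = 0 \<longleftrightarrow> (AE z in Z. f z = 0)"
  unfolding nrm_def using integral_nonneg_eq_0_iff_AE[OF sq_int_integrable[OF f]] by simp

lemma cauchy_schwarz:
  assumes f: "f \<in> sq_int Z" and g: "g \<in> sq_int Z"
  shows "cmod (dot Z f g) \<le> nrm Z f * nrm Z g"
proof -
  let ?A = "(nrm Z f)\<^sup>2" and ?B = "(nrm Z g)\<^sup>2" and ?C = "\<integral>z. cmod (f z) * cmod (g z) \<partial>Z"
  note int = sq_int_integrable[OF f] sq_int_integrable[OF g] sq_int_absmult[OF f g]
  have C0: "0 \<le> ?C" by (rule integral_nonneg_AE) auto
  have quad: "2 * t * ?C \<le> t\<^sup>2 * ?A + ?B" for t :: real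
  proof -
    have "(\<integral>z. 2 * t * (cmod (f z) * cmod (g z)) \<partial>Z) \<le> (\<integral>z. t\<^sup>2 * (cmod (f z))\<^sup>2 + (cmod (g z))\<^sup>2 \<partial>Z)"
    proof (rule integral_mono)
      fix z
      show "2 * t * (cmod (f z) * cmod (g z)) \<le> t\<^sup>2 * (cmod (f z))\<^sup>2 + (cmod (g z))\<^sup>2"
        using sum_squares_bound[of "t * cmod (f z)" "cmod (g z)"] by (simp add: power_mult_distrib mult.assoc)
    qed (use int in auto)
    then show ?thesis using int by (simp add: nrm_sq)
  qed
  have "?C \<le> nrm Z f * nrm Z g"
  proof (cases "?A = 0")
    case True
    have "?C = 0"
    proof (rule ccontr)
      assume "?C \<noteq> 0"
      then have "?C > 0" using C0 by linarith
      then have "2 * ((?B + 1) / ?C) * ?C = 2 * (?B + 1)" by simp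
      then have "2 * (?B + 1) \<le> ?B" using quad[of "(?B + 1) / ?C"] True by simp
      moreover have "x < 2 * (x + 1)" if "0 \<le> x" for x :: real using that by simp
      ultimately show False using zero_le_power2[of "nrm Z g"] leD by blast
    qed
    then show ?thesis by simp
  next
    case False
    then have A: "?A > 0" by simp
    have "2 * (?C / ?A) * ?C \<le> (?C / ?A)\<^sup>2 * ?A + ?B" by (rule quad)
    moreover have "c\<^sup>2 \<le> a * b" if "a > 0" "2 * (c / a) * c \<le> (c / a)\<^sup>2 * a + b" for a b c :: real
      using that by (simp add: field_simps power2_eq_square)
    ultimately have "?C\<^sup>2 \<le> ?A * ?B" using A by blast
    then have "?C\<^sup>2 \<le> (nrm Z f * nrm Z g)\<^sup>2" by (simp add: power_mult_distrib)
    then show ?thesis by (rule power2_le_imp_le) simp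
  qed
  moreover have "cmod (dot Z f g) \<le> ?C"
    unfolding dot_def using integral_norm_bound[of Z "\<lambda>z. f z * cnj (g z)"] by (simp add: norm_mult)
  ultimately show ?thesis by simp
qed

lemma nrm_sq_add:
  assumes f: "f \<in> sq_int Z" and g: "g \<in> sq_int Z"
  shows "(nrm Z (\<lambda>z. f z + g z))\<^sup>2 = (nrm Z f)\<^sup>2 + 2 * Re (dot Z f g) + (nrm Z g)\<^sup>2"
proof -
  have "complex_of_real ((nrm Z (\<lambda>z. f z + g z))\<^sup>2)
      = dot Z f f + dot Z f g + (cnj (dot Z f g) + dot Z g g)"
    unfolding dot_self[symmetric] dot_cnj[of Z g f, symmetric]
    using f g by (simp add: dot_add_left dot_add_right sq_int_add)
  then have "Re (complex_of_real ((nrm Z (\<lambda>z. f z + g z))\<^sup>2))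
      = Re (dot Z f f + dot Z f g + (cnj (dot Z f g) + dot Z g g))" by (rule arg_cong)
  then show ?thesis by (simp add: dot_self)
qed

lemma nrm_triangle:
  assumes f: "f \<in> sq_int Z" and g: "g \<in> sq_int Z"
  shows "nrm Z (\<lambda>z. f z + g z) \<le> nrm Z f + nrm Z g"
proof (rule power2_le_imp_le)
  have "Re (dot Z f g) \<le> nrm Z f * nrm Z g"
    using cauchy_schwarz[OF f g] complex_Re_le_cmod order_trans by blast
  then show "(nrm Z (\<lambda>z. f z + g z))\<^sup>2 \<le> (nrm Z f + nrm Z g)\<^sup>2"
    unfolding nrm_sq_add[OF f g] by (simp add: power2_sum)
qed simp

lemma nrm_triangle_diff:
  assumes "f \<in> sq_int Z" "g \<in> sq_int Z" "h \<in> sq_int Z"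
  shows "nrm Z (\<lambda>z. f z - h z) \<le> nrm Z (\<lambda>z. f z - g z) + nrm Z (\<lambda>z. g z - h z)"
  using nrm_triangle[OF sq_int_diff[OF assms(1,2)] sq_int_diff[OF assms(2,3)]] by simp

section \<open>Completeness\<close>

lemma sq_int_nn_integral:
  assumes f: "f \<in> sq_int Z"
  shows "(\<integral>\<^sup>+z. ennreal ((cmod (f z))\<^sup>2) \<partial>Z) = ennreal ((nrm Z f)\<^sup>2)"
  unfolding nrm_sq by (rule nn_integral_eq_integral[OF sq_int_integrable[OF f]]) simp

text \<open>
  Fatou's lemma; it serves both to show that the limit in the Riesz-Fischer theorem is square
  integrable and to bound its distance to the approximating functions.
\<close>

lemma sq_int_AE_limit:
  assumes F: "\<And>n. F n \<in> sq_int Z" and g [measurable]: "g \<in> borel_measurable Z"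
    and lim: "AE z in Z. (\<lambda>n. F n z) \<longlonglongrightarrow> g z"
    and bound: "eventually (\<lambda>n. nrm Z (F n) \<le> c) sequentially" and c: "0 \<le> c"
  shows "g \<in> sq_int Z" "nrm Z g \<le> c"
proof -
  have [measurable]: "F n \<in> borel_measurable Z" for n using F by (rule sq_int_measurable)
  have "(\<integral>\<^sup>+z. ennreal ((cmod (g z))\<^sup>2) \<partial>Z)
      = (\<integral>\<^sup>+z. liminf (\<lambda>n. ennreal ((cmod (F n z))\<^sup>2)) \<partial>Z)"
  proof (rule nn_integral_cong_AE, use lim in eventually_elim)
    fix z assume "(\<lambda>n. F n z) \<longlonglongrightarrow> g z"
    then have "(\<lambda>n. ennreal ((cmod (F n z))\<^sup>2)) \<longlonglongrightarrow> ennreal ((cmod (g z))\<^sup>2)"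
      by (intro tendsto_ennrealI tendsto_intros)
    from lim_imp_Liminf[OF _ this] show "ennreal ((cmod (g z))\<^sup>2) = liminf (\<lambda>n. ennreal ((cmod (F n z))\<^sup>2))"
      by simp
  qed
  also have "\<dots> \<le> liminf (\<lambda>n. \<integral>\<^sup>+z. ennreal ((cmod (F n z))\<^sup>2) \<partial>Z)"
    by (rule nn_integral_liminf) measurable
  also have "\<dots> = liminf (\<lambda>n. ennreal ((nrm Z (F n))\<^sup>2))"
    by (simp add: sq_int_nn_integral[OF F])
  also have "\<dots> \<le> ennreal (c\<^sup>2)"
  proof -
    have "eventually (\<lambda>n. ennreal ((nrm Z (F n))\<^sup>2) \<le> ennreal (c\<^sup>2)) sequentially"
      using bound by eventually_elim (auto intro!: ennreal_leI power_mono)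
    then have "liminf (\<lambda>n. ennreal ((nrm Z (F n))\<^sup>2)) \<le> liminf (\<lambda>n. ennreal (c\<^sup>2))"
      by (rule Liminf_mono)
    then show ?thesis by (simp add: Liminf_const)
  qed
  finally have le: "(\<integral>\<^sup>+z. ennreal ((cmod (g z))\<^sup>2) \<partial>Z) \<le> ennreal (c\<^sup>2)" .
  then have "integrable Z (\<lambda>z. (cmod (g z))\<^sup>2)"
    by (intro integrableI_bounded) (auto simp: le_less_trans)
  then show gs: "g \<in> sq_int Z" by (simp add: sq_int_def)
  have "(nrm Z g)\<^sup>2 \<le> c\<^sup>2"
    using le unfolding sq_int_nn_integral[OF gs] by (simp add: ennreal_le_iff)
  then show "nrm Z g \<le> c" using c by (rule power2_le_imp_le)
qed

text \<open>
  A subsequence with increments of norm at most \<open>4\<^sup>-\<^sup>n\<close> converges almost everywhere, and Fatou's lemma turns the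
  pointwise limit into a limit in norm of the whole Cauchy sequence.
\<close>

lemma riesz_fischer:
  assumes F: "\<And>k. F k \<in> sq_int Z"
    and cauchy: "\<And>e. e > 0 \<Longrightarrow> \<exists>K. \<forall>k\<ge>K. \<forall>l\<ge>K. nrm Z (\<lambda>z. F k z - F l z) \<le> e"
  obtains f where "f \<in> sq_int Z" "(\<lambda>k. nrm Z (\<lambda>z. F k z - f z)) \<longlonglongrightarrow> 0"
proof -
  have "\<forall>n. \<exists>K. \<forall>k\<ge>K. \<forall>l\<ge>K. nrm Z (\<lambda>z. F k z - F l z) \<le> (1/4)^n"
    using cauchy by simp
  then obtain K where K: "\<And>n k l. k \<ge> K n \<Longrightarrow> l \<ge> K n \<Longrightarrow> nrm Z (\<lambda>z. F k z - F l z) \<le> (1/4)^n"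
    by metis
  define r where "r n = (\<Sum>i\<le>n. Suc (K i))" for n :: nat
  have rK: "K n \<le> r n" for n
    unfolding r_def using member_le_sum[of n "{..n}" "\<lambda>i. Suc (K i)"] by simp
  have rS: "r n \<le> r (Suc n)" for n by (simp add: r_def)
  have rn: "n \<le> r n" for n by (induction n) (simp_all add: r_def)
  define D where "D n z = F (r (Suc n)) z - F (r n) z" for n z
  have D: "D n \<in> sq_int Z" for n unfolding D_def by (intro sq_int_diff F)
  have Dm [measurable]: "D n \<in> borel_measurable Z" for n using D by (rule sq_int_measurable)
  have Fm [measurable]: "F n \<in> borel_measurable Z" for n using F by (rule sq_int_measurable)
  have Dn: "nrm Z (D n) \<le> (1/4)^n" for n
    unfolding D_def by (intro K) (use rK rS order_trans in blast)+
  \<comment> \<open>The weights \<open>4 ^ n\<close> turn square summability of the increments into absolute summability.\<close>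
  have "(\<integral>\<^sup>+z. (\<Sum>n. ennreal (4^n * (cmod (D n z))\<^sup>2)) \<partial>Z)
      = (\<Sum>n. \<integral>\<^sup>+z. ennreal (4^n) * ennreal ((cmod (D n z))\<^sup>2) \<partial>Z)"
    by (subst nn_integral_suminf) (auto simp: ennreal_mult)
  also have "\<dots> = (\<Sum>n. ennreal (4^n * (nrm Z (D n))\<^sup>2))"
    by (simp add: nn_integral_cmult sq_int_nn_integral[OF D] ennreal_mult)
  also have "\<dots> \<le> (\<Sum>n. ennreal ((1/4)^n))"
  proof (intro suminf_le ennreal_leI summableI)
    fix n
    have "4^n * (nrm Z (D n))\<^sup>2 \<le> 4^n * ((1/4)^n)\<^sup>2"
      by (intro mult_left_mono power_mono Dn) auto
    also have "\<dots> = (1/4)^n" by (simp add: power2_eq_square power_one_over)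
    finally show "4^n * (nrm Z (D n))\<^sup>2 \<le> (1/4)^n" .
  qed
  also have "\<dots> = ennreal (\<Sum>n. (1/4)^n)"
    by (rule suminf_ennreal2) (auto intro: summable_geometric)
  finally have "(\<integral>\<^sup>+z. (\<Sum>n. ennreal (4^n * (cmod (D n z))\<^sup>2)) \<partial>Z) \<noteq> \<infinity>"
    by (auto simp: top_unique)
  then have "AE z in Z. (\<Sum>n. ennreal (4^n * (cmod (D n z))\<^sup>2)) \<noteq> \<infinity>"
    by (intro nn_integral_PInf_AE) measurable
  then have conv: "AE z in Z. convergent (\<lambda>n. F (r n) z)"
  proof eventually_elim
    fix z assume "(\<Sum>n. ennreal (4^n * (cmod (D n z))\<^sup>2)) \<noteq> \<infinity>"
    then have "summable (\<lambda>n. 4^n * (cmod (D n z))\<^sup>2)"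
      by (intro summable_suminf_not_top) auto
    then have "Bseq (\<lambda>n. 4^n * (cmod (D n z))\<^sup>2)"
      by (intro convergent_imp_Bseq) (auto simp: convergent_def dest: summable_LIMSEQ_zero)
    then obtain C where C: "C > 0" "\<And>n. norm (4^n * (cmod (D n z))\<^sup>2) \<le> C" by (auto elim: BseqE)
    have "cmod (D n z) \<le> sqrt C * (1/2)^n" for n
    proof -
      have "((2::real)^n)\<^sup>2 = 4^n" by (simp add: power2_eq_square flip: power_mult_distrib)
      then have "(2^n * cmod (D n z))\<^sup>2 \<le> C" using C(2)[of n] by (simp add: power_mult_distrib)
      then have "2^n * cmod (D n z) \<le> sqrt C" by (rule real_le_rsqrt)
      then show ?thesis by (simp add: field_simps power_one_over)
    qed
    moreover have "summable (\<lambda>n. sqrt C * (1/2)^n)"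
      by (intro summable_mult summable_geometric) simp
    ultimately have "summable (\<lambda>n. D n z)"
      using summable_comparison_test'[of "\<lambda>n. sqrt C * (1/2)^n" 0 "\<lambda>n. D n z"] by blast
    then have "convergent (\<lambda>n. F (r 0) z + (\<Sum>i<n. D i z))"
      by (intro convergent_add convergent_const) (simp add: summable_iff_convergent)
    moreover have "F (r 0) z + (\<Sum>i<n. D i z) = F (r n) z" for n
      unfolding D_def using sum_lessThan_telescope[of "\<lambda>i. F (r i) z" n] by simp
    ultimately show "convergent (\<lambda>n. F (r n) z)" by simp
  qed
  define f where "f z = lim (\<lambda>n. F (r n) z)" for z
  have fm [measurable]: "f \<in> borel_measurable Z"
    unfolding f_def by (rule borel_measurable_lim_metric) measurable
  have flim: "AE z in Z. (\<lambda>n. F (r n) z) \<longlonglongrightarrow> f z"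
    using conv unfolding f_def by eventually_elim (simp add: convergent_LIMSEQ_iff)
  have key: "\<exists>K. \<forall>k\<ge>K. (\<lambda>z. F k z - f z) \<in> sq_int Z \<and> nrm Z (\<lambda>z. F k z - f z) \<le> e" if "e > 0" for e
  proof -
    obtain K where K: "\<And>k l. k \<ge> K \<Longrightarrow> l \<ge> K \<Longrightarrow> nrm Z (\<lambda>z. F k z - F l z) \<le> e"
      using cauchy[OF \<open>e > 0\<close>] by blast
    show ?thesis
    proof (intro exI[of _ K] allI impI)
      fix k assume k: "k \<ge> K"
      have "AE z in Z. (\<lambda>n. F k z - F (r n) z) \<longlonglongrightarrow> F k z - f z"
        using flim by eventually_elim (intro tendsto_intros)
      moreover have "eventually (\<lambda>n. nrm Z (\<lambda>z. F k z - F (r n) z) \<le> e) sequentially"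
        using eventually_ge_at_top[of K] by eventually_elim (use K k rn order_trans in blast)
      ultimately show "(\<lambda>z. F k z - f z) \<in> sq_int Z \<and> nrm Z (\<lambda>z. F k z - f z) \<le> e"
        using \<open>e > 0\<close> sq_int_AE_limit[of "\<lambda>n z. F k z - F (r n) z" Z "\<lambda>z. F k z - f z" e]
        by (auto intro: sq_int_diff F)
    qed
  qed
  have "f \<in> sq_int Z"
  proof -
    obtain k where "(\<lambda>z. F k z - f z) \<in> sq_int Z" using key[of 1] by auto
    from sq_int_diff[OF F[of k] this] show ?thesis by simp
  qed
  moreover have "(\<lambda>k. nrm Z (\<lambda>z. F k z - f z)) \<longlonglongrightarrow> 0"
  proof (rule LIMSEQ_I)
    fix e :: real assume "e > 0"
    with key[of "e/2"] obtain K where "\<forall>k\<ge>K. nrm Z (\<lambda>z. F k z - f z) \<le> e/2" by auto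
    then show "\<exists>K. \<forall>k\<ge>K. norm (nrm Z (\<lambda>z. F k z - f z) - 0) < e"
      using \<open>e > 0\<close> by (intro exI[of _ K]) (auto intro: le_less_trans)
  qed
  ultimately show ?thesis by (rule that)
qed

lemma tendsto_dot_left:
  assumes F: "\<And>k. F k \<in> sq_int Z" and f: "f \<in> sq_int Z" and g: "g \<in> sq_int Z"
    and lim: "(\<lambda>k. nrm Z (\<lambda>z. F k z - f z)) \<longlonglongrightarrow> 0"
  shows "(\<lambda>k. dot Z (F k) g) \<longlonglongrightarrow> dot Z f g"
proof (rule LIM_zero_cancel, rule Lim_null_comparison)
  show "\<forall>\<^sub>F k in sequentially. norm (dot Z (F k) g - dot Z f g) \<le> nrm Z (\<lambda>z. F k z - f z) * nrm Z g"
    using cauchy_schwarz[OF sq_int_diff[OF F f] g] by (simp add: dot_diff_left F f g)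
  show "(\<lambda>k. nrm Z (\<lambda>z. F k z - f z) * nrm Z g) \<longlonglongrightarrow> 0"
    using tendsto_mult_left_zero[OF lim] by simp
qed

section \<open>Gram-Schmidt coordinates\<close>

declare sum.cong [fundef_cong]

text \<open>
  Division by zero makes the \<open>n\<close>-th function vanish when \<open>u n\<close> depends on its predecessors. Hence
  every function of the sequence is either zero or a unit vector, and no linear independence has to be assumed.
\<close>

fun gram_schmidt :: "'z measure \<Rightarrow> (nat \<Rightarrow> 'z \<Rightarrow> complex) \<Rightarrow> nat \<Rightarrow> 'z \<Rightarrow> complex" where
  "gram_schmidt Z u n =
     (let r = (\<lambda>z. u n z - (\<Sum>j<n. dot Z (u n) (gram_schmidt Z u j) * gram_schmidt Z u j z))
      in (\<lambda>z. of_real (1 / nrm Z r) * r z))"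

declare gram_schmidt.simps [simp del] sum.cong [fundef_cong del]

definition gs_residue :: "'z measure \<Rightarrow> (nat \<Rightarrow> 'z \<Rightarrow> complex) \<Rightarrow> nat \<Rightarrow> 'z \<Rightarrow> complex" where
  "gs_residue Z u n = (\<lambda>z. u n z - (\<Sum>j<n. dot Z (u n) (gram_schmidt Z u j) * gram_schmidt Z u j z))"

lemma gram_schmidt_residue:
  "gram_schmidt Z u n = (\<lambda>z. of_real (1 / nrm Z (gs_residue Z u n)) * gs_residue Z u n z)"
  by (subst gram_schmidt.simps) (simp only: Let_def gs_residue_def)

lemma gs_residue_gram_schmidt:
  "nrm Z (gs_residue Z u n) \<noteq> 0 \<Longrightarrow>
   gs_residue Z u n = (\<lambda>z. of_real (nrm Z (gs_residue Z u n)) * gram_schmidt Z u n z)"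
  by (simp add: gram_schmidt_residue)

lemma nrm_gram_schmidt:
  "gram_schmidt Z u n = (\<lambda>_. 0) \<or> nrm Z (gram_schmidt Z u n) = 1"
proof (cases "nrm Z (gs_residue Z u n) = 0")
  case True then show ?thesis by (simp add: gram_schmidt_residue)
next
  case False
  then have "nrm Z (gram_schmidt Z u n) = 1"
    by (simp only: gram_schmidt_residue nrm_scale) (simp add: norm_divide)
  then show ?thesis ..
qed

definition coords :: "'z measure \<Rightarrow> (nat \<Rightarrow> 'z \<Rightarrow> complex) \<Rightarrow> ('z \<Rightarrow> complex) \<Rightarrow> nat \<Rightarrow> complex" where
  "coords Z u f n = dot Z f (gram_schmidt Z u n)"

text \<open>
  The closed linear span, as a double orthogonal complement: in this form it is visibly a closed
  subspace, and membership is tested by inner products only.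
\<close>

definition closed_span :: "'z measure \<Rightarrow> ('z \<Rightarrow> complex) set \<Rightarrow> ('z \<Rightarrow> complex) set" where
  "closed_span Z U = {f \<in> sq_int Z. \<forall>h\<in>sq_int Z. (\<forall>v\<in>U. dot Z v h = 0) \<longrightarrow> dot Z f h = 0}"

context
  fixes Z :: "'z measure" and u :: "nat \<Rightarrow> 'z \<Rightarrow> complex"
  assumes u: "\<And>n. u n \<in> sq_int Z"
begin

lemma sq_int_gram_schmidt: "gram_schmidt Z u n \<in> sq_int Z"
proof (induction n rule: less_induct)
  case (less n)
  then have "gs_residue Z u n \<in> sq_int Z"
    unfolding gs_residue_def by (intro sq_int_diff u sq_int_sum sq_int_scale) simp
  then show ?case by (subst gram_schmidt_residue) (rule sq_int_scale)
qed

lemma sq_int_gs_residue: "gs_residue Z u n \<in> sq_int Z"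
  unfolding gs_residue_def by (intro sq_int_diff u sq_int_sum sq_int_scale sq_int_gram_schmidt)

lemma dot_gs_residue:
  "h \<in> sq_int Z \<Longrightarrow> dot Z (gs_residue Z u n) h =
     dot Z (u n) h - (\<Sum>j<n. dot Z (u n) (gram_schmidt Z u j) * dot Z (gram_schmidt Z u j) h)"
  unfolding gs_residue_def
  by (simp add: dot_diff_left dot_sum_left u sq_int_sum sq_int_scale sq_int_gram_schmidt dot_scale_left)

lemma dot_gram_schmidt_self_mult:
  "dot Z h (gram_schmidt Z u i) * dot Z (gram_schmidt Z u i) (gram_schmidt Z u i) = dot Z h (gram_schmidt Z u i)"
  using nrm_gram_schmidt[of Z u i] by (auto simp: dot_self dot_def)

lemma gram_schmidt_orthogonal_less: "i < n \<Longrightarrow> dot Z (gram_schmidt Z u n) (gram_schmidt Z u i) = 0"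
proof (induction n arbitrary: i rule: less_induct)
  case (less n)
  let ?e = "gram_schmidt Z u"
  have orth: "dot Z (?e j) (?e i) = 0" if "j < n" "j \<noteq> i" for j
  proof (cases "j < i")
    case True
    then have "dot Z (?e i) (?e j) = 0" using less by simp
    then show ?thesis using dot_cnj[of Z "?e j" "?e i"] by simp
  next
    case False
    then show ?thesis using less.IH[of j i] that by simp
  qed
  have "(\<Sum>j<n. dot Z (u n) (?e j) * dot Z (?e j) (?e i)) = (\<Sum>j\<in>{i}. dot Z (u n) (?e j) * dot Z (?e j) (?e i))"
    by (rule sum.mono_neutral_right) (use less.prems orth in auto)
  then have "dot Z (gs_residue Z u n) (?e i) = 0"
    by (simp add: dot_gs_residue sq_int_gram_schmidt dot_gram_schmidt_self_mult)
  then show ?case by (subst gram_schmidt_residue) (simp only: dot_scale_left, simp)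
qed

lemma gram_schmidt_orthogonal: "i \<noteq> n \<Longrightarrow> dot Z (gram_schmidt Z u n) (gram_schmidt Z u i) = 0"
  using gram_schmidt_orthogonal_less[of i n] gram_schmidt_orthogonal_less[of n i]
    dot_cnj[of Z "gram_schmidt Z u n" "gram_schmidt Z u i"]
  by (cases "i < n") auto

text \<open>
  Every \<open>u n\<close> lies in the span of the Gram-Schmidt functions up to a function of norm zero, which
  Cauchy-Schwarz makes invisible to inner products.
\<close>

lemma orthogonal_gram_schmidt_imp:
  assumes h: "h \<in> sq_int Z" and "\<And>n. dot Z (gram_schmidt Z u n) h = 0"
  shows "dot Z (u n) h = 0"
proof -
  have "dot Z (gs_residue Z u n) h = 0"
  proof (cases "nrm Z (gs_residue Z u n) = 0")
    case True
    then show ?thesis using cauchy_schwarz[OF sq_int_gs_residue h, of n] by simp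
  next
    case False
    then show ?thesis by (subst gs_residue_gram_schmidt) (simp_all add: dot_scale_left assms)
  qed
  then show ?thesis using dot_gs_residue[OF h, of n] assms by simp
qed

lemma nrm_sq_gram_schmidt_sum:
  assumes "finite I"
  shows "(nrm Z (\<lambda>z. \<Sum>j\<in>I. coords Z u f j * gram_schmidt Z u j z))\<^sup>2 = (\<Sum>j\<in>I. (cmod (coords Z u f j))\<^sup>2)"
  using assms
proof (induction I)
  case empty
  then show ?case by (simp add: nrm_def)
next
  case (insert i I)
  let ?e = "gram_schmidt Z u"
  have "dot Z (?e i) (\<lambda>z. \<Sum>j\<in>I. coords Z u f j * ?e j z) = cnj (dot Z (\<lambda>z. \<Sum>j\<in>I. coords Z u f j * ?e j z) (?e i))"
    by (rule dot_cnj)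
  also have "dot Z (\<lambda>z. \<Sum>j\<in>I. coords Z u f j * ?e j z) (?e i) = 0"
    using insert.hyps
    by (auto simp: dot_sum_left sq_int_scale sq_int_gram_schmidt dot_scale_left intro!: sum.neutral gram_schmidt_orthogonal)
  finally have 0: "dot Z (?e i) (\<lambda>z. \<Sum>j\<in>I. coords Z u f j * ?e j z) = 0" by simp
  have 1: "(nrm Z (\<lambda>z. coords Z u f i * ?e i z))\<^sup>2 = (cmod (coords Z u f i))\<^sup>2"
    using nrm_gram_schmidt[of Z u i] by (auto simp: nrm_scale coords_def dot_def)
  show ?case using insert
    by (simp add: nrm_sq_add sq_int_scale sq_int_sum sq_int_gram_schmidt dot_scale_left 0 1)
qed

lemma bessel:
  assumes f: "f \<in> sq_int Z"
  shows "(\<Sum>j<N. (cmod (coords Z u f j))\<^sup>2) \<le> (nrm Z f)\<^sup>2"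
proof -
  let ?s = "\<lambda>z. \<Sum>j<N. coords Z u f j * gram_schmidt Z u j z"
  let ?S = "\<Sum>j<N. (cmod (coords Z u f j))\<^sup>2"
  have s: "?s \<in> sq_int Z" by (intro sq_int_sum sq_int_scale sq_int_gram_schmidt)
  have "dot Z ?s f = (\<Sum>j<N. coords Z u f j * dot Z (gram_schmidt Z u j) f)"
    by (simp add: dot_sum_left sq_int_scale sq_int_gram_schmidt dot_scale_left f)
  also have "\<dots> = (\<Sum>j<N. coords Z u f j * cnj (coords Z u f j))"
    by (simp add: coords_def dot_cnj[of Z _ f, symmetric])
  also have "\<dots> = of_real ?S" by (simp only: of_real_sum complex_norm_square)
  finally have sf: "dot Z ?s f = of_real ?S" .
  have nn: "(nrm Z ?s)\<^sup>2 = ?S" by (rule nrm_sq_gram_schmidt_sum) simp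
  have "0 \<le> ?S" by (simp add: sum_nonneg)
  then have "?S \<le> nrm Z ?s * nrm Z f"
    using cauchy_schwarz[OF s f] unfolding sf norm_of_real by simp
  then have "nrm Z ?s * nrm Z ?s \<le> nrm Z ?s * nrm Z f" using nn by (simp add: power2_eq_square)
  then have "nrm Z ?s = 0 \<or> nrm Z ?s \<le> nrm Z f"
    using nrm_nonneg[of Z ?s] unfolding mult_le_cancel_left by linarith
  then have "nrm Z ?s \<le> nrm Z f" using nrm_nonneg[of Z f] by linarith
  then show ?thesis unfolding nn[symmetric] by (intro power_mono) auto
qed

text \<open>
  By Bessel's inequality and completeness the Fourier series of \<open>f\<close> converges to some \<open>t\<close>. The residual \<open>f - t\<close>
  is orthogonal to all Gram-Schmidt functions, so to the closed span, so to \<open>f\<close>; it is also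
  orthogonal to \<open>t\<close>, hence of norm zero.
\<close>

lemma parseval:
  assumes f: "f \<in> closed_span Z (range u)" and g: "g \<in> sq_int Z"
  shows "(\<lambda>j. coords Z u f j * cnj (coords Z u g j)) sums dot Z f g"
proof -
  let ?e = "gram_schmidt Z u" and ?c = "coords Z u f"
  note e = sq_int_gram_schmidt
  have fs: "f \<in> sq_int Z" using f by (simp add: closed_span_def)
  define s where "s N z = (\<Sum>j<N. ?c j * ?e j z)" for N z
  have s: "s N \<in> sq_int Z" for N unfolding s_def by (intro sq_int_sum sq_int_scale e)
  have ips: "dot Z (s N) h = (\<Sum>j<N. ?c j * dot Z (?e j) h)" if "h \<in> sq_int Z" for N h
    unfolding s_def by (simp add: dot_sum_left sq_int_scale e dot_scale_left that)
  have summ: "summable (\<lambda>j. (cmod (?c j))\<^sup>2)"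
    by (rule summableI_nonneg_bounded) (use bessel[OF fs] in auto)
  have incr: "(nrm Z (\<lambda>z. s N z - s M z))\<^sup>2 = (\<Sum>j\<in>{M..<N}. (cmod (?c j))\<^sup>2)" if "M \<le> N" for M N
  proof -
    have "s N z - s M z = (\<Sum>j\<in>{M..<N}. ?c j * ?e j z)" for z
      unfolding s_def using sum_diff_nat_ivl[of 0 M N "\<lambda>j. ?c j * ?e j z"] that by (simp add: lessThan_atLeast0)
    then show ?thesis using nrm_sq_gram_schmidt_sum[of "{M..<N}" f] by simp
  qed
  obtain t where t: "t \<in> sq_int Z" and st: "(\<lambda>N. nrm Z (\<lambda>z. s N z - t z)) \<longlonglongrightarrow> 0"
  proof (rule riesz_fischer[of s Z, OF s])
    fix e :: real assume e: "e > 0"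
    then have "e\<^sup>2 > 0" by simp
    with summ obtain K where K: "\<And>m n. m \<ge> K \<Longrightarrow> norm (\<Sum>j\<in>{m..<n}. (cmod (?c j))\<^sup>2) < e\<^sup>2"
      unfolding summable_Cauchy by blast
    have le: "nrm Z (\<lambda>z. s k z - s l z) \<le> e" if "l \<ge> K" "l \<le> k" for k l
    proof (rule power2_le_imp_le)
      show "(nrm Z (\<lambda>z. s k z - s l z))\<^sup>2 \<le> e\<^sup>2" using K[OF that(1), of k] by (simp add: incr[OF that(2)])
    qed (use e in simp)
    have "nrm Z (\<lambda>z. s k z - s l z) \<le> e" if "l \<ge> K" "k \<ge> K" for k l
      using le[of k l] le[of l k] that nrm_diff_commute[of Z "s k" "s l"] by (cases "l \<le> k") auto
    then show "\<exists>K. \<forall>k\<ge>K. \<forall>l\<ge>K. nrm Z (\<lambda>z. s k z - s l z) \<le> e" by blast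
  qed (use that in blast)
  define r where "r z = f z - t z" for z
  have r: "r \<in> sq_int Z" unfolding r_def by (intro sq_int_diff fs t)
  \<comment> \<open>The residual is orthogonal to every Gram-Schmidt vector, hence to the closed span.\<close>
  have "dot Z (?e j) r = 0" for j
  proof -
    have "(\<lambda>N. dot Z (s N) (?e j)) \<longlonglongrightarrow> dot Z t (?e j)"
      by (rule tendsto_dot_left[OF s t e st])
    moreover have "eventually (\<lambda>N. dot Z (s N) (?e j) = ?c j) sequentially"
      using eventually_gt_at_top[of j]
    proof eventually_elim
      case (elim N)
      have "dot Z (s N) (?e j) = (\<Sum>i\<in>{j}. ?c i * dot Z (?e i) (?e j))"
        unfolding ips[OF e] by (rule sum.mono_neutral_right)
          (use elim gram_schmidt_orthogonal in auto)
      then show ?case by (simp add: coords_def dot_gram_schmidt_self_mult)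
    qed
    ultimately have "dot Z t (?e j) = ?c j" by (metis LIMSEQ_unique tendsto_eventually)
    then have "dot Z r (?e j) = 0"
      unfolding r_def by (simp add: dot_diff_left fs t e coords_def)
    then show ?thesis using dot_cnj[of Z "?e j" r] by simp
  qed
  note er = this
  then have "dot Z (u n) r = 0" for n by (rule orthogonal_gram_schmidt_imp[OF r])
  then have fr: "dot Z f r = 0" using f r by (auto simp: closed_span_def)
  have "(\<lambda>N. dot Z (s N) r) \<longlonglongrightarrow> dot Z t r" by (rule tendsto_dot_left[OF s t r st])
  moreover have "dot Z (s N) r = 0" for N by (simp add: ips r er)
  ultimately have tr: "dot Z t r = 0" by (simp add: LIMSEQ_const_iff)
  have "dot Z r r = dot Z f r - dot Z t r"
    unfolding r_def by (rule dot_diff_left) (use fs t r[unfolded r_def] in simp_all)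
  then have "nrm Z r = 0" by (simp add: fr tr dot_self)
  then have "cmod (dot Z r g) \<le> 0" using cauchy_schwarz[OF r g] by simp
  moreover have "dot Z r g = dot Z f g - dot Z t g" unfolding r_def by (rule dot_diff_left[OF fs t g])
  ultimately have tg: "dot Z t g = dot Z f g" by simp
  have "(\<lambda>N. dot Z (s N) g) \<longlonglongrightarrow> dot Z f g" using tendsto_dot_left[OF s t g st] tg by simp
  moreover have "dot Z (s N) g = (\<Sum>j<N. ?c j * cnj (coords Z u g j))" for N
    by (simp add: ips g coords_def dot_cnj[of Z "?e _" g])
  ultimately show ?thesis by (simp add: sums_def)
qed

end

lemma closed_span_sq_int: "f \<in> closed_span Z U \<Longrightarrow> f \<in> sq_int Z"
  by (simp add: closed_span_def)

lemma closed_span_orthogonal: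
  "f \<in> closed_span Z U \<Longrightarrow> h \<in> sq_int Z \<Longrightarrow> (\<And>v. v \<in> U \<Longrightarrow> dot Z v h = 0) \<Longrightarrow> dot Z f h = 0"
  by (simp add: closed_span_def)

lemma closed_span_add:
  "f \<in> closed_span Z U \<Longrightarrow> g \<in> closed_span Z U \<Longrightarrow> (\<lambda>z. f z + g z) \<in> closed_span Z U"
  by (simp add: closed_span_def sq_int_add dot_add_left)

lemma closed_span_diff:
  "f \<in> closed_span Z U \<Longrightarrow> g \<in> closed_span Z U \<Longrightarrow> (\<lambda>z. f z - g z) \<in> closed_span Z U"
  by (simp add: closed_span_def sq_int_diff dot_diff_left)

lemma closed_span_scale: "f \<in> closed_span Z U \<Longrightarrow> (\<lambda>z. c * f z) \<in> closed_span Z U"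
  by (simp add: closed_span_def sq_int_scale dot_scale_left)

lemma closed_span_zero: "(\<lambda>_. 0) \<in> closed_span Z U"
  by (simp add: closed_span_def sq_int_zero dot_def)

lemma closed_span_mono: "U \<subseteq> closed_span Z V \<Longrightarrow> closed_span Z U \<subseteq> closed_span Z V"
  by (auto simp: closed_span_def subset_eq)

lemma closed_span_limit:
  assumes "\<And>k. F k \<in> closed_span Z U" "f \<in> sq_int Z" "(\<lambda>k. nrm Z (\<lambda>z. F k z - f z)) \<longlonglongrightarrow> 0"
  shows "f \<in> closed_span Z U"
  unfolding closed_span_def
proof (intro CollectI conjI ballI impI assms(2))
  fix h assume h: "h \<in> sq_int Z" and 0: "\<forall>v\<in>U. dot Z v h = 0"
  have "(\<lambda>k. dot Z (F k) h) \<longlonglongrightarrow> dot Z f h"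
    by (rule tendsto_dot_left) (use assms h closed_span_sq_int in blast)+
  moreover have "dot Z (F k) h = 0" for k using closed_span_orthogonal[OF assms(1) h] 0 by blast
  ultimately show "dot Z f h = 0" by (simp add: LIMSEQ_const_iff)
qed

lemma dot_cong_AE:
  assumes "f \<in> sq_int Z" "g \<in> sq_int Z" "h \<in> sq_int Z" "nrm Z (\<lambda>z. f z - g z) = 0"
  shows "dot Z f h = dot Z g h"
  using cauchy_schwarz[OF sq_int_diff[OF assms(1,2)] assms(3)] assms by (simp add: dot_diff_left)

lemma ell2_eq_sq_int: "ell2 = sq_int (count_space UNIV)"
  by (simp add: ell2_def sq_int_def integrable_count_space_nat_iff)

lemma ell2_norm_eq_nrm: "x \<in> ell2 \<Longrightarrow> ell2_norm x = nrm (count_space UNIV) x"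
  unfolding ell2_norm_def nrm_def
  by (subst integral_count_space_nat) (simp_all add: ell2_eq_sq_int sq_int_integrable)

lemma ell2_norm_eq_0:
  assumes "x \<in> ell2" "ell2_norm x = 0"
  shows "x = (\<lambda>_. 0)"
  using assms nrm_eq_0_iff[of x "count_space UNIV"]
  by (auto simp: ell2_norm_eq_nrm ell2_eq_sq_int AE_count_space)

context
  fixes Z :: "'z measure" and u :: "nat \<Rightarrow> 'z \<Rightarrow> complex"
  assumes u: "\<And>n. u n \<in> sq_int Z"
begin

lemma coords_add: "f \<in> sq_int Z \<Longrightarrow> g \<in> sq_int Z \<Longrightarrow>
    coords Z u (\<lambda>z. f z + g z) = (\<lambda>n. coords Z u f n + coords Z u g n)"
  by (simp add: coords_def fun_eq_iff dot_add_left sq_int_gram_schmidt u)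

lemma coords_diff: "f \<in> sq_int Z \<Longrightarrow> g \<in> sq_int Z \<Longrightarrow>
    coords Z u (\<lambda>z. f z - g z) = (\<lambda>n. coords Z u f n - coords Z u g n)"
  by (simp add: coords_def fun_eq_iff dot_diff_left sq_int_gram_schmidt u)

lemma coords_scale: "coords Z u (\<lambda>z. c * f z) = (\<lambda>n. c * coords Z u f n)"
  by (simp add: coords_def fun_eq_iff dot_scale_left)

lemma coords_zero: "coords Z u (\<lambda>_. 0) = (\<lambda>_. 0)"
  by (simp add: coords_def fun_eq_iff dot_def)

lemma ell2_inner_coords:
  "f \<in> closed_span Z (range u) \<Longrightarrow> g \<in> sq_int Z \<Longrightarrow> ell2_inner (coords Z u f) (coords Z u g) = dot Z f g"
  unfolding ell2_inner_def using parseval[of u Z, OF u] by (simp add: sums_iff)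

lemma coords_sums_nrm_sq:
  assumes f: "f \<in> closed_span Z (range u)"
  shows "(\<lambda>n. (cmod (coords Z u f n))\<^sup>2) sums (nrm Z f)\<^sup>2"
proof -
  have "(\<lambda>n. complex_of_real ((cmod (coords Z u f n))\<^sup>2)) sums complex_of_real ((nrm Z f)\<^sup>2)"
    unfolding complex_norm_square dot_self[symmetric]
    using parseval[of u Z, OF u f closed_span_sq_int[OF f]] .
  then show ?thesis by (simp only: sums_of_real_iff)
qed

lemma coords_in_ell2: "f \<in> closed_span Z (range u) \<Longrightarrow> coords Z u f \<in> ell2"
  using coords_sums_nrm_sq[of f] by (auto simp: ell2_def sums_iff)

lemma ell2_norm_coords: "f \<in> closed_span Z (range u) \<Longrightarrow> ell2_norm (coords Z u f) = nrm Z f"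
  using coords_sums_nrm_sq[of f] by (simp add: ell2_norm_def sums_iff)

lemma ell2_norm_coords_diff:
  assumes f: "f \<in> closed_span Z (range u)" and g: "g \<in> closed_span Z (range u)"
  shows "ell2_norm (\<lambda>n. coords Z u f n - coords Z u g n) = nrm Z (\<lambda>z. f z - g z)"
  using ell2_norm_coords[OF closed_span_diff[OF f g]] coords_diff[OF f[THEN closed_span_sq_int] g[THEN closed_span_sq_int]]
  by simp

lemma coords_eq_iff:
  assumes f: "f \<in> closed_span Z (range u)" and g: "g \<in> closed_span Z (range u)"
  shows "coords Z u f = coords Z u g \<longleftrightarrow> nrm Z (\<lambda>z. f z - g z) = 0"
proof
  assume "coords Z u f = coords Z u g"
  then show "nrm Z (\<lambda>z. f z - g z) = 0"
    unfolding ell2_norm_coords_diff[OF f g, symmetric] by (simp add: ell2_norm_def)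
next
  assume "nrm Z (\<lambda>z. f z - g z) = 0"
  then show "coords Z u f = coords Z u g"
    unfolding coords_def fun_eq_iff
    using dot_cong_AE[OF f[THEN closed_span_sq_int] g[THEN closed_span_sq_int]] by (simp add: sq_int_gram_schmidt u)
qed

text \<open>
  The coordinate map is isometric on the closed span, which is complete by the Riesz-Fischer
  theorem; so its image is closed in \<open>\<ell>\<^sup>2(\<nat>)\<close>.
\<close>

lemma closed_subspace_ell2_coords: "closed_subspace_ell2 (coords Z u ` closed_span Z (range u))"
  unfolding closed_subspace_ell2_def
proof (intro conjI ballI allI impI)
  let ?S = "closed_span Z (range u)" and ?c = "coords Z u"
  show "?c ` ?S \<subseteq> ell2" using coords_in_ell2 by auto
  show "(\<lambda>_. 0) \<in> ?c ` ?S" using closed_span_zero coords_zero by (metis image_eqI)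
  show "(\<lambda>n. x n + y n) \<in> ?c ` ?S" if "x \<in> ?c ` ?S" "y \<in> ?c ` ?S" for x y
  proof -
    from that obtain f g where "x = ?c f" "f \<in> ?S" "y = ?c g" "g \<in> ?S" by (elim imageE)
    then show ?thesis
      using coords_add[of f g] closed_span_add[of f Z "range u" g]
        closed_span_sq_int[of f Z "range u"] closed_span_sq_int[of g Z "range u"]
      by (intro image_eqI[of _ ?c "\<lambda>z. f z + g z"]) auto
  qed
  show "(\<lambda>n. c * x n) \<in> ?c ` ?S" if "x \<in> ?c ` ?S" for c x
  proof -
    from that obtain f where "x = ?c f" "f \<in> ?S" by (elim imageE)
    then show ?thesis
      using coords_scale[of c f] closed_span_scale[of f Z "range u" c]
      by (intro image_eqI[of _ ?c "\<lambda>z. c * f z"]) auto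
  qed
  fix s :: "nat \<Rightarrow> nat \<Rightarrow> complex" and x
  assume x: "x \<in> ell2" and sH: "\<forall>k. s k \<in> ?c ` ?S"
    and lim: "(\<lambda>k. ell2_norm (\<lambda>n. s k n - x n)) \<longlonglongrightarrow> 0"
  define f where "f k = inv_into ?S ?c (s k)" for k
  have f: "f k \<in> ?S" and s: "s k = ?c (f k)" for k
    unfolding f_def using sH inv_into_into[of "s k" ?c ?S] f_inv_into_f[of "s k" ?c ?S] by simp_all
  have fs: "f k \<in> sq_int Z" for k using f by (rule closed_span_sq_int)
  have sl: "s k \<in> ell2" for k unfolding s by (rule coords_in_ell2[OF f])
  let ?N = "count_space UNIV :: nat measure"
  note sl' = sl[unfolded ell2_eq_sq_int] note x' = x[unfolded ell2_eq_sq_int]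
  have lim': "(\<lambda>k. nrm ?N (\<lambda>n. s k n - x n)) \<longlonglongrightarrow> 0"
    using lim by (simp add: ell2_norm_eq_nrm ell2_eq_sq_int sq_int_diff sl' x')
  obtain g where g: "g \<in> sq_int Z" "(\<lambda>k. nrm Z (\<lambda>z. f k z - g z)) \<longlonglongrightarrow> 0"
  proof (rule riesz_fischer[of f Z, OF fs])
    fix e :: real assume "e > 0"
    then have "eventually (\<lambda>k. nrm ?N (\<lambda>n. s k n - x n) < e/2) sequentially"
      using lim' by (intro order_tendstoD) auto
    then obtain K where K: "\<And>k. k \<ge> K \<Longrightarrow> nrm ?N (\<lambda>n. s k n - x n) < e/2"
      by (auto simp: eventually_sequentially)
    have "nrm Z (\<lambda>z. f k z - f l z) \<le> e" if "k \<ge> K" "l \<ge> K" for k l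
    proof -
      have "nrm Z (\<lambda>z. f k z - f l z) = nrm ?N (\<lambda>n. s k n - s l n)"
        unfolding ell2_norm_coords_diff[OF f f, symmetric] s[symmetric]
        by (simp add: ell2_norm_eq_nrm ell2_eq_sq_int sq_int_diff sl')
      also have "\<dots> \<le> nrm ?N (\<lambda>n. s k n - x n) + nrm ?N (\<lambda>n. x n - s l n)"
        by (rule nrm_triangle_diff) (use sl' x' in auto)
      also have "nrm ?N (\<lambda>n. x n - s l n) = nrm ?N (\<lambda>n. s l n - x n)" by (rule nrm_diff_commute)
      finally show ?thesis using K[OF that(1)] K[OF that(2)] by simp
    qed
    then show "\<exists>K. \<forall>k\<ge>K. \<forall>l\<ge>K. nrm Z (\<lambda>z. f k z - f l z) \<le> e" by blast
  qed (use that in blast)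
  have gS: "g \<in> ?S" by (rule closed_span_limit[OF f g])
  note cg = coords_in_ell2[OF gS, unfolded ell2_eq_sq_int]
  have "nrm ?N (\<lambda>n. x n - ?c g n) \<le> 0"
  proof (rule LIMSEQ_le_const)
    show "(\<lambda>k. nrm ?N (\<lambda>n. s k n - x n) + nrm Z (\<lambda>z. f k z - g z)) \<longlonglongrightarrow> 0"
      using tendsto_add[OF lim' g(2)] by simp
    have "nrm ?N (\<lambda>n. x n - ?c g n) \<le> nrm ?N (\<lambda>n. s k n - x n) + nrm Z (\<lambda>z. f k z - g z)" for k
    proof -
      have "nrm ?N (\<lambda>n. x n - ?c g n) \<le> nrm ?N (\<lambda>n. x n - s k n) + nrm ?N (\<lambda>n. s k n - ?c g n)"
        by (rule nrm_triangle_diff) (use sl' x' cg in auto)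
      also have "nrm ?N (\<lambda>n. x n - s k n) = nrm ?N (\<lambda>n. s k n - x n)" by (rule nrm_diff_commute)
      also have "nrm ?N (\<lambda>n. s k n - ?c g n) = nrm Z (\<lambda>z. f k z - g z)"
        unfolding ell2_norm_coords_diff[OF f gS, symmetric] s[symmetric]
        by (simp add: ell2_norm_eq_nrm ell2_eq_sq_int sq_int_diff sl' cg)
      finally show ?thesis .
    qed
    then show "\<exists>K. \<forall>k\<ge>K. nrm ?N (\<lambda>n. x n - ?c g n) \<le> nrm ?N (\<lambda>n. s k n - x n) + nrm Z (\<lambda>z. f k z - g z)"
      by blast
  qed
  then have "ell2_norm (\<lambda>n. x n - ?c g n) = 0"
    using nrm_nonneg[of ?N "\<lambda>n. x n - ?c g n"] by (simp add: ell2_norm_eq_nrm ell2_eq_sq_int sq_int_diff x' cg)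
  then have "(\<lambda>n. x n - ?c g n) = (\<lambda>_. 0)"
    by (intro ell2_norm_eq_0) (simp_all add: ell2_eq_sq_int sq_int_diff x' cg)
  then have "x = ?c g" by (simp add: fun_eq_iff)
  then show "x \<in> ?c ` ?S" using gS by blast
qed

end

section \<open>Property (T) for Koopman representations\<close>

text \<open>
  A Kazhdan pair for the separable representations considered here; property (T) says that one exists
  with a finite set \<open>F\<close>.
\<close>

definition kazhdan_pair :: "('g, 'm) monoid_scheme \<Rightarrow> 'g set \<Rightarrow> real \<Rightarrow> bool" where
  "kazhdan_pair G F \<epsilon> \<longleftrightarrow> F \<subseteq> carrier G \<and> \<epsilon> > 0 \<and>
     (\<forall>H \<pi>. unitary_rep G H \<pi> \<longrightarrow>
        (\<exists>\<xi>\<in>H. ell2_norm \<xi> = 1 \<and> (\<forall>g\<in>F. ell2_norm (\<lambda>n. \<pi> g \<xi> n - \<xi> n) < \<epsilon>)) \<longrightarrow>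
        (\<exists>\<eta>\<in>H. \<eta> \<noteq> (\<lambda>_. 0) \<and> (\<forall>g\<in>carrier G. \<pi> g \<eta> = \<eta>)))"

lemma property_T_kazhdan_pair:
  assumes "property_T G"
  obtains F \<epsilon> where "finite F" "kazhdan_pair G F \<epsilon>"
  using assms unfolding property_T_def kazhdan_pair_def by blast

lemma kazhdan_pairD:
  assumes "kazhdan_pair G F \<epsilon>" "unitary_rep G H \<pi>"
    and "\<exists>\<xi>\<in>H. ell2_norm \<xi> = 1 \<and> (\<forall>g\<in>F. ell2_norm (\<lambda>n. \<pi> g \<xi> n - \<xi> n) < \<epsilon>)"
  shows "\<exists>\<eta>\<in>H. \<eta> \<noteq> (\<lambda>_. 0) \<and> (\<forall>g\<in>carrier G. \<pi> g \<eta> = \<eta>)"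
  using assms unfolding kazhdan_pair_def by blast

text \<open>
  A measure preserving action whose identities hold at every point, not only almost everywhere.
  The locale covers the two probability spaces as well as a usually infinite measure on their product.
\<close>

locale strict_action = group G for G (structure) +
  fixes Z :: "'z measure" and T :: "'a \<Rightarrow> 'z \<Rightarrow> 'z"
  assumes meas: "g \<in> carrier G \<Longrightarrow> T g \<in> Z \<rightarrow>\<^sub>M Z"
    and preserving: "g \<in> carrier G \<Longrightarrow> distr Z Z (T g) = Z"
    and act_mult: "g \<in> carrier G \<Longrightarrow> h \<in> carrier G \<Longrightarrow> z \<in> space Z \<Longrightarrow> T (g \<otimes> h) z = T g (T h z)"
    and act_one: "z \<in> space Z \<Longrightarrow> T \<one> z = z"
begin

lemma act_space: "g \<in> carrier G \<Longrightarrow> z \<in> space Z \<Longrightarrow> T g z \<in> space Z"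
  using meas by (rule measurable_space)

lemma act_inv_left: "g \<in> carrier G \<Longrightarrow> z \<in> space Z \<Longrightarrow> T (inv g) (T g z) = z"
  using act_mult[of "inv g" g z] act_one by simp

lemma act_inv_right: "g \<in> carrier G \<Longrightarrow> z \<in> space Z \<Longrightarrow> T g (T (inv g) z) = z"
  using act_mult[of g "inv g" z] act_one by simp

definition koopman :: "'a \<Rightarrow> ('z \<Rightarrow> complex) \<Rightarrow> 'z \<Rightarrow> complex" where
  "koopman g f = (\<lambda>z. f (T (inv g) z))"

lemma koopman_add: "koopman g (\<lambda>z. f z + h z) = (\<lambda>z. koopman g f z + koopman g h z)"
  and koopman_diff: "koopman g (\<lambda>z. f z - h z) = (\<lambda>z. koopman g f z - koopman g h z)"
  and koopman_scale: "koopman g (\<lambda>z. c * f z) = (\<lambda>z. c * koopman g f z)"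
  by (simp_all add: koopman_def)

lemma sq_int_koopman:
  assumes g: "g \<in> carrier G" and f: "f \<in> sq_int Z"
  shows "koopman g f \<in> sq_int Z"
proof -
  note [measurable] = meas[OF inv_closed[OF g]] sq_int_measurable[OF f]
  have "integrable (distr Z Z (T (inv g))) (\<lambda>z. (cmod (f z))\<^sup>2)"
    using sq_int_integrable[OF f] preserving[OF inv_closed[OF g]] by simp
  then have "integrable Z (\<lambda>z. (cmod (f (T (inv g) z)))\<^sup>2)"
    by (subst (asm) integrable_distr_eq) measurable
  then show ?thesis by (simp add: sq_int_def koopman_def)
qed

lemma dot_koopman_koopman:
  assumes g: "g \<in> carrier G" and f: "f \<in> sq_int Z" and h: "h \<in> sq_int Z"
  shows "dot Z (koopman g f) (koopman g h) = dot Z f h"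
proof -
  note [measurable] = meas[OF inv_closed[OF g]] sq_int_measurable[OF f] sq_int_measurable[OF h]
  have "dot Z f h = (\<integral>z. f z * cnj (h z) \<partial>distr Z Z (T (inv g)))"
    using preserving[OF inv_closed[OF g]] by (simp add: dot_def)
  also have "\<dots> = dot Z (koopman g f) (koopman g h)"
    unfolding dot_def koopman_def by (rule integral_distr) measurable
  finally show ?thesis by simp
qed

lemma nrm_koopman: "g \<in> carrier G \<Longrightarrow> f \<in> sq_int Z \<Longrightarrow> nrm Z (koopman g f) = nrm Z f"
  using dot_koopman_koopman[of g f f] by (simp add: dot_self flip: of_real_power)

lemma koopman_mult:
  "g \<in> carrier G \<Longrightarrow> h \<in> carrier G \<Longrightarrow> z \<in> space Z \<Longrightarrow> koopman (g \<otimes> h) f z = koopman g (koopman h f) z"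
  by (simp add: koopman_def inv_mult_group act_mult)

lemma koopman_inv_right: "g \<in> carrier G \<Longrightarrow> z \<in> space Z \<Longrightarrow> koopman g (koopman (inv g) f) z = f z"
  by (simp add: koopman_def act_inv_right)

lemma dot_cong_space:
  "(\<And>z. z \<in> space Z \<Longrightarrow> f z = f' z) \<Longrightarrow> (\<And>z. z \<in> space Z \<Longrightarrow> h z = h' z) \<Longrightarrow> dot Z f h = dot Z f' h'"
  unfolding dot_def by (rule Bochner_Integration.integral_cong) auto

lemma dot_koopman_left:
  assumes g: "g \<in> carrier G" and f: "f \<in> sq_int Z" and h: "h \<in> sq_int Z"
  shows "dot Z (koopman g f) h = dot Z f (koopman (inv g) h)"
proof -
  have "dot Z (koopman g f) h = dot Z (koopman g f) (koopman g (koopman (inv g) h))"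
    by (rule dot_cong_space) (simp_all add: koopman_inv_right g)
  also have "\<dots> = dot Z f (koopman (inv g) h)"
    by (rule dot_koopman_koopman) (simp_all add: g f h sq_int_koopman)
  finally show ?thesis .
qed

definition cyclic_span :: "('z \<Rightarrow> complex) \<Rightarrow> ('z \<Rightarrow> complex) set" where
  "cyclic_span \<xi> = closed_span Z ((\<lambda>g. koopman g \<xi>) ` carrier G)"

lemma dot_koopman_one: "dot Z (koopman \<one> f) h = dot Z f h"
  by (rule dot_cong_space) (auto simp: koopman_def act_one)

lemma self_in_cyclic_span: "\<xi> \<in> sq_int Z \<Longrightarrow> \<xi> \<in> cyclic_span \<xi>"
  unfolding cyclic_span_def closed_span_def
  by (auto simp: dot_koopman_one dest: bspec[of _ _ "\<one>"])

lemma koopman_cyclic_span: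
  assumes xi: "\<xi> \<in> sq_int Z" and f: "f \<in> cyclic_span \<xi>" and g: "g \<in> carrier G"
  shows "koopman g f \<in> cyclic_span \<xi>"
proof -
  have fs: "f \<in> sq_int Z" using f closed_span_sq_int by (simp add: cyclic_span_def)
  show ?thesis
    unfolding cyclic_span_def closed_span_def
  proof (intro CollectI conjI ballI impI sq_int_koopman[OF g fs])
    fix h assume h: "h \<in> sq_int Z" and 0: "\<forall>v\<in>(\<lambda>g. koopman g \<xi>) ` carrier G. dot Z v h = 0"
    have "dot Z f (koopman (inv g) h) = 0"
      using f[unfolded cyclic_span_def]
    proof (rule closed_span_orthogonal)
      show "koopman (inv g) h \<in> sq_int Z" using g h by (simp add: sq_int_koopman)
      fix v assume "v \<in> (\<lambda>g. koopman g \<xi>) ` carrier G"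
      then obtain k where k: "k \<in> carrier G" "v = koopman k \<xi>" by blast
      have "dot Z v (koopman (inv g) h) = dot Z (koopman g v) h"
        unfolding k by (rule dot_koopman_left[symmetric]) (simp_all add: k g h xi sq_int_koopman)
      also have "\<dots> = dot Z (koopman (g \<otimes> k) \<xi>) h"
        unfolding k by (rule dot_cong_space) (simp_all add: k g koopman_mult)
      also have "\<dots> = 0" using 0 k g by simp
      finally show "dot Z v (koopman (inv g) h) = 0" .
    qed
    then show "dot Z (koopman g f) h = 0" by (simp add: dot_koopman_left g fs h)
  qed
qed

lemma cyclic_span_mono:
  assumes "\<xi> \<in> sq_int Z" "f \<in> cyclic_span \<xi>"
  shows "cyclic_span f \<subseteq> cyclic_span \<xi>"
  unfolding cyclic_span_def[of f]
  by (subst cyclic_span_def, rule closed_span_mono)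
     (auto simp: cyclic_span_def[symmetric] intro: koopman_cyclic_span assms)

definition invariant_vector :: "('z \<Rightarrow> complex) \<Rightarrow> bool" where
  "invariant_vector f \<longleftrightarrow> f \<in> sq_int Z \<and> (\<forall>g\<in>carrier G. nrm Z (\<lambda>z. koopman g f z - f z) = 0)"

lemma invariant_vector_diff_scale:
  assumes "invariant_vector f" "invariant_vector h"
  shows "invariant_vector (\<lambda>z. f z - c * h z)"
  unfolding invariant_vector_def
proof (intro conjI ballI)
  have f: "f \<in> sq_int Z" and h: "h \<in> sq_int Z" using assms by (auto simp: invariant_vector_def)
  show "(\<lambda>z. f z - c * h z) \<in> sq_int Z" by (intro sq_int_diff sq_int_scale f h)
  fix g assume g: "g \<in> carrier G"
  have "nrm Z (\<lambda>z. koopman g (\<lambda>z. f z - c * h z) z - (f z - c * h z))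
      = nrm Z (\<lambda>z. (koopman g f z - f z) + (- c) * (koopman g h z - h z))"
    by (simp add: koopman_diff koopman_scale algebra_simps)
  also have "\<dots> \<le> nrm Z (\<lambda>z. koopman g f z - f z) + nrm Z (\<lambda>z. (- c) * (koopman g h z - h z))"
    by (intro nrm_triangle sq_int_scale sq_int_diff sq_int_koopman f h g)
  also have "nrm Z (\<lambda>z. (- c) * (koopman g h z - h z)) = cmod (- c) * nrm Z (\<lambda>z. koopman g h z - h z)"
    by (rule nrm_scale)
  also have "nrm Z (\<lambda>z. koopman g f z - f z) + cmod (- c) * nrm Z (\<lambda>z. koopman g h z - h z) = 0"
    using assms g by (simp add: invariant_vector_def)
  finally show "nrm Z (\<lambda>z. koopman g (\<lambda>z. f z - c * h z) z - (f z - c * h z)) = 0"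
    using nrm_nonneg by (rule antisym)
qed

text \<open>
  An invariant vector orthogonal to \<open>\<xi>\<close> is orthogonal to the whole orbit of \<open>\<xi>\<close>. Consequently the
  invariant vectors in a cyclic subspace form a space of dimension at most one.
\<close>

lemma invariant_in_cyclic_span_eq_0:
  assumes xi: "\<xi> \<in> sq_int Z" and f: "f \<in> cyclic_span \<xi>" "invariant_vector f" and 0: "dot Z f \<xi> = 0"
  shows "nrm Z f = 0"
proof -
  have fs: "f \<in> sq_int Z" using f by (simp add: invariant_vector_def)
  have "dot Z f f = 0"
    using f(1)[unfolded cyclic_span_def] fs
  proof (rule closed_span_orthogonal)
    fix v assume "v \<in> (\<lambda>g. koopman g \<xi>) ` carrier G"
    then obtain g where g: "g \<in> carrier G" and v: "v = koopman g \<xi>" by blast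
    have "dot Z f v = dot Z (koopman g f) v"
      using dot_cong_AE[of "koopman g f" Z f v] f(2) g xi unfolding v
      by (auto simp: invariant_vector_def sq_int_koopman)
    also have "\<dots> = 0" unfolding v using 0 by (simp add: dot_koopman_koopman g fs xi)
    finally have "dot Z f v = 0" .
    then show "dot Z v f = 0" using dot_cnj[of Z v f] by simp
  qed
  then show ?thesis by (simp add: dot_self)
qed

lemma invariant_vector_AE:
  assumes f: "invariant_vector f" and g: "g \<in> carrier G"
  shows "AE z in Z. f (T g z) = f z"
proof -
  have fs: "f \<in> sq_int Z" using f by (simp add: invariant_vector_def)
  have "nrm Z (\<lambda>z. koopman (inv g) f z - f z) = 0" using f g by (simp add: invariant_vector_def)
  then have "AE z in Z. koopman (inv g) f z - f z = 0"
    by (subst (asm) nrm_eq_0_iff) (auto intro!: sq_int_diff sq_int_koopman simp: fs g)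
  then show ?thesis by (simp add: koopman_def g)
qed

text \<open>
  Gram-Schmidt coordinates of the orbit of \<open>\<xi>\<close> carry the Koopman representation on the cyclic
  subspace of \<open>\<xi>\<close> to a unitary representation on a closed subspace of \<open>\<ell>\<^sup>2(\<nat>)\<close>, to which the Kazhdan pair
  applies.
\<close>

lemma almost_invariant_imp_invariant:
  assumes countable: "countable (carrier G)"
    and K: "kazhdan_pair G F \<epsilon>"
    and xi: "\<xi> \<in> sq_int Z" "nrm Z \<xi> = 1" "\<And>g. g \<in> F \<Longrightarrow> nrm Z (\<lambda>z. koopman g \<xi> z - \<xi> z) < \<epsilon>"
  obtains \<eta> where "\<eta> \<in> cyclic_span \<xi>" "invariant_vector \<eta>" "nrm Z \<eta> \<noteq> 0"
proof -
  have F: "F \<subseteq> carrier G" using K by (simp add: kazhdan_pair_def)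
  define u where "u n = koopman (from_nat_into (carrier G) n) \<xi>" for n
  have range_u: "range u = (\<lambda>g. koopman g \<xi>) ` carrier G"
  proof -
    have "range u = (\<lambda>g. koopman g \<xi>) ` range (from_nat_into (carrier G))"
      by (auto simp: u_def)
    also have "range (from_nat_into (carrier G)) = carrier G"
      using countable one_closed by (intro range_from_nat_into) auto
    finally show ?thesis .
  qed
  have u: "u n \<in> sq_int Z" for n
    unfolding u_def using from_nat_into[of "carrier G"] one_closed by (intro sq_int_koopman xi) auto
  define S where "S = cyclic_span \<xi>"
  have S: "S = closed_span Z (range u)" by (simp add: S_def cyclic_span_def range_u)
  define c where "c = coords Z u"
  \<comment> \<open>Any preimage in \<open>S\<close> may be used: \<open>c\<close> identifies only functions at distance zero.\<close>
  define \<pi> where "\<pi> g v = c (koopman g (inv_into S c v))" for g v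
  note eq_iff = coords_eq_iff[of u Z, OF u, folded S c_def]
  have Ssq: "f \<in> sq_int Z" if "f \<in> S" for f using that unfolding S by (rule closed_span_sq_int)
  have SK: "koopman g f \<in> S" if "f \<in> S" "g \<in> carrier G" for f g
    using koopman_cyclic_span[OF xi(1)] that by (simp add: S_def)
  have c_koopman: "c (koopman g f) = c (koopman g f') \<longleftrightarrow> c f = c f'"
    if "f \<in> S" "f' \<in> S" "g \<in> carrier G" for f f' g
    using that nrm_koopman[of g "\<lambda>z. f z - f' z"]
    by (simp add: eq_iff SK sq_int_diff Ssq koopman_diff)
  have \<pi>: "\<pi> g (c f) = c (koopman g f)" if "f \<in> S" "g \<in> carrier G" for f g
    unfolding \<pi>_def
    using that f_inv_into_f[of "c f" c S] inv_into_into[of "c f" c S] by (subst c_koopman) simp_all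
  have add: "c (\<lambda>z. f z + h z) = (\<lambda>n. c f n + c h n)" if "f \<in> S" "h \<in> S" for f h
    unfolding c_def using that by (intro coords_add u Ssq)
  have scale: "c (\<lambda>z. a * f z) = (\<lambda>n. a * c f n)" for f a
    unfolding c_def by (rule coords_scale[OF u])
  have rep: "unitary_rep G (c ` S) \<pi>"
    unfolding unitary_rep_def
  proof (intro conjI ballI)
    show "closed_subspace_ell2 (c ` S)"
      unfolding S c_def by (rule closed_subspace_ell2_coords[OF u])
  next
    fix g assume g: "g \<in> carrier G"
    show "unitary_on (c ` S) (\<pi> g)"
      unfolding unitary_on_def
    proof (intro conjI ballI allI)
      show "bij_betw (\<pi> g) (c ` S) (c ` S)"
        unfolding bij_betw_def
      proof
        show "inj_on (\<pi> g) (c ` S)"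
          by (rule inj_onI) (auto simp: \<pi> g c_koopman)
        show "\<pi> g ` (c ` S) = c ` S"
        proof
          show "\<pi> g ` (c ` S) \<subseteq> c ` S" by (auto simp: \<pi> g SK)
          show "c ` S \<subseteq> \<pi> g ` (c ` S)"
          proof
            fix v assume "v \<in> c ` S"
            then obtain f where f: "f \<in> S" "v = c f" by blast
            have "\<pi> g (c (koopman (inv g) f)) = c (koopman g (koopman (inv g) f))"
              by (rule \<pi>) (simp_all add: SK f g)
            also have "\<dots> = v"
              unfolding f c_def coords_def fun_eq_iff
              by (intro allI dot_cong_space) (simp_all add: koopman_inv_right g)
            finally show "v \<in> \<pi> g ` (c ` S)" using SK[OF f(1) inv_closed[OF g]] by blast
          qed
        qed
      qed
    next
      fix x y assume "x \<in> c ` S" "y \<in> c ` S"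
      then obtain f h where fh: "x = c f" "f \<in> S" "y = c h" "h \<in> S" by blast
      have "(\<lambda>z. f z + h z) \<in> S" using fh unfolding S by (intro closed_span_add)
      from \<pi>[OF this g] show "\<pi> g (\<lambda>n. x n + y n) = (\<lambda>n. \<pi> g x n + \<pi> g y n)"
        by (simp add: fh \<pi> g add koopman_add SK)
      show "ell2_inner (\<pi> g x) (\<pi> g y) = ell2_inner x y"
        using ell2_inner_coords[of u Z, OF u, folded S c_def]
        by (simp add: fh \<pi> g SK Ssq dot_koopman_koopman)
    next
      fix a x assume "x \<in> c ` S"
      then obtain f where f: "x = c f" "f \<in> S" by blast
      have "(\<lambda>z. a * f z) \<in> S" using f unfolding S by (intro closed_span_scale)
      from \<pi>[OF this g] show "\<pi> g (\<lambda>n. a * x n) = (\<lambda>n. a * \<pi> g x n)"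
        by (simp add: f \<pi> g scale koopman_scale)
    qed
  next
    fix g h x assume g: "g \<in> carrier G" and h: "h \<in> carrier G" and "x \<in> c ` S"
    then obtain f where f: "x = c f" "f \<in> S" by blast
    have "c (koopman (g \<otimes> h) f) = c (koopman g (koopman h f))"
      unfolding c_def coords_def fun_eq_iff by (intro allI dot_cong_space) (simp_all add: koopman_mult g h)
    then show "\<pi> (g \<otimes> h) x = \<pi> g (\<pi> h x)" by (simp add: f \<pi> g h SK)
  qed
  have xiS: "\<xi> \<in> S" unfolding S_def by (rule self_in_cyclic_span[OF xi(1)])
  have norm_diff: "ell2_norm (\<lambda>n. \<pi> g (c f) n - c f n) = nrm Z (\<lambda>z. koopman g f z - f z)"
    if "f \<in> S" "g \<in> carrier G" for f g
    using ell2_norm_coords_diff[of u Z, OF u, folded S c_def, of "koopman g f" f] that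
    by (simp add: \<pi> SK)
  have "\<exists>\<eta>\<in>c ` S. \<eta> \<noteq> (\<lambda>_. 0) \<and> (\<forall>g\<in>carrier G. \<pi> g \<eta> = \<eta>)"
  proof (rule kazhdan_pairD[OF K rep], rule bexI[of _ "c \<xi>"], intro conjI ballI)
    show "ell2_norm (c \<xi>) = 1"
      using ell2_norm_coords[of u Z, OF u, folded S c_def, OF xiS] xi by simp
    show "ell2_norm (\<lambda>n. \<pi> g (c \<xi>) n - c \<xi> n) < \<epsilon>" if "g \<in> F" for g
      using that F xi(3)[of g] by (subst norm_diff[OF xiS]) auto
  qed (use xiS in simp)
  then obtain \<eta> where eta: "\<eta> \<in> S" "c \<eta> \<noteq> (\<lambda>_. 0)" "\<And>g. g \<in> carrier G \<Longrightarrow> \<pi> g (c \<eta>) = c \<eta>" by auto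
  show ?thesis
  proof (rule that)
    show "\<eta> \<in> cyclic_span \<xi>" using eta(1) by (simp add: S_def)
    show "invariant_vector \<eta>"
      using eta by (auto simp: invariant_vector_def Ssq \<pi> eq_iff SK)
    show "nrm Z \<eta> \<noteq> 0"
    proof
      assume "nrm Z \<eta> = 0"
      then have "c \<eta> = c (\<lambda>_. 0)"
        by (subst eq_iff) (use eta closed_span_zero in \<open>auto simp: S\<close>)
      then show False using eta(2) coords_zero[OF u] by (simp add: c_def)
    qed
  qed
qed

text \<open>
  There is a nonzero invariant vector \<open>\<eta>\<^sub>0\<close> in the cyclic subspace of \<open>\<xi>\<close>, and the projection of \<open>\<xi>\<close> onto its
  line is the vector wanted. If the remainder \<open>\<xi>'\<close> had norm greater than \<open>\<delta>\<close>, then, normalised, it would still be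
  almost invariant, so its own cyclic subspace would contain a nonzero invariant vector \<open>\<eta>\<^sub>1\<close>. Both
  vectors lie in the cyclic subspace of \<open>\<xi>\<close>, so \<open>\<eta>\<^sub>1\<close> is a multiple of \<open>\<eta>\<^sub>0\<close> and thus orthogonal to \<open>\<xi>'\<close>;
  this forces \<open>\<eta>\<^sub>1 = 0\<close>.
\<close>

lemma almost_invariant_near_invariant:
  assumes countable: "countable (carrier G)"
    and K: "kazhdan_pair G F \<epsilon>"
    and delta: "0 < \<delta>" "\<delta> \<le> 1"
    and xi: "\<xi> \<in> sq_int Z" "nrm Z \<xi> = 1" "\<And>g. g \<in> F \<Longrightarrow> nrm Z (\<lambda>z. koopman g \<xi> z - \<xi> z) < \<epsilon> * \<delta>"
  obtains \<eta> where "\<eta> \<in> sq_int Z" "nrm Z (\<lambda>z. \<xi> z - \<eta> z) \<le> \<delta>"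
    "\<And>g. g \<in> carrier G \<Longrightarrow> AE z in Z. \<eta> (T g z) = \<eta> z"
proof -
  have F: "F \<subseteq> carrier G" and eps: "\<epsilon> > 0" using K by (simp_all add: kazhdan_pair_def)
  have "\<epsilon> * \<delta> \<le> \<epsilon>" using eps delta by simp
  then have d0: "nrm Z (\<lambda>z. koopman g \<xi> z - \<xi> z) < \<epsilon>" if "g \<in> F" for g using xi(3)[OF that] by simp
  obtain \<eta>\<^sub>0 where eta0: "\<eta>\<^sub>0 \<in> cyclic_span \<xi>" "invariant_vector \<eta>\<^sub>0" "nrm Z \<eta>\<^sub>0 \<noteq> 0"
    by (rule almost_invariant_imp_invariant[OF countable K xi(1,2) d0])
  have e0: "\<eta>\<^sub>0 \<in> sq_int Z" using eta0(2) by (simp add: invariant_vector_def)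
  define n2 where "n2 = complex_of_real ((nrm Z \<eta>\<^sub>0)\<^sup>2)"
  have n2: "n2 \<noteq> 0" "dot Z \<eta>\<^sub>0 \<eta>\<^sub>0 = n2" using eta0(3) by (auto simp: n2_def dot_self)
  define a where "a = dot Z \<xi> \<eta>\<^sub>0 / n2"
  define \<xi>' where "\<xi>' z = \<xi> z - a * \<eta>\<^sub>0 z" for z
  have xi': "\<xi>' \<in> sq_int Z" unfolding \<xi>'_def by (intro sq_int_diff sq_int_scale xi e0)
  have perp: "dot Z \<xi>' \<eta>\<^sub>0 = 0"
  proof -
    have "a * n2 = dot Z \<xi> \<eta>\<^sub>0" using n2 by (simp add: a_def)
    then show ?thesis
      unfolding \<xi>'_def using n2 by (simp add: dot_diff_left sq_int_scale xi e0 dot_scale_left)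
  qed
  have inv_scaled: "invariant_vector (\<lambda>z. a * \<eta>\<^sub>0 z)"
  proof -
    have "invariant_vector (\<lambda>z. 0 * \<eta>\<^sub>0 z)"
      by (simp add: invariant_vector_def sq_int_zero koopman_def nrm_def)
    from invariant_vector_diff_scale[OF this eta0(2), of "-a"] show ?thesis by simp
  qed
  have small: "nrm Z \<xi>' \<le> \<delta>"
  proof (rule ccontr)
    assume "\<not> nrm Z \<xi>' \<le> \<delta>"
    then have big: "nrm Z \<xi>' > \<delta>" by simp
    define b where "b = complex_of_real (1 / nrm Z \<xi>')"
    define \<zeta> where "\<zeta> z = b * \<xi>' z" for z
    have z: "\<zeta> \<in> sq_int Z" unfolding \<zeta>_def by (intro sq_int_scale xi')
    have nz: "nrm Z \<zeta> = 1"
      unfolding \<zeta>_def nrm_scale b_def using big delta by (simp add: norm_divide)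
    have dz: "nrm Z (\<lambda>z. koopman g \<zeta> z - \<zeta> z) < \<epsilon>" if "g \<in> F" for g
    proof -
      have g: "g \<in> carrier G" using that F by auto
      have "nrm Z (\<lambda>z. koopman g \<xi>' z - \<xi>' z)
          = nrm Z (\<lambda>z. (koopman g \<xi> z - \<xi> z) + (-1) * (koopman g (\<lambda>z. a * \<eta>\<^sub>0 z) z - a * \<eta>\<^sub>0 z))"
        by (simp add: \<xi>'_def koopman_def algebra_simps)
      also have "\<dots> \<le> nrm Z (\<lambda>z. koopman g \<xi> z - \<xi> z)
          + nrm Z (\<lambda>z. (-1) * (koopman g (\<lambda>z. a * \<eta>\<^sub>0 z) z - a * \<eta>\<^sub>0 z))"
        by (intro nrm_triangle sq_int_scale sq_int_diff sq_int_koopman xi e0 g)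
      also have "\<dots> = nrm Z (\<lambda>z. koopman g \<xi> z - \<xi> z)"
        using inv_scaled g by (subst nrm_scale) (simp add: invariant_vector_def)
      also have "\<dots> < \<epsilon> * \<delta>" by (rule xi(3)[OF that])
      also have "\<dots> \<le> \<epsilon> * nrm Z \<xi>'" using big eps by simp
      finally have "nrm Z (\<lambda>z. koopman g \<xi>' z - \<xi>' z) < \<epsilon> * nrm Z \<xi>'" .
      moreover have "nrm Z (\<lambda>z. koopman g \<zeta> z - \<zeta> z) = cmod b * nrm Z (\<lambda>z. koopman g \<xi>' z - \<xi>' z)"
        unfolding nrm_scale[symmetric] by (simp add: \<zeta>_def koopman_def algebra_simps)
      moreover have "cmod b = 1 / nrm Z \<xi>'" by (simp add: b_def norm_divide)
      moreover have "nrm Z \<xi>' > 0" using big delta by linarith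
      ultimately show ?thesis by (simp add: pos_divide_less_eq)
    qed
    obtain \<eta>\<^sub>1 where eta1: "\<eta>\<^sub>1 \<in> cyclic_span \<zeta>" "invariant_vector \<eta>\<^sub>1" "nrm Z \<eta>\<^sub>1 \<noteq> 0"
      by (rule almost_invariant_imp_invariant[OF countable K z nz dz])
    have e1: "\<eta>\<^sub>1 \<in> sq_int Z" using eta1(2) by (simp add: invariant_vector_def)
    have "\<zeta> \<in> cyclic_span \<xi>"
      unfolding \<zeta>_def \<xi>'_def using eta0(1) self_in_cyclic_span[OF xi(1)]
      unfolding cyclic_span_def by (intro closed_span_scale closed_span_diff)
    then have e1S: "\<eta>\<^sub>1 \<in> cyclic_span \<xi>" using cyclic_span_mono[OF xi(1)] eta1(1) by blast
    have b0: "dot Z \<eta>\<^sub>0 \<xi> \<noteq> 0" using invariant_in_cyclic_span_eq_0[OF xi(1) eta0(1,2)] eta0(3) by blast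
    \<comment> \<open>Invariant vectors of a cyclic representation are determined by their inner product with the cyclic vector.\<close>
    define q where "q = dot Z \<eta>\<^sub>1 \<xi> / dot Z \<eta>\<^sub>0 \<xi>"
    define w where "w z = \<eta>\<^sub>1 z - q * \<eta>\<^sub>0 z" for z
    have w: "w \<in> sq_int Z" unfolding w_def by (intro sq_int_diff sq_int_scale e0 e1)
    have "nrm Z w = 0"
    proof (rule invariant_in_cyclic_span_eq_0[OF xi(1)])
      show "w \<in> cyclic_span \<xi>"
        unfolding w_def using e1S eta0(1) unfolding cyclic_span_def by (intro closed_span_diff closed_span_scale)
      show "invariant_vector w" unfolding w_def by (rule invariant_vector_diff_scale[OF eta1(2) eta0(2)])
      show "dot Z w \<xi> = 0"
      proof -
        have "q * dot Z \<eta>\<^sub>0 \<xi> = dot Z \<eta>\<^sub>1 \<xi>" using b0 by (simp add: q_def)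
        then show ?thesis
          unfolding w_def by (simp add: dot_diff_left sq_int_scale e0 e1 xi dot_scale_left)
      qed
    qed
    then have "dot Z w \<zeta> = 0" using cauchy_schwarz[OF w z] by simp
    moreover have "dot Z w \<zeta> = dot Z \<eta>\<^sub>1 \<zeta> - q * dot Z \<eta>\<^sub>0 \<zeta>"
      unfolding w_def by (simp add: dot_diff_left sq_int_scale e0 e1 z dot_scale_left)
    moreover have "dot Z \<eta>\<^sub>0 \<zeta> = 0"
      unfolding \<zeta>_def dot_scale_right using perp dot_cnj[of Z \<eta>\<^sub>0 \<xi>'] by simp
    ultimately have "dot Z \<eta>\<^sub>1 \<zeta> = 0" by simp
    then have "nrm Z \<eta>\<^sub>1 = 0" by (rule invariant_in_cyclic_span_eq_0[OF z eta1(1,2)])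
    then show False using eta1(3) by simp
  qed
  show ?thesis
  proof (rule that)
    show "(\<lambda>z. a * \<eta>\<^sub>0 z) \<in> sq_int Z" by (intro sq_int_scale e0)
    show "nrm Z (\<lambda>z. \<xi> z - a * \<eta>\<^sub>0 z) \<le> \<delta>" using small by (simp add: \<xi>'_def[abs_def])
    show "AE z in Z. a * \<eta>\<^sub>0 (T g z) = a * \<eta>\<^sub>0 z" if "g \<in> carrier G" for g
      using invariant_vector_AE[OF inv_scaled that] .
  qed
qed

end

section \<open>Actions defined everywhere\<close>

text \<open>
  This consequence of standardness makes the set where two measurable maps agree measurable, and
  hence graphs of measurable maps.
\<close>

definition countably_separated :: "'a measure \<Rightarrow> bool" where
  "countably_separated M \<longleftrightarrow>
     (\<exists>C. countable C \<and> C \<subseteq> sets M \<and>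
       (\<forall>x\<in>space M. \<forall>y\<in>space M. x \<noteq> y \<longrightarrow> (\<exists>c\<in>C. x \<in> c \<and> y \<notin> c)))"

lemma standard_countably_separated:
  assumes "standard_prob_space M"
  shows "countably_separated M"
proof -
  obtain T where T: "topspace T = space M" "completely_metrizable_space T" "second_countable T"
    "sets M = sigma_sets (space M) {U. openin T U}"
    using assms by (auto simp: standard_prob_space_def)
  obtain C where C: "countable C" "\<forall>V\<in>C. openin T V"
    "\<forall>U x. openin T U \<and> x \<in> U \<longrightarrow> (\<exists>V\<in>C. x \<in> V \<and> V \<subseteq> U)"
    using T(3) unfolding second_countable_def by (elim exE conjE) (rule that)
  have t1: "t1_space T"
    by (intro metrizable_imp_t1_space completely_metrizable_imp_metrizable_space T(2))
  show ?thesis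
    unfolding countably_separated_def
  proof (intro exI[of _ C] conjI ballI impI C(1))
    show "C \<subseteq> sets M" using C(2) by (auto simp: T(4) intro: sigma_sets.Basic)
    fix x y assume "x \<in> space M" "y \<in> space M" "x \<noteq> y"
    then have "\<exists>U. openin T U \<and> x \<in> U \<and> y \<notin> U"
      using t1 unfolding t1_space_def T(1)[symmetric] by simp
    then obtain U where U: "openin T U" "x \<in> U" "y \<notin> U" by blast
    then obtain V where "V \<in> C" "x \<in> V" "V \<subseteq> U" using C(3) by blast
    with U(3) show "\<exists>c\<in>C. x \<in> c \<and> y \<notin> c" by blast
  qed
qed

lemma pred_ball_countable:
  assumes "countable X" "\<And>i. i \<in> X \<Longrightarrow> Measurable.pred M (\<lambda>x. P i x)"
  shows "Measurable.pred M (\<lambda>x. \<forall>i\<in>X. P i x)"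
proof (cases "X = {}")
  case False
  have X: "(\<forall>i\<in>X. P i x) \<longleftrightarrow> (\<forall>n::nat. P (from_nat_into X n) x)" for x
  proof -
    have "(\<forall>i\<in>range (from_nat_into X). P i x) \<longleftrightarrow> (\<forall>n::nat. P (from_nat_into X n) x)" by simp
    then show ?thesis unfolding range_from_nat_into[OF False assms(1)] .
  qed
  show ?thesis
    unfolding X by (intro pred_intros_countable assms(2) from_nat_into[OF False])
qed simp

lemma measurable_eq_countably_separated:
  assumes N: "countably_separated N" and f: "f \<in> L \<rightarrow>\<^sub>M N" and g: "g \<in> L \<rightarrow>\<^sub>M N"
  shows "Measurable.pred L (\<lambda>x. f x = g x)"
proof -
  obtain C where C: "countable C" "C \<subseteq> sets N"
    "\<forall>x\<in>space N. \<forall>y\<in>space N. x \<noteq> y \<longrightarrow> (\<exists>c\<in>C. x \<in> c \<and> y \<notin> c)"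
    using N unfolding countably_separated_def by (elim exE conjE) (rule that)
  have "Measurable.pred L (\<lambda>x. \<forall>c\<in>C. f x \<in> c \<longrightarrow> g x \<in> c)"
  proof (intro pred_ball_countable pred_intros_logic)
    fix c assume "c \<in> C"
    then have [measurable]: "c \<in> sets N" using C(2) by auto
    show "Measurable.pred L (\<lambda>x. f x \<in> c)" "Measurable.pred L (\<lambda>x. g x \<in> c)"
      using f g by measurable
  qed (rule C(1))
  moreover have "(\<forall>c\<in>C. f x \<in> c \<longrightarrow> g x \<in> c) \<longleftrightarrow> f x = g x" if "x \<in> space L" for x
    using C(3) measurable_space[OF f that] measurable_space[OF g that] by metis
  ultimately show ?thesis by (subst measurable_cong) auto
qed

lemma mp_isosD:
  assumes "f \<in> mp_isos M N"
  shows "f \<in> M \<rightarrow>\<^sub>M N" "distr M N f = N" "ae_inverse M N f (mp_inv M N f)"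
  using assms someI_ex[of "ae_inverse M N f"] by (auto simp: mp_isos_def mp_inv_def)

lemma AE_mp_compose:
  assumes f: "f \<in> M \<rightarrow>\<^sub>M N" and d: "distr M N f = N" and P: "AE y in N. P y"
  shows "AE x in M. P (f x)"
proof (rule AE_distrD[OF f])
  show "AE y in distr M N f. P y" unfolding d by (rule P)
qed

text \<open>
  Since the group is countable, almost every point satisfies all identities of the action along its
  entire orbit. These points form an invariant measurable set, and off this set the group may act trivially.
\<close>

lemma strict_action_of_pmp_action:
  fixes G (structure)
  assumes "group G" and countable: "countable (carrier G)"
    and sep: "countably_separated M" and act: "pmp_action G M \<sigma>"
  obtains \<sigma>' where "strict_action G M \<sigma>'" "\<And>g. g \<in> carrier G \<Longrightarrow> AE x in M. \<sigma>' g x = \<sigma> g x"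
proof -
  interpret group G by fact
  have iso: "\<sigma> g \<in> mp_isos M M" if "g \<in> carrier G" for g
    using act that by (simp add: pmp_action_def)
  note sm = mp_isosD(1)[OF iso] and sp = mp_isosD(2)[OF iso]
  have mult: "AE x in M. \<sigma> (g \<otimes> h) x = \<sigma> g (\<sigma> h x)" if "g \<in> carrier G" "h \<in> carrier G" for g h
    using act that by (simp add: pmp_action_def)
  have one: "AE x in M. \<sigma> \<one> x = x"
  proof -
    define k where "k = mp_inv M M (\<sigma> \<one>)"
    have k: "AE x in M. k (\<sigma> \<one> x) = x"
      using mp_isosD(3)[OF iso[OF one_closed]] by (simp add: ae_inverse_def k_def)
    have k': "AE x in M. k (\<sigma> \<one> (\<sigma> \<one> x)) = \<sigma> \<one> x"
      by (rule AE_mp_compose[OF sm sp k]) simp_all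
    from mult[OF one_closed one_closed] k k' show ?thesis
      by eventually_elim simp
  qed
  define b where "b x \<longleftrightarrow> (\<forall>g\<in>carrier G. \<forall>h\<in>carrier G. \<sigma> (g \<otimes> h) x = \<sigma> g (\<sigma> h x))" for x
  have bD: "\<sigma> (g \<otimes> h) x = \<sigma> g (\<sigma> h x)" if "b x" "g \<in> carrier G" "h \<in> carrier G" for g h x
    using that by (simp add: b_def)
  define q where "q x \<longleftrightarrow> b x \<and> (\<forall>g\<in>carrier G. b (\<sigma> g x)) \<and> \<sigma> \<one> x = x" for x
  have AE_b: "AE x in M. b x"
    unfolding b_def using mult countable by (simp add: AE_ball_countable)
  have "AE x in M. b (\<sigma> g x)" if "g \<in> carrier G" for g
    by (rule AE_mp_compose[OF sm sp AE_b]) (fact that)+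
  then have AE_q: "AE x in M. q x"
    unfolding q_def using AE_b one countable by (simp add: AE_ball_countable)
  have pb: "Measurable.pred M b"
    unfolding b_def
    by (intro pred_ball_countable countable measurable_eq_countably_separated[OF sep]
        measurable_compose[OF sm sm] sm m_closed)
  have pq [measurable]: "Measurable.pred M q"
    unfolding q_def
    by (intro pred_intros_logic pred_ball_countable countable pb measurable_compose[OF sm pb]
        measurable_eq_countably_separated[OF sep] sm one_closed measurable_ident_sets refl)
      simp
  have q_act: "q (\<sigma> h x)" if "q x" "h \<in> carrier G" for h x
    unfolding q_def
  proof (intro conjI ballI)
    show "b (\<sigma> h x)" using that by (simp add: q_def)
    show "b (\<sigma> g (\<sigma> h x))" if g: "g \<in> carrier G" for g
    proof -
      have "\<sigma> g (\<sigma> h x) = \<sigma> (g \<otimes> h) x" using \<open>q x\<close> \<open>h \<in> carrier G\<close> g by (simp add: q_def b_def)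
      then show ?thesis using \<open>q x\<close> \<open>h \<in> carrier G\<close> g by (simp add: q_def)
    qed
    have "\<sigma> (\<one> \<otimes> h) x = \<sigma> \<one> (\<sigma> h x)"
      by (rule bD) (use that in \<open>simp_all add: q_def\<close>)
    then show "\<sigma> \<one> (\<sigma> h x) = \<sigma> h x" using that by simp
  qed
  define \<sigma>' where "\<sigma>' g x = (if q x then \<sigma> g x else x)" for g x
  have eq: "AE x in M. \<sigma>' g x = \<sigma> g x" for g
    using AE_q by eventually_elim (simp add: \<sigma>'_def)
  have m: "\<sigma>' g \<in> M \<rightarrow>\<^sub>M M" if "g \<in> carrier G" for g
    unfolding \<sigma>'_def by (intro measurable_If sm that) (use pq in \<open>simp_all add: pred_def\<close>)
  have "strict_action G M \<sigma>'"
  proof unfold_locales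
    fix g h x assume g: "g \<in> carrier G"
    show "\<sigma>' g \<in> M \<rightarrow>\<^sub>M M" by (rule m[OF g])
    show "distr M M (\<sigma>' g) = M"
      using distr_cong_AE[OF refl refl eq m[OF g] sm[OF g]] sp[OF g] by simp
    assume h: "h \<in> carrier G"
    show "\<sigma>' (g \<otimes> h) x = \<sigma>' g (\<sigma>' h x)"
      using q_act[OF _ h, of x] g h by (auto simp: \<sigma>'_def q_def b_def)
  next
    show "\<sigma>' \<one> x = x" for x by (simp add: \<sigma>'_def q_def)
  qed
  then show ?thesis by (rule that) (rule eq)
qed

section \<open>Partial isomorphisms\<close>

text \<open>
  Total maps avoid measurability on subspaces, and an explicit inverse makes restriction,
  composition and inversion symmetric in the two spaces.
\<close>

definition partial_iso ::
  "'a measure \<Rightarrow> 'b measure \<Rightarrow> 'a set \<Rightarrow> 'b set \<Rightarrow> ('a \<Rightarrow> 'b) \<Rightarrow> ('b \<Rightarrow> 'a) \<Rightarrow> bool" where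
  "partial_iso M N A B f g \<longleftrightarrow>
     A \<in> sets M \<and> B \<in> sets N \<and> f \<in> M \<rightarrow>\<^sub>M N \<and> g \<in> N \<rightarrow>\<^sub>M M \<and>
     (\<forall>x\<in>A. f x \<in> B \<and> g (f x) = x) \<and> (\<forall>y\<in>B. g y \<in> A \<and> f (g y) = y) \<and>
     (\<forall>C\<in>sets N. emeasure M {x\<in>A. f x \<in> C} = emeasure N (B \<inter> C))"

lemma partial_isoD:
  assumes "partial_iso M N A B f g"
  shows "A \<in> sets M" "B \<in> sets N" "f \<in> M \<rightarrow>\<^sub>M N" "g \<in> N \<rightarrow>\<^sub>M M"
    "\<And>x. x \<in> A \<Longrightarrow> f x \<in> B" "\<And>x. x \<in> A \<Longrightarrow> g (f x) = x"
    "\<And>y. y \<in> B \<Longrightarrow> g y \<in> A" "\<And>y. y \<in> B \<Longrightarrow> f (g y) = y"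
    "\<And>C. C \<in> sets N \<Longrightarrow> emeasure M {x\<in>A. f x \<in> C} = emeasure N (B \<inter> C)"
    "A \<subseteq> space M" "B \<subseteq> space N"
  using assms sets.sets_into_space[of A M] sets.sets_into_space[of B N]
  unfolding partial_iso_def by simp_all

lemma partial_iso_sym:
  assumes "partial_iso M N A B f g"
  shows "partial_iso N M B A g f"
proof -
  note p = partial_isoD[OF assms]
  have "emeasure N {y\<in>B. g y \<in> D} = emeasure M (A \<inter> D)" if D: "D \<in> sets M" for D
  proof -
    have C: "g -` D \<inter> space N \<in> sets N" by (rule measurable_sets[OF p(4) D])
    have "{y\<in>B. g y \<in> D} = B \<inter> (g -` D \<inter> space N)" using p(11) by auto
    moreover have "{x\<in>A. f x \<in> g -` D \<inter> space N} = A \<inter> D"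
      using p(5,6,11) by auto
    ultimately show ?thesis using p(9)[OF C] by simp
  qed
  then show ?thesis unfolding partial_iso_def using p by auto
qed

lemma partial_iso_emeasure_eq:
  assumes "partial_iso M N A B f g"
  shows "emeasure M A = emeasure N B"
proof -
  note p = partial_isoD[OF assms]
  have "{x\<in>A. f x \<in> space N} = A" "B \<inter> space N = B" using p(5,11) by auto
  then show ?thesis using p(9)[of "space N"] by simp
qed

lemma partial_iso_restrict:
  assumes "partial_iso M N A B f g" and A': "A' \<in> sets M" "A' \<subseteq> A"
    and B': "B' = {y\<in>B. g y \<in> A'}"
  shows "partial_iso M N A' B' f g"
proof -
  note p = partial_isoD[OF assms(1)]
  have C': "g -` A' \<inter> space N \<in> sets N" by (rule measurable_sets[OF p(4) A'(1)])
  have B'': "B' = B \<inter> (g -` A' \<inter> space N)" using p(11) B' by auto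
  have "emeasure M {x\<in>A'. f x \<in> C} = emeasure N (B' \<inter> C)" if C: "C \<in> sets N" for C
  proof -
    have "{x\<in>A. f x \<in> C \<inter> (g -` A' \<inter> space N)} = {x\<in>A'. f x \<in> C}"
      using p(5,6,11) A'(2) by auto
    moreover have "B \<inter> (C \<inter> (g -` A' \<inter> space N)) = B' \<inter> C" by (auto simp: B'')
    ultimately show ?thesis using p(9)[OF sets.Int[OF C C']] by simp
  qed
  moreover have "B' \<in> sets N" unfolding B'' by (rule sets.Int[OF p(2) C'])
  moreover have "f x \<in> B'" "g (f x) = x" if "x \<in> A'" for x
    using that A'(2) p(5,6)[of x] by (auto simp: B')
  moreover have "g y \<in> A'" "f (g y) = y" if "y \<in> B'" for y
    using that p(8)[of y] by (auto simp: B')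
  ultimately show ?thesis
    unfolding partial_iso_def using p(3,4) A'(1) by simp
qed

lemma partial_iso_compose:
  assumes "partial_iso M N A B f g" "partial_iso N K B C f' g'"
  shows "partial_iso M K A C (\<lambda>x. f' (f x)) (\<lambda>z. g (g' z))"
proof -
  note p = partial_isoD[OF assms(1)] and q = partial_isoD[OF assms(2)]
  have "emeasure M {x\<in>A. f' (f x) \<in> D} = emeasure K (C \<inter> D)" if D: "D \<in> sets K" for D
  proof -
    have E: "f' -` D \<inter> space N \<in> sets N" by (rule measurable_sets[OF q(3) D])
    have "{x\<in>A. f' (f x) \<in> D} = {x\<in>A. f x \<in> f' -` D \<inter> space N}" using p(5,11) by auto
    also have "emeasure M \<dots> = emeasure N (B \<inter> (f' -` D \<inter> space N))" by (rule p(9)[OF E])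
    also have "B \<inter> (f' -` D \<inter> space N) = {y\<in>B. f' y \<in> D}" using p(11) by auto
    finally show ?thesis using q(9)[OF D] by simp
  qed
  then show ?thesis
    unfolding partial_iso_def
    using p(1,5-8) q(2,5-8) measurable_compose[OF p(3) q(3)] measurable_compose[OF q(4) p(4)] by simp
qed

lemma partial_iso_id: "partial_iso M M (space M) (space M) (\<lambda>x. x) (\<lambda>x. x)"
  unfolding partial_iso_def using sets.sets_into_space by (auto intro!: arg_cong[where f="emeasure M"])

lemma measurable_select:
  assumes F: "\<And>n. F n \<in> M \<rightarrow>\<^sub>M N" and A: "\<And>n::nat. A n \<in> sets M"
  shows "(\<lambda>x. F (LEAST n. x \<in> A n) x) \<in> M \<rightarrow>\<^sub>M N"
proof (rule measurable_compose_countable[OF F])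
  show "(\<lambda>x. LEAST n. x \<in> A n) \<in> M \<rightarrow>\<^sub>M count_space UNIV"
    using A by (intro measurable_Least) (simp add: pred_sets1)
qed

lemma Least_disjoint_family:
  fixes A :: "nat \<Rightarrow> 'a set"
  assumes "disjoint_family A" "x \<in> A n"
  shows "(LEAST n. x \<in> A n) = n"
proof -
  have "(x \<in> A m) = (m = n)" for m
    using assms unfolding disjoint_family_on_def by (metis IntI UNIV_I empty_iff)
  then show ?thesis by (auto intro: Least_equality)
qed

lemma partial_iso_glue:
  assumes iso: "\<And>n::nat. partial_iso M N (A n) (B n) (F n) (H n)"
    and disj: "disjoint_family A" "disjoint_family B"
  obtains f g where "partial_iso M N (\<Union>n. A n) (\<Union>n. B n) f g"
    "\<And>n x. x \<in> A n \<Longrightarrow> f x = F n x" "\<And>n y. y \<in> B n \<Longrightarrow> g y = H n y"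
proof -
  note p = partial_isoD[OF iso]
  define f where "f x = F (LEAST n. x \<in> A n) x" for x
  define g where "g y = H (LEAST n. y \<in> B n) y" for y
  have f: "f x = F n x" if "x \<in> A n" for n x
    using that by (simp add: f_def Least_disjoint_family[OF disj(1)])
  have g: "g y = H n y" if "y \<in> B n" for n y
    using that by (simp add: g_def Least_disjoint_family[OF disj(2)])
  have "emeasure M {x\<in>\<Union>n. A n. f x \<in> C} = emeasure N ((\<Union>n. B n) \<inter> C)" if C: "C \<in> sets N" for C
  proof -
    have s: "{x\<in>A n. F n x \<in> C} \<in> sets M" for n
    proof -
      have "{x\<in>A n. F n x \<in> C} = A n \<inter> (F n -` C \<inter> space M)" using p(10) by auto
      then show ?thesis using measurable_sets[OF p(3) C] p(1) by simp
    qed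
    have "{x\<in>\<Union>n. A n. f x \<in> C} = (\<Union>n. {x\<in>A n. F n x \<in> C})" by (auto simp: f)
    also have "emeasure M \<dots> = (\<Sum>n. emeasure M {x\<in>A n. F n x \<in> C})"
      using disj(1) s by (intro suminf_emeasure[symmetric]) (auto simp: disjoint_family_on_def)
    also have "\<dots> = (\<Sum>n. emeasure N (B n \<inter> C))" by (simp add: p(9)[OF C])
    also have "\<dots> = emeasure N (\<Union>n. B n \<inter> C)"
      using disj(2) p(2) C by (intro suminf_emeasure) (auto simp: disjoint_family_on_def)
    finally show ?thesis by (simp add: Int_UN_distrib2)
  qed
  moreover have "f \<in> M \<rightarrow>\<^sub>M N" "g \<in> N \<rightarrow>\<^sub>M M"
    using measurable_select[of F M N A, OF p(3) p(1)] measurable_select[of H N M B, OF p(4) p(2)]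
    by (simp_all add: f_def[abs_def] g_def[abs_def])
  ultimately have "partial_iso M N (\<Union>n. A n) (\<Union>n. B n) f g"
    unfolding partial_iso_def
  proof (intro conjI ballI)
    fix x assume "x \<in> (\<Union>n. A n)"
    then obtain n where n: "x \<in> A n" by blast
    show "f x \<in> (\<Union>n. B n)" "g (f x) = x"
      using p(5,6)[OF n] f[OF n] g[of "f x" n] by auto
  next
    fix y assume "y \<in> (\<Union>n. B n)"
    then obtain n where n: "y \<in> B n" by blast
    show "g y \<in> (\<Union>n. A n)" "f (g y) = y"
      using p(7,8)[OF n] g[OF n] f[of "g y" n] by auto
  qed (use p(1,2) in auto)
  then show ?thesis using f g by (rule that)
qed

lemma partial_iso_imp_mp_iso:
  assumes iso: "partial_iso M N A B f g" and A: "AE x in M. x \<in> A" and B: "AE y in N. y \<in> B"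
  shows "f \<in> mp_isos M N" "ae_inverse M N f g"
proof -
  note p = partial_isoD[OF iso]
  have "distr M N f = N"
  proof (rule measure_eqI)
    fix C assume "C \<in> sets (distr M N f)"
    then have C: "C \<in> sets N" by simp
    have pre: "f -` C \<inter> space M \<in> sets M" by (rule measurable_sets[OF p(3) C])
    have "{x\<in>A. f x \<in> C} = A \<inter> (f -` C \<inter> space M)" using p(10) by auto
    then have "emeasure M (f -` C \<inter> space M) = emeasure M {x\<in>A. f x \<in> C}"
      using A pre p(1) by (intro emeasure_eq_AE) auto
    also have "\<dots> = emeasure N C"
      unfolding p(9)[OF C] using B C p(2) by (intro emeasure_eq_AE) auto
    finally show "emeasure (distr M N f) C = emeasure N C" by (simp add: emeasure_distr p(3) C)
  qed simp
  moreover show inv: "ae_inverse M N f g"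
    unfolding ae_inverse_def using A B p by auto
  ultimately show "f \<in> mp_isos M N" using p(3) by (auto simp: mp_isos_def)
qed

lemma mp_iso_partial_iso:
  assumes f: "f \<in> mp_isos M N" and k: "ae_inverse M N f k"
    and M: "countably_separated M" and N: "countably_separated N"
  shows "partial_iso M N {x\<in>space M. k (f x) = x} {y\<in>space N. f (k y) = y} f k"
proof -
  note fm = mp_isosD(1)[OF f] and fd = mp_isosD(2)[OF f]
  have km: "k \<in> N \<rightarrow>\<^sub>M M" and kf: "AE x in M. k (f x) = x" and fk: "AE y in N. f (k y) = y"
    using k by (auto simp: ae_inverse_def)
  have A: "{x\<in>space M. k (f x) = x} \<in> sets M"
    using measurable_eq_countably_separated[OF M measurable_compose[OF fm km] measurable_ident_sets[OF refl]]
    by (simp add: pred_def)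
  have B: "{y\<in>space N. f (k y) = y} \<in> sets N"
    using measurable_eq_countably_separated[OF N measurable_compose[OF km fm] measurable_ident_sets[OF refl]]
    by (simp add: pred_def)
  have "emeasure M {x\<in>{x\<in>space M. k (f x) = x}. f x \<in> C} = emeasure N ({y\<in>space N. f (k y) = y} \<inter> C)"
    if C: "C \<in> sets N" for C
  proof -
    have pre: "f -` C \<inter> space M \<in> sets M" by (rule measurable_sets[OF fm C])
    have "{x\<in>{x\<in>space M. k (f x) = x}. f x \<in> C} = {x\<in>space M. k (f x) = x} \<inter> (f -` C \<inter> space M)" by auto
    then have "emeasure M {x\<in>{x\<in>space M. k (f x) = x}. f x \<in> C} = emeasure M (f -` C \<inter> space M)"
      using kf A pre by (auto intro!: emeasure_eq_AE elim: AE_mp)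
    also have "\<dots> = emeasure (distr M N f) C" by (simp add: emeasure_distr fm C)
    also have "\<dots> = emeasure N ({y\<in>space N. f (k y) = y} \<inter> C)"
      unfolding fd using fk AE_space B C by (intro emeasure_eq_AE) (auto elim: AE_mp)
    finally show ?thesis .
  qed
  then show ?thesis
    unfolding partial_iso_def using A B fm km measurable_space[OF fm] measurable_space[OF km] by auto
qed

text \<open>
  The domain of the \<open>n\<close>-th power of the partial map \<open>g\<close> consists of the points whose first \<open>n\<close> iterates,
  starting with the point itself, lie in the domain \<open>B\<close> of \<open>g\<close>.
\<close>

lemma partial_iso_funpow:
  assumes iso: "partial_iso M M A B f g"
  shows "partial_iso M M {x\<in>space M. \<forall>i<n. (g ^^ i) x \<in> B} {y\<in>space M. \<forall>i<n. (f ^^ i) y \<in> A} (g ^^ n) (f ^^ n)"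
proof (induction n)
  case 0
  have 0: "g ^^ 0 = (\<lambda>x. x)" "f ^^ 0 = (\<lambda>x. x)"
    "{x\<in>space M. \<forall>i<0. (g ^^ i) x \<in> B} = space M" "{y\<in>space M. \<forall>i<0. (f ^^ i) y \<in> A} = space M"
    by (simp_all add: fun_eq_iff)
  show ?case unfolding 0 by (rule partial_iso_id)
next
  case (Suc n)
  let ?B = "\<lambda>n. {x\<in>space M. \<forall>i<n. (g ^^ i) x \<in> B}" and ?A = "\<lambda>n. {y\<in>space M. \<forall>i<n. (f ^^ i) y \<in> A}"
  note p = partial_isoD[OF iso] and q = partial_isoD[OF Suc]
  have "partial_iso M M (A \<inter> ?B n) {x\<in>B. g x \<in> A \<inter> ?B n} f g"
    by (rule partial_iso_restrict[OF iso sets.Int[OF p(1) q(1)] Int_lower1 refl])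
  then have 1: "partial_iso M M {x\<in>B. g x \<in> A \<inter> ?B n} (A \<inter> ?B n) g f"
    by (rule partial_iso_sym)
  have 2: "partial_iso M M (A \<inter> ?B n) {y\<in>?A n. (f ^^ n) y \<in> A \<inter> ?B n} (g ^^ n) (f ^^ n)"
    by (rule partial_iso_restrict[OF Suc sets.Int[OF p(1) q(1)] Int_lower2 refl])
  have "{x\<in>B. g x \<in> A \<inter> ?B n} = ?B (Suc n)"
    using p(7,10,11) by (auto simp: less_Suc_eq_0_disj funpow_swap1)
  moreover have "{y\<in>?A n. (f ^^ n) y \<in> A \<inter> ?B n} = ?A (Suc n)"
    using q(7) by (auto simp: less_Suc_eq)
  ultimately show ?case
    using partial_iso_compose[OF 1 2] by (simp add: funpow_swap1 comp_def)
qed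

text \<open>
  Let \<open>W\<close> be the set of points outside \<open>A\<close> whose iterates under \<open>g\<close> stay in \<open>B\<close> forever. Its images under the
  powers of \<open>g\<close> have equal measure and are disjoint, because \<open>W\<close> misses the range \<open>A\<close> of \<open>g\<close>. In a
  finite measure space this is only possible if \<open>W\<close> is null.
\<close>

lemma partial_iso_recurrence:
  assumes iso: "partial_iso M M A B f g" and "prob_space M"
  shows "AE x in M. x \<in> A \<or> (\<exists>n. (g ^^ n) x \<notin> B)"
proof -
  interpret prob_space M by fact
  note p = partial_isoD[OF iso]
  have [measurable]: "A \<in> sets M" "B \<in> sets M" "g \<in> M \<rightarrow>\<^sub>M M" by (fact p)+
  have gn [measurable]: "g ^^ n \<in> M \<rightarrow>\<^sub>M M" for n by (rule measurable_compose_n) (rule p(4))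
  define W where "W = {x\<in>space M. x \<notin> A \<and> (\<forall>n. (g ^^ n) x \<in> B)}"
  have W [measurable]: "W \<in> sets M" unfolding W_def by measurable
  define V where "V n = {y\<in>{y\<in>space M. \<forall>i<n. (f ^^ i) y \<in> A}. (f ^^ n) y \<in> W}" for n
  have V: "partial_iso M M W (V n) (g ^^ n) (f ^^ n)" for n
    unfolding V_def by (rule partial_iso_restrict[OF partial_iso_funpow[OF iso, of n]]) (use W in \<open>auto simp: W_def\<close>)
  have VW: "measure M (V n) = measure M W" for n
    using partial_iso_emeasure_eq[OF V[of n]] by (simp add: measure_def)
  have "V i \<inter> V j = {}" if "i < j" for i j using that by (auto simp: V_def W_def)
  then have "disjoint_family V"
    unfolding disjoint_family_on_def by (metis Int_commute linorder_neqE_nat)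
  then have "(\<lambda>n. measure M (V n)) sums measure M (\<Union>n. V n)"
    using partial_isoD(2)[OF V] by (intro finite_measure_UNION) auto
  then have "summable (\<lambda>n::nat. measure M W)" by (simp add: VW sums_iff)
  then have "measure M W = 0" by (rule summable_const_iff[THEN iffD1])
  then have "emeasure M W = 0" by (simp add: emeasure_eq_measure)
  then have "AE x in M. x \<notin> W" by (intro AE_not_in null_setsI W)
  with AE_space show ?thesis by eventually_elim (auto simp: W_def)
qed

lemma first_exit:
  assumes "x \<in> S" "x \<notin> A" "\<exists>n. (g ^^ n) x \<notin> B"
  shows "\<exists>n. x \<in> {x\<in>S. x \<notin> A \<and> (\<forall>i<n. (g ^^ i) x \<in> B) \<and> (g ^^ n) x \<notin> B}"
proof -
  define n where "n = (LEAST n. (g ^^ n) x \<notin> B)"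
  have "(g ^^ n) x \<notin> B" unfolding n_def by (rule LeastI_ex[OF assms(3)])
  moreover have "(g ^^ i) x \<in> B" if "i < n" for i using not_less_Least that unfolding n_def by blast
  ultimately show ?thesis using assms(1,2) by blast
qed

text \<open>
  In finite measure, \<open>A\<close> and \<open>B\<close> being equivariantly isomorphic implies the same for their complements.
  The complement of \<open>A\<close> is cut into the sets \<open>R n\<close> of points that leave \<open>B\<close> after exactly \<open>n\<close> applications of \<open>g\<close>,
  the complement of \<open>B\<close> likewise into sets \<open>L n\<close> using \<open>f\<close>, and the \<open>n\<close>-th power of \<open>g\<close> maps \<open>R n\<close> onto \<open>L n\<close>.
  By recurrence these sets exhaust the two complements up to null sets.
\<close>

lemma extend_equivariant_partial_iso:
  fixes G (structure)
  assumes "strict_action G M T" and "prob_space M"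
    and iso: "partial_iso M M A B f g"
    and A_inv: "\<And>s x. s \<in> carrier G \<Longrightarrow> x \<in> A \<Longrightarrow> T s x \<in> A"
    and equi: "\<And>s x. s \<in> carrier G \<Longrightarrow> x \<in> A \<Longrightarrow> f (T s x) = T s (f x)"
  obtains h where "h \<in> mp_isos M M" "\<And>x. x \<in> A \<Longrightarrow> h x = f x"
    "\<And>s. s \<in> carrier G \<Longrightarrow> AE x in M. h (T s x) = T s (h x)"
proof -
  interpret strict_action G M T by fact
  note p = partial_isoD[OF iso]
  have B_inv: "T s y \<in> B" if "s \<in> carrier G" "y \<in> B" for s y
    using that p(5)[OF A_inv[of s "g y"]] equi[of s "g y"] p(7,8) by simp
  have equi': "g (T s y) = T s (g y)" if "s \<in> carrier G" "y \<in> B" for s y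
    using that equi[of s "g y"] p(6)[OF A_inv[of s "g y"]] p(7,8) by simp
  have A_not: "T s x \<notin> A" if "s \<in> carrier G" "x \<in> space M" "x \<notin> A" for s x
    using that A_inv[of "inv s" "T s x"] act_inv_left[of s x] by auto
  have B_not: "T s x \<notin> B" if "s \<in> carrier G" "x \<in> space M" "x \<notin> B" for s x
    using that B_inv[of "inv s" "T s x"] act_inv_left[of s x] by auto
  define R where "R n = {x\<in>space M. x \<notin> A \<and> (\<forall>i<n. (g ^^ i) x \<in> B) \<and> (g ^^ n) x \<notin> B}" for n
  define L where "L n = {y\<in>space M. y \<notin> B \<and> (\<forall>i<n. (f ^^ i) y \<in> A) \<and> (f ^^ n) y \<notin> A}" for n
  have [measurable]: "A \<in> sets M" "B \<in> sets M" "g \<in> M \<rightarrow>\<^sub>M M" by (fact p)+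
  have gn [measurable]: "g ^^ n \<in> M \<rightarrow>\<^sub>M M" for n by (rule measurable_compose_n) (rule p(4))
  have "R n \<in> sets M" for n unfolding R_def by measurable
  then have RL: "partial_iso M M (R n) (L n) (g ^^ n) (f ^^ n)" for n
    using partial_isoD(7,8,10)[OF partial_iso_funpow[OF iso, of n]]
    by (intro partial_iso_restrict[OF partial_iso_funpow[OF iso, of n]]) (auto simp: R_def L_def)
  define A' where "A' = case_nat A R"
  define B' where "B' = case_nat B L"
  \<comment> \<open>The given partial isomorphism becomes piece \<open>0\<close> and the \<open>n\<close>-th exit piece becomes piece \<open>Suc n\<close>.\<close>
  have pieces: "partial_iso M M (A' n) (B' n) (case_nat f (\<lambda>n. g ^^ n) n) (case_nat g (\<lambda>n. f ^^ n) n)" for n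
    using iso RL by (simp add: A'_def B'_def split: nat.split)
  have RR: "R i \<inter> R j = {}" "L i \<inter> L j = {}" if "i < j" for i j using that by (auto simp: R_def L_def)
  have AR: "A \<inter> R i = {}" "B \<inter> L i = {}" for i by (auto simp: R_def L_def)
  have "A' i \<inter> A' j = {} \<and> B' i \<inter> B' j = {}" if "i < j" for i j
    using that RR[of "i - 1" "j - 1"] AR by (auto simp: A'_def B'_def split: nat.splits)
  then have disj: "disjoint_family A'" "disjoint_family B'"
    unfolding disjoint_family_on_def by (metis Int_commute linorder_neqE_nat)+
  obtain h h' where h: "partial_iso M M (\<Union>n. A' n) (\<Union>n. B' n) h h'"
    "\<And>n x. x \<in> A' n \<Longrightarrow> h x = (case_nat f (\<lambda>n. g ^^ n) n) x"
    by (rule partial_iso_glue[OF pieces disj]) blast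
  have hA: "h x = f x" if "x \<in> A" for x using h(2)[of x 0] that by (simp add: A'_def)
  have hR: "h x = (g ^^ n) x" if "x \<in> R n" for x n using h(2)[of x "Suc n"] that by (simp add: A'_def)
  have inA: "x \<in> (\<Union>n. A' n)" if x: "x \<in> space M" "x \<in> A \<or> (\<exists>n. (g ^^ n) x \<notin> B)" for x
  proof (cases "x \<in> A")
    case True
    then show ?thesis by (intro UN_I[of 0]) (simp_all add: A'_def)
  next
    case False
    then obtain n where "x \<in> R n" using first_exit[of x "space M" A g B] x unfolding R_def by blast
    then show ?thesis by (intro UN_I[of "Suc n"]) (simp_all add: A'_def)
  qed
  have AE_A: "AE x in M. x \<in> (\<Union>n. A' n)"
    using partial_iso_recurrence[OF iso \<open>prob_space M\<close>] AE_space by eventually_elim (rule inA; assumption)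
  have inB: "x \<in> (\<Union>n. B' n)" if x: "x \<in> space M" "x \<in> B \<or> (\<exists>n. (f ^^ n) x \<notin> A)" for x
  proof (cases "x \<in> B")
    case True
    then show ?thesis by (intro UN_I[of 0]) (simp_all add: B'_def)
  next
    case False
    then obtain n where "x \<in> L n" using first_exit[of x "space M" B f A] x unfolding L_def by blast
    then show ?thesis by (intro UN_I[of "Suc n"]) (simp_all add: B'_def)
  qed
  have AE_B: "AE x in M. x \<in> (\<Union>n. B' n)"
    using partial_iso_recurrence[OF partial_iso_sym[OF iso] \<open>prob_space M\<close>] AE_space
    by eventually_elim (rule inB; assumption)
  have gB: "(g ^^ n) (T s x) = T s ((g ^^ n) x)"
    if "s \<in> carrier G" "\<forall>i<n. (g ^^ i) x \<in> B" for s n x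
    using that by (induction n) (auto simp: equi')
  have R_equi: "T s x \<in> R n \<and> (g ^^ n) (T s x) = T s ((g ^^ n) x)" if s: "s \<in> carrier G" and x: "x \<in> R n" for s n x
  proof -
    have gs: "(g ^^ n) x \<in> space M" using x measurable_space[OF gn] by (auto simp: R_def)
    have "(g ^^ i) (T s x) \<in> B" if "i < n" for i
      using that x gB[OF s, of i x] B_inv[OF s] by (auto simp: R_def)
    moreover have eq: "(g ^^ n) (T s x) = T s ((g ^^ n) x)" using x by (intro gB s) (auto simp: R_def)
    moreover have "T s ((g ^^ n) x) \<notin> B" using x gs by (intro B_not s) (auto simp: R_def)
    moreover have "T s x \<notin> A" "T s x \<in> space M" using x s by (auto simp: R_def A_not act_space)
    ultimately show ?thesis by (simp add: R_def)
  qed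
  show ?thesis
  proof (rule that)
    show "h \<in> mp_isos M M" by (rule partial_iso_imp_mp_iso[OF h(1) AE_A AE_B])
    show "h x = f x" if "x \<in> A" for x by (rule hA[OF that])
    fix s assume s: "s \<in> carrier G"
    show "AE x in M. h (T s x) = T s (h x)"
      using AE_A
    proof eventually_elim
      fix x assume "x \<in> (\<Union>n. A' n)"
      then obtain n where n: "x \<in> A' n" by blast
      show "h (T s x) = T s (h x)"
      proof (cases n)
        case 0
        then show ?thesis using n A_inv[OF s] equi[OF s] by (simp add: A'_def hA)
      next
        case (Suc m)
        then show ?thesis
          using n R_equi[OF s, of x m] hR[of x m] hR[of "T s x" m] by (simp add: A'_def)
      qed
    qed
  qed
qed

section \<open>The orbit of a graph\<close>

lemma emeasure_count_space_bij:
  "bij_betw f S S' \<Longrightarrow> emeasure (count_space UNIV) S = emeasure (count_space UNIV) S'"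
  using bij_betw_finite[of f S S'] bij_betw_same_card[of f S S'] by (simp add: emeasure_count_space)

text \<open>
  Two everywhere defined actions and an isomorphism \<open>\<theta>\<close> with almost everywhere inverse \<open>k\<close>. Its translates
  are the isomorphisms \<open>\<rho>\<^sub>g \<theta> \<sigma>\<^sub>g\<^sup>-\<^sup>1\<close>.
\<close>

locale graph_system =
  X: strict_action G M \<sigma> + Y: strict_action G N \<rho>
  for G (structure) and M :: "'x measure" and \<sigma> and N :: "'y measure" and \<rho> +
  fixes \<theta> :: "'x \<Rightarrow> 'y" and k :: "'y \<Rightarrow> 'x"
  assumes countable_carrier: "countable (carrier G)"
    and sep_M: "countably_separated M" and sep_N: "countably_separated N"
    and prob_M: "prob_space M"
    and iso: "\<theta> \<in> mp_isos M N" and inverse: "ae_inverse M N \<theta> k"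
begin

lemma \<theta>_meas: "\<theta> \<in> M \<rightarrow>\<^sub>M N" and \<theta>_distr: "distr M N \<theta> = N"
  using mp_isosD[OF iso] by auto

lemma k_meas: "k \<in> N \<rightarrow>\<^sub>M M" and k_\<theta>: "AE x in M. k (\<theta> x) = x" and \<theta>_k: "AE y in N. \<theta> (k y) = y"
  using inverse by (auto simp: ae_inverse_def)

definition translate :: "'a \<Rightarrow> 'x \<Rightarrow> 'y" where "translate g x = \<rho> g (\<theta> (\<sigma> (inv g) x))"
definition translate_inv :: "'a \<Rightarrow> 'y \<Rightarrow> 'x" where "translate_inv g y = \<sigma> g (k (\<rho> (inv g) y))"

lemma translate_meas [measurable]: "g \<in> carrier G \<Longrightarrow> translate g \<in> M \<rightarrow>\<^sub>M N"
  unfolding translate_def[abs_def]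
  by (rule measurable_compose[OF measurable_compose[OF X.meas \<theta>_meas] Y.meas]) simp_all

lemma translate_inv_meas [measurable]: "g \<in> carrier G \<Longrightarrow> translate_inv g \<in> N \<rightarrow>\<^sub>M M"
  unfolding translate_inv_def[abs_def]
  by (rule measurable_compose[OF measurable_compose[OF Y.meas k_meas] X.meas]) simp_all

lemma translate_distr:
  assumes g: "g \<in> carrier G"
  shows "distr M N (translate g) = N"
proof -
  note m = X.meas[OF X.inv_closed[OF g]] \<theta>_meas Y.meas[OF g]
  have "distr M N (translate g) = distr (distr (distr M M (\<sigma> (inv g))) N \<theta>) N (\<rho> g)"
    using distr_distr[OF m(3) measurable_compose[OF m(1,2)]] distr_distr[OF m(2,1)]
    by (simp add: translate_def[abs_def] comp_def)
  then show ?thesis by (simp add: X.preserving Y.preserving g \<theta>_distr)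
qed

lemma translate_inv_translate:
  assumes g: "g \<in> carrier G"
  shows "AE x in M. translate_inv g (translate g x) = x"
proof -
  have "AE x in M. k (\<theta> (\<sigma> (inv g) x)) = \<sigma> (inv g) x"
    by (rule AE_mp_compose[OF X.meas X.preserving k_\<theta>]) (simp_all add: g)
  then show ?thesis
    using AE_space
  proof eventually_elim
    case (elim x)
    have "\<theta> (\<sigma> (inv g) x) \<in> space N"
      using elim(2) g by (intro measurable_space[OF \<theta>_meas] X.act_space) simp_all
    then show ?case
      using elim g by (simp add: translate_def translate_inv_def Y.act_inv_left X.act_inv_right)
  qed
qed

lemma translate_translate_inv:
  assumes g: "g \<in> carrier G"
  shows "AE y in N. translate g (translate_inv g y) = y"
proof -
  have "AE y in N. \<theta> (k (\<rho> (inv g) y)) = \<rho> (inv g) y"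
    by (rule AE_mp_compose[OF Y.meas Y.preserving \<theta>_k]) (simp_all add: g)
  then show ?thesis
    using AE_space
  proof eventually_elim
    case (elim y)
    have "k (\<rho> (inv g) y) \<in> space M"
      using elim(2) g by (intro measurable_space[OF k_meas] Y.act_space) simp_all
    then show ?case
      using elim g by (simp add: translate_def translate_inv_def X.act_inv_left Y.act_inv_right)
  qed
qed

lemma translate_inverse: "g \<in> carrier G \<Longrightarrow> ae_inverse M N (translate g) (translate_inv g)"
  unfolding ae_inverse_def by (simp add: translate_inv_meas translate_inv_translate translate_translate_inv)

lemma translate_mp_isos: "g \<in> carrier G \<Longrightarrow> translate g \<in> mp_isos M N"
  unfolding mp_isos_def using translate_meas translate_distr translate_inverse by blast

lemma translate_one: "x \<in> space M \<Longrightarrow> translate \<one> x = \<theta> x"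
  by (simp add: translate_def X.act_one Y.act_one measurable_space[OF \<theta>_meas])

lemma translate_inv_one: "y \<in> space N \<Longrightarrow> translate_inv \<one> y = k y"
  by (simp add: translate_inv_def X.act_one Y.act_one measurable_space[OF k_meas])

text \<open>
  The graph of a translate, cut down to the points where the translate and its inverse fit together.
  This makes it the graph of a bijection between subsets of the two spaces, so that its rows and its
  columns have at most one point.
\<close>

definition graph_of :: "'a \<Rightarrow> ('x \<times> 'y) set" where
  "graph_of g = {(x, y). x \<in> space M \<and> y \<in> space N \<and> translate g x = y \<and> translate_inv g y = x}"

lemma graph_of_sets [measurable]:
  assumes g: "g \<in> carrier G"
  shows "graph_of g \<in> sets (M \<Otimes>\<^sub>M N)"
proof -
  have "Measurable.pred (M \<Otimes>\<^sub>M N) (\<lambda>z. translate g (fst z) = snd z \<and> translate_inv g (snd z) = fst z)"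
    by (intro pred_intros_logic measurable_eq_countably_separated[OF sep_M] measurable_eq_countably_separated[OF sep_N]
        measurable_snd measurable_fst measurable_compose[OF measurable_fst translate_meas] measurable_compose[OF measurable_snd translate_inv_meas] g)
  moreover have "graph_of g = {z \<in> space (M \<Otimes>\<^sub>M N). translate g (fst z) = snd z \<and> translate_inv g (snd z) = fst z}"
    by (auto simp: graph_of_def space_pair_measure)
  ultimately show ?thesis by (simp add: pred_def)
qed

definition T :: "'a \<Rightarrow> 'x \<times> 'y \<Rightarrow> 'x \<times> 'y" where "T g z = (\<sigma> g (fst z), \<rho> g (snd z))"

lemma graph_of_translate:
  assumes g: "g \<in> carrier G" and h: "h \<in> carrier G" and z: "z \<in> graph_of h"
  shows "T g z \<in> graph_of (g \<otimes> h)"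
proof -
  obtain x y where z': "z = (x, y)" by (cases z)
  have xy: "x \<in> space M" "y \<in> space N" "translate h x = y" "translate_inv h y = x" using z by (auto simp: z' graph_of_def)
  have 1: "\<theta> (\<sigma> (inv h) x) \<in> space N" "k (\<rho> (inv h) y) \<in> space M"
    using xy(1,2) h by (simp_all add: measurable_space[OF \<theta>_meas] measurable_space[OF k_meas] X.act_space Y.act_space)
  have "translate (g \<otimes> h) (\<sigma> g x) = \<rho> (g \<otimes> h) (\<theta> (\<sigma> (inv h) (\<sigma> (inv g) (\<sigma> g x))))"
    using g h xy by (simp add: translate_def X.inv_mult_group X.act_mult X.act_space)
  also have "\<dots> = \<rho> g (translate h x)"
    using g h xy 1 by (simp add: translate_def X.act_inv_left Y.act_mult)
  finally have t: "translate (g \<otimes> h) (\<sigma> g x) = \<rho> g y" using xy(3) by simp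
  have "translate_inv (g \<otimes> h) (\<rho> g y) = \<sigma> (g \<otimes> h) (k (\<rho> (inv h) (\<rho> (inv g) (\<rho> g y))))"
    using g h xy by (simp add: translate_inv_def X.inv_mult_group Y.act_mult Y.act_space)
  also have "\<dots> = \<sigma> g (translate_inv h y)"
    using g h xy 1 by (simp add: translate_inv_def Y.act_inv_left X.act_mult)
  finally have "translate_inv (g \<otimes> h) (\<rho> g y) = \<sigma> g x" using xy(4) by simp
  with t show ?thesis using xy(1,2) g by (simp add: z' T_def graph_of_def X.act_space Y.act_space)
qed

definition graphs :: "('x \<times> 'y) set" where "graphs = (\<Union>g\<in>carrier G. graph_of g)"

lemma graphs_translate: "g \<in> carrier G \<Longrightarrow> z \<in> graphs \<Longrightarrow> T g z \<in> graphs"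
  unfolding graphs_def using graph_of_translate by blast

lemma T_space: "g \<in> carrier G \<Longrightarrow> z \<in> space (M \<Otimes>\<^sub>M N) \<Longrightarrow> T g z \<in> space (M \<Otimes>\<^sub>M N)"
  by (auto simp: T_def space_pair_measure X.act_space Y.act_space)

lemma T_meas: "g \<in> carrier G \<Longrightarrow> T g \<in> (M \<Otimes>\<^sub>M N) \<rightarrow>\<^sub>M (M \<Otimes>\<^sub>M N)"
  unfolding T_def[abs_def]
  by (intro measurable_Pair measurable_compose[OF measurable_fst X.meas] measurable_compose[OF measurable_snd Y.meas])

lemma T_mult: "g \<in> carrier G \<Longrightarrow> h \<in> carrier G \<Longrightarrow> z \<in> space (M \<Otimes>\<^sub>M N) \<Longrightarrow> T (g \<otimes> h) z = T g (T h z)"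
  by (auto simp: T_def space_pair_measure X.act_mult Y.act_mult)

lemma T_one: "z \<in> space (M \<Otimes>\<^sub>M N) \<Longrightarrow> T \<one> z = z"
  by (auto simp: T_def space_pair_measure X.act_one Y.act_one)

definition elt :: "nat \<Rightarrow> 'a" where "elt = from_nat_into (carrier G)"

lemma elt_carrier [simp]: "elt n \<in> carrier G"
  unfolding elt_def by (rule from_nat_into) (use X.one_closed in blast)

lemma range_elt: "range elt = carrier G"
  unfolding elt_def by (rule range_from_nat_into) (use X.one_closed countable_carrier in auto)

text \<open>
  The graphs overlap where translates agree; the pieces partition their union.
\<close>

definition piece :: "nat \<Rightarrow> ('x \<times> 'y) set" where
  "piece n = disjointed (\<lambda>n. graph_of (elt n)) n"

lemma piece_sets [measurable]: "piece n \<in> sets (M \<Otimes>\<^sub>M N)"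
proof -
  have "range (disjointed (\<lambda>n. graph_of (elt n))) \<subseteq> sets (M \<Otimes>\<^sub>M N)"
    by (intro sets.range_disjointed_sets image_subsetI graph_of_sets elt_carrier)
  then show ?thesis unfolding piece_def by blast
qed

lemma disjoint_piece: "disjoint_family piece"
  unfolding piece_def[abs_def] by (rule disjoint_family_disjointed)

lemma piece_subset: "piece n \<subseteq> graph_of (elt n)"
  unfolding piece_def by (rule disjointed_subset)

lemma graphs_eq: "graphs = (\<Union>n. piece n)"
  unfolding piece_def UN_disjointed_eq graphs_def range_elt[symmetric] by simp

lemma graphs_sets [measurable]: "graphs \<in> sets (M \<Otimes>\<^sub>M N)"
  unfolding graphs_eq by measurable

lemma graphs_space: "graphs \<subseteq> space (M \<Otimes>\<^sub>M N)"
  using graphs_sets by (rule sets.sets_into_space)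

definition fibre_count :: "('x \<times> 'y) set \<Rightarrow> 'x \<Rightarrow> ennreal" where
  "fibre_count A x = emeasure (count_space UNIV) {y. (x, y) \<in> A \<inter> graphs}"

definition cofibre_count :: "('x \<times> 'y) set \<Rightarrow> 'y \<Rightarrow> ennreal" where
  "cofibre_count A y = emeasure (count_space UNIV) {x. (x, y) \<in> A \<inter> graphs}"

lemma fibre_count_eq: "fibre_count A x = (\<Sum>n. indicator (A \<inter> piece n) (x, translate (elt n) x))"
proof -
  have "{y. (x, y) \<in> A \<inter> graphs} = (\<Union>n. {y. (x, y) \<in> A \<inter> piece n})" by (auto simp: graphs_eq)
  then have "fibre_count A x = (\<Sum>n. emeasure (count_space UNIV) {y. (x, y) \<in> A \<inter> piece n})"
    unfolding fibre_count_def using disjoint_piece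
    by (subst suminf_emeasure) (auto simp: disjoint_family_on_def)
  also have "\<dots> = (\<Sum>n. indicator (A \<inter> piece n) (x, translate (elt n) x))"
  proof (rule suminf_cong)
    fix n
    have "{y. (x, y) \<in> A \<inter> piece n} = (if (x, translate (elt n) x) \<in> A \<inter> piece n then {translate (elt n) x} else {})"
      using piece_subset[of n] by (auto simp: graph_of_def)
    then show "emeasure (count_space UNIV) {y. (x, y) \<in> A \<inter> piece n} = indicator (A \<inter> piece n) (x, translate (elt n) x)"
      by (simp add: indicator_def)
  qed
  finally show ?thesis .
qed

lemma cofibre_count_eq: "cofibre_count A y = (\<Sum>n. indicator (A \<inter> piece n) (translate_inv (elt n) y, y))"
proof -
  have "{x. (x, y) \<in> A \<inter> graphs} = (\<Union>n. {x. (x, y) \<in> A \<inter> piece n})" by (auto simp: graphs_eq)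
  then have "cofibre_count A y = (\<Sum>n. emeasure (count_space UNIV) {x. (x, y) \<in> A \<inter> piece n})"
    unfolding cofibre_count_def using disjoint_piece
    by (subst suminf_emeasure) (auto simp: disjoint_family_on_def)
  also have "\<dots> = (\<Sum>n. indicator (A \<inter> piece n) (translate_inv (elt n) y, y))"
  proof (rule suminf_cong)
    fix n
    have "{x. (x, y) \<in> A \<inter> piece n} = (if (translate_inv (elt n) y, y) \<in> A \<inter> piece n then {translate_inv (elt n) y} else {})"
      using piece_subset[of n] by (auto simp: graph_of_def)
    then show "emeasure (count_space UNIV) {x. (x, y) \<in> A \<inter> piece n} = indicator (A \<inter> piece n) (translate_inv (elt n) y, y)"
      by (simp add: indicator_def)
  qed
  finally show ?thesis .
qed

lemma graph_indicator_meas: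
  assumes [measurable]: "A \<in> sets (M \<Otimes>\<^sub>M N)"
  shows "(\<lambda>x. indicator A (x, translate (elt n) x) :: ennreal) \<in> borel_measurable M"
    "(\<lambda>y. indicator A (translate_inv (elt n) y, y) :: ennreal) \<in> borel_measurable N"
proof -
  note [measurable] = translate_meas[OF elt_carrier[of n]] translate_inv_meas[OF elt_carrier[of n]]
  show "(\<lambda>x. indicator A (x, translate (elt n) x) :: ennreal) \<in> borel_measurable M"
    "(\<lambda>y. indicator A (translate_inv (elt n) y, y) :: ennreal) \<in> borel_measurable N" by measurable
qed

lemma fibre_count_meas: "A \<in> sets (M \<Otimes>\<^sub>M N) \<Longrightarrow> fibre_count A \<in> borel_measurable M"
  unfolding fibre_count_eq[abs_def] by (intro borel_measurable_suminf_order graph_indicator_meas) simp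

lemma cofibre_count_meas: "A \<in> sets (M \<Otimes>\<^sub>M N) \<Longrightarrow> cofibre_count A \<in> borel_measurable N"
  unfolding cofibre_count_eq[abs_def] by (intro borel_measurable_suminf_order graph_indicator_meas) simp

text \<open>
  Each graph carries a copy of the measure of \<open>M\<close>, and points common to several graphs count once.
\<close>

definition \<zeta> :: "('x \<times> 'y) measure" where
  "\<zeta> = measure_of (space (M \<Otimes>\<^sub>M N)) (sets (M \<Otimes>\<^sub>M N)) (\<lambda>A. \<integral>\<^sup>+x. fibre_count A x \<partial>M)"

lemma sets_\<zeta> [measurable_cong, simp]: "sets \<zeta> = sets (M \<Otimes>\<^sub>M N)" and space_\<zeta> [simp]: "space \<zeta> = space (M \<Otimes>\<^sub>M N)"
  by (simp_all add: \<zeta>_def)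

lemma emeasure_\<zeta>:
  assumes A: "A \<in> sets (M \<Otimes>\<^sub>M N)"
  shows "emeasure \<zeta> A = (\<integral>\<^sup>+x. fibre_count A x \<partial>M)"
proof (rule emeasure_measure_of[OF \<zeta>_def])
  show "sets (M \<Otimes>\<^sub>M N) \<subseteq> Pow (space (M \<Otimes>\<^sub>M N))" using sets.sets_into_space by blast
  show "A \<in> sets \<zeta>" using A by simp
  show "positive (sets \<zeta>) (\<lambda>A. \<integral>\<^sup>+x. fibre_count A x \<partial>M)"
    by (simp add: positive_def fibre_count_def)
  show "countably_additive (sets \<zeta>) (\<lambda>A. \<integral>\<^sup>+x. fibre_count A x \<partial>M)"
  proof (rule countably_additiveI)
    fix A :: "nat \<Rightarrow> ('x \<times> 'y) set"
    assume A: "range A \<subseteq> sets \<zeta>" "disjoint_family A"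
    have "(\<Sum>i. fibre_count (A i) x) = fibre_count (\<Union>i. A i) x" for x
    proof -
      have "(\<Sum>i. emeasure (count_space UNIV) {y. (x, y) \<in> A i \<inter> graphs})
          = emeasure (count_space UNIV) (\<Union>i. {y. (x, y) \<in> A i \<inter> graphs})"
        using A(2) by (intro suminf_emeasure) (auto simp: disjoint_family_on_def)
      also have "(\<Union>i. {y. (x, y) \<in> A i \<inter> graphs}) = {y. (x, y) \<in> (\<Union>i. A i) \<inter> graphs}" by auto
      finally show ?thesis by (simp add: fibre_count_def)
    qed
    moreover have "(\<Sum>i. \<integral>\<^sup>+x. fibre_count (A i) x \<partial>M) = (\<integral>\<^sup>+x. (\<Sum>i. fibre_count (A i) x) \<partial>M)"
      using A(1) by (intro nn_integral_suminf[symmetric] fibre_count_meas) auto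
    ultimately show "(\<Sum>i. \<integral>\<^sup>+x. fibre_count (A i) x \<partial>M) = (\<integral>\<^sup>+x. fibre_count (\<Union>i. A i) x \<partial>M)"
      by simp
  qed
qed

text \<open>
  Counting along columns gives the same measure, because each translate is measure preserving.
\<close>

lemma emeasure_\<zeta>_cofibre:
  assumes A: "A \<in> sets (M \<Otimes>\<^sub>M N)"
  shows "emeasure \<zeta> A = (\<integral>\<^sup>+y. cofibre_count A y \<partial>N)"
proof -
  have P: "A \<inter> piece n \<in> sets (M \<Otimes>\<^sub>M N)" for n using A by simp
  have "emeasure \<zeta> A = (\<Sum>n. \<integral>\<^sup>+x. indicator (A \<inter> piece n) (x, translate (elt n) x) \<partial>M)"
    unfolding emeasure_\<zeta>[OF A] fibre_count_eq
    by (rule nn_integral_suminf) (rule graph_indicator_meas[OF P])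
  also have "\<dots> = (\<Sum>n. \<integral>\<^sup>+y. indicator (A \<inter> piece n) (translate_inv (elt n) y, y) \<partial>N)"
  proof (rule suminf_cong)
    fix n
    have "(\<integral>\<^sup>+y. indicator (A \<inter> piece n) (translate_inv (elt n) y, y) \<partial>N)
        = (\<integral>\<^sup>+y. indicator (A \<inter> piece n) (translate_inv (elt n) y, y) \<partial>distr M N (translate (elt n)))"
      by (simp add: translate_distr)
    also have "\<dots> = (\<integral>\<^sup>+x. indicator (A \<inter> piece n) (translate_inv (elt n) (translate (elt n) x), translate (elt n) x) \<partial>M)"
      by (rule nn_integral_distr[OF translate_meas[OF elt_carrier]]) (simp add: graph_indicator_meas(2)[OF P])
    also have "\<dots> = (\<integral>\<^sup>+x. indicator (A \<inter> piece n) (x, translate (elt n) x) \<partial>M)"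
      by (rule nn_integral_cong_AE) (use translate_inv_translate[OF elt_carrier[of n]] in \<open>eventually_elim, simp\<close>)
    finally show "(\<integral>\<^sup>+x. indicator (A \<inter> piece n) (x, translate (elt n) x) \<partial>M)
        = (\<integral>\<^sup>+y. indicator (A \<inter> piece n) (translate_inv (elt n) y, y) \<partial>N)" by simp
  qed
  also have "\<dots> = (\<integral>\<^sup>+y. cofibre_count A y \<partial>N)"
    unfolding cofibre_count_eq
    by (rule nn_integral_suminf[symmetric]) (rule graph_indicator_meas[OF P])
  finally show ?thesis .
qed

text \<open>
  The union of the graphs is invariant, so \<open>\<rho> g\<close> maps the row over \<open>x\<close> bijectively to the row over \<open>\<sigma> g x\<close>.
\<close>

lemma fibre_count_translate:
  assumes g: "g \<in> carrier G" and x: "x \<in> space M" and A: "A \<subseteq> space (M \<Otimes>\<^sub>M N)"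
  shows "fibre_count (T g -` A \<inter> space (M \<Otimes>\<^sub>M N)) x = fibre_count A (\<sigma> g x)"
  unfolding fibre_count_def
proof (rule emeasure_count_space_bij)
  have T_inv: "T (inv g) (\<sigma> g x, y) = (x, \<rho> (inv g) y)" for y
    using g x by (simp add: T_def X.act_inv_left)
  show "bij_betw (\<rho> g) {y. (x, y) \<in> T g -` A \<inter> space (M \<Otimes>\<^sub>M N) \<inter> graphs} {y. (\<sigma> g x, y) \<in> A \<inter> graphs}"
  proof (rule bij_betw_byWitness[where f' = "\<rho> (inv g)"])
    show "\<forall>y\<in>{y. (x, y) \<in> T g -` A \<inter> space (M \<Otimes>\<^sub>M N) \<inter> graphs}. \<rho> (inv g) (\<rho> g y) = y"
      using g by (auto simp: space_pair_measure Y.act_inv_left)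
    show "\<forall>y\<in>{y. (\<sigma> g x, y) \<in> A \<inter> graphs}. \<rho> g (\<rho> (inv g) y) = y"
      using g A by (auto simp: space_pair_measure Y.act_inv_right)
    show "\<rho> g ` {y. (x, y) \<in> T g -` A \<inter> space (M \<Otimes>\<^sub>M N) \<inter> graphs} \<subseteq> {y. (\<sigma> g x, y) \<in> A \<inter> graphs}"
      using graphs_translate[OF g] by (auto simp: T_def)
    show "\<rho> (inv g) ` {y. (\<sigma> g x, y) \<in> A \<inter> graphs} \<subseteq> {y. (x, y) \<in> T g -` A \<inter> space (M \<Otimes>\<^sub>M N) \<inter> graphs}"
    proof (intro image_subsetI CollectI)
      fix y assume y: "y \<in> {y. (\<sigma> g x, y) \<in> A \<inter> graphs}"
      then have yN: "y \<in> space N" using A by (auto simp: space_pair_measure)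
      have "(x, \<rho> (inv g) y) \<in> graphs"
        using graphs_translate[of "inv g" "(\<sigma> g x, y)"] y g by (simp add: T_inv)
      moreover have "T g (x, \<rho> (inv g) y) = (\<sigma> g x, y)" using g yN by (simp add: T_def Y.act_inv_right)
      ultimately show "(x, \<rho> (inv g) y) \<in> T g -` A \<inter> space (M \<Otimes>\<^sub>M N) \<inter> graphs"
        using y graphs_space by auto
    qed
  qed
qed

lemma strict_action_\<zeta>: "strict_action G \<zeta> T"
proof unfold_locales
  fix g assume g: "g \<in> carrier G"
  show T: "T g \<in> \<zeta> \<rightarrow>\<^sub>M \<zeta>" using T_meas[OF g] by simp
  show "distr \<zeta> \<zeta> (T g) = \<zeta>"
  proof (rule measure_eqI)
    fix A assume "A \<in> sets (distr \<zeta> \<zeta> (T g))"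
    then have A: "A \<in> sets (M \<Otimes>\<^sub>M N)" by simp
    then have "emeasure (distr \<zeta> \<zeta> (T g)) A = emeasure \<zeta> (T g -` A \<inter> space (M \<Otimes>\<^sub>M N))"
      using T by (simp add: emeasure_distr)
    also have "\<dots> = (\<integral>\<^sup>+x. fibre_count (T g -` A \<inter> space (M \<Otimes>\<^sub>M N)) x \<partial>M)"
      by (rule emeasure_\<zeta>) (rule measurable_sets[OF T_meas[OF g] A])
    also have "\<dots> = (\<integral>\<^sup>+x. fibre_count A (\<sigma> g x) \<partial>M)"
      by (rule nn_integral_cong) (rule fibre_count_translate[OF g _ sets.sets_into_space[OF A]])
    also have "\<dots> = (\<integral>\<^sup>+x. fibre_count A x \<partial>distr M M (\<sigma> g))"
      by (rule nn_integral_distr[symmetric, OF X.meas[OF g]]) (simp add: fibre_count_meas[OF A])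
    also have "\<dots> = emeasure \<zeta> A" by (simp add: X.preserving[OF g] emeasure_\<zeta>[OF A])
    finally show "emeasure (distr \<zeta> \<zeta> (T g)) A = emeasure \<zeta> A" .
  qed simp
qed (simp_all add: T_mult T_one)

end

section \<open>From an invariant vector to an equivariant partial isomorphism\<close>

context graph_system
begin

interpretation Z: strict_action G \<zeta> T by (rule strict_action_\<zeta>)

lemma in_graph_of_one: "(x, y) \<in> graph_of \<one> \<longleftrightarrow> x \<in> space M \<and> y \<in> space N \<and> \<theta> x = y \<and> k y = x"
  using translate_one[of x] translate_inv_one[of y] by (auto simp: graph_of_def)

lemma graph_of_one_subset_graphs: "graph_of \<one> \<subseteq> graphs"
  unfolding graphs_def by blast

definition graph_vector :: "'x \<times> 'y \<Rightarrow> complex" where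
  "graph_vector = indicator (graph_of \<one>)"

lemma graph_vector_meas: "graph_vector \<in> borel_measurable \<zeta>"
  unfolding graph_vector_def by (intro borel_measurable_indicator) (simp add: graph_of_sets)

lemma nn_integral_graph_vector_sq:
  "(\<integral>\<^sup>+z. ennreal ((cmod (graph_vector z))\<^sup>2) \<partial>\<zeta>) = 1"
proof -
  interpret prob_space M by (rule prob_M)
  have "(\<integral>\<^sup>+z. ennreal ((cmod (graph_vector z))\<^sup>2) \<partial>\<zeta>) = (\<integral>\<^sup>+z. indicator (graph_of \<one>) z \<partial>\<zeta>)"
    by (rule nn_integral_cong) (simp add: graph_vector_def indicator_def)
  also have "\<dots> = emeasure \<zeta> (graph_of \<one>)" by (simp add: graph_of_sets)
  also have "\<dots> = (\<integral>\<^sup>+x. fibre_count (graph_of \<one>) x \<partial>M)" by (rule emeasure_\<zeta>) (simp add: graph_of_sets)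
  also have "\<dots> = (\<integral>\<^sup>+x. 1 \<partial>M)"
  proof (rule nn_integral_cong_AE, use k_\<theta> AE_space in eventually_elim)
    fix x assume x: "k (\<theta> x) = x" "x \<in> space M"
    have "{y. (x, y) \<in> graph_of \<one> \<inter> graphs} = {\<theta> x}"
      using graph_of_one_subset_graphs x measurable_space[OF \<theta>_meas x(2)] by (auto simp: in_graph_of_one)
    then show "fibre_count (graph_of \<one>) x = 1" by (simp add: fibre_count_def)
  qed
  finally show ?thesis by (simp add: emeasure_space_1)
qed

lemma sq_int_graph_vector: "graph_vector \<in> sq_int \<zeta>"
proof -
  have "integrable \<zeta> (\<lambda>z. (cmod (graph_vector z))\<^sup>2)"
    using graph_vector_meas nn_integral_graph_vector_sq by (intro integrableI_bounded) auto
  then show ?thesis using graph_vector_meas by (simp add: sq_int_def)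
qed

lemma nrm_graph_vector: "nrm \<zeta> graph_vector = 1"
proof -
  have "ennreal ((nrm \<zeta> graph_vector)\<^sup>2) = ennreal 1"
    using nn_integral_graph_vector_sq sq_int_nn_integral[OF sq_int_graph_vector] by simp
  then have "(nrm \<zeta> graph_vector)\<^sup>2 = 1" by (subst (asm) ennreal_inj) auto
  then show ?thesis using nrm_nonneg[of \<zeta> graph_vector] by (simp add: power2_eq_1_iff)
qed

definition defect :: "'a \<Rightarrow> 'x set" where
  "defect h = {x \<in> space M. \<theta> (\<sigma> h x) \<noteq> \<rho> h (\<theta> x)}"

lemma defect_sets: "h \<in> carrier G \<Longrightarrow> defect h \<in> sets M"
  unfolding defect_def pred_def[symmetric]
  by (intro pred_intros_logic measurable_eq_countably_separated[OF sep_N]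
      measurable_compose[OF X.meas \<theta>_meas] measurable_compose[OF \<theta>_meas Y.meas])

text \<open>
  For almost every \<open>x\<close> outside the defect the translated graph and the graph have the same point in
  the row over \<open>x\<close>; on the defect the row contains at most one point of each.
\<close>

lemma nrm_sq_displacement:
  assumes g: "g \<in> carrier G"
  shows "(nrm \<zeta> (\<lambda>z. Z.koopman g graph_vector z - graph_vector z))\<^sup>2 \<le> 2 * measure M (defect (inv g))"
proof -
  interpret prob_space M by (rule prob_M)
  define h where "h = inv g"
  have h: "h \<in> carrier G" using g by (simp add: h_def)
  define S where "S = {z \<in> space (M \<Otimes>\<^sub>M N). (T h z \<in> graph_of \<one>) \<noteq> (z \<in> graph_of \<one>)}"
  have pS: "Measurable.pred (M \<Otimes>\<^sub>M N) (\<lambda>z. (T h z \<in> graph_of \<one>) \<noteq> (z \<in> graph_of \<one>))"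
    by (intro pred_intros_logic measurable_compose[OF T_meas[OF h]] pred_sets2[OF graph_of_sets] measurable_ident_sets)
      simp_all
  then have S: "S \<in> sets (M \<Otimes>\<^sub>M N)" unfolding S_def by (simp add: pred_def)
  have sq: "(\<lambda>z. Z.koopman g graph_vector z - graph_vector z) \<in> sq_int \<zeta>"
    by (intro sq_int_diff Z.sq_int_koopman sq_int_graph_vector g)
  have "ennreal ((nrm \<zeta> (\<lambda>z. Z.koopman g graph_vector z - graph_vector z))\<^sup>2)
      = (\<integral>\<^sup>+z. ennreal ((cmod (Z.koopman g graph_vector z - graph_vector z))\<^sup>2) \<partial>\<zeta>)"
    by (rule sq_int_nn_integral[OF sq, symmetric])
  also have "\<dots> = (\<integral>\<^sup>+z. indicator S z \<partial>\<zeta>)"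
    by (rule nn_integral_cong)
      (simp add: Z.koopman_def graph_vector_def S_def h_def indicator_def)
  also have "\<dots> = emeasure \<zeta> S" using S by simp
  also have "\<dots> = (\<integral>\<^sup>+x. fibre_count S x \<partial>M)" by (rule emeasure_\<zeta>[OF S])
  also have "\<dots> \<le> (\<integral>\<^sup>+x. 2 * indicator (defect h) x \<partial>M)"
  proof (rule nn_integral_mono_AE)
    have "AE x in M. k (\<theta> (\<sigma> h x)) = \<sigma> h x"
      by (rule AE_mp_compose[OF X.meas X.preserving k_\<theta>]) (fact h)+
    then show "AE x in M. fibre_count S x \<le> 2 * indicator (defect h) x"
      using k_\<theta> AE_space
    proof eventually_elim
      fix x assume x: "k (\<theta> (\<sigma> h x)) = \<sigma> h x" "k (\<theta> x) = x" "x \<in> space M"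
      define y' where "y' = \<rho> (inv h) (\<theta> (\<sigma> h x))"
      have 1: "(x, y) \<in> graph_of \<one> \<longleftrightarrow> y = \<theta> x" if "y \<in> space N" for y
        using x that by (auto simp: in_graph_of_one)
      have 2: "T h (x, y) \<in> graph_of \<one> \<longleftrightarrow> \<theta> (\<sigma> h x) = \<rho> h y" if "y \<in> space N" for y
      proof -
        have "T h (x, y) \<in> graph_of \<one> \<longleftrightarrow> \<theta> (\<sigma> h x) = \<rho> h y \<and> k (\<rho> h y) = \<sigma> h x"
          using x that h by (simp add: T_def in_graph_of_one X.act_space Y.act_space)
        also have "\<dots> \<longleftrightarrow> \<theta> (\<sigma> h x) = \<rho> h y" using x(1) by metis
        finally show ?thesis .
      qed
      have 3: "y = y'" if "y \<in> space N" "\<theta> (\<sigma> h x) = \<rho> h y" for y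
        unfolding y'_def that(2) using that(1) h by (simp add: Y.act_inv_left)
      show "fibre_count S x \<le> 2 * indicator (defect h) x"
      proof (cases "x \<in> defect h")
        case False
        then have eq: "\<theta> (\<sigma> h x) = \<rho> h (\<theta> x)" using x by (simp add: defect_def)
        have "(x, y) \<notin> S" for y
        proof
          assume a: "(x, y) \<in> S"
          then have y: "y \<in> space N" by (simp add: S_def space_pair_measure)
          have \<theta>x: "\<theta> x \<in> space N" by (rule measurable_space[OF \<theta>_meas x(3)])
          have "\<theta> (\<sigma> h x) = \<rho> h y \<longleftrightarrow> y = \<theta> x"
            using 3[OF y] 3[OF \<theta>x eq] eq by auto
          then show False using a 1[OF y] 2[OF y] by (simp add: S_def)
        qed
        then show ?thesis using False by (simp add: fibre_count_def)
      next
        case True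
        have "{y. (x, y) \<in> S \<inter> graphs} \<subseteq> {\<theta> x, y'}"
          using 1 2 3 by (auto simp: S_def space_pair_measure)
        then have "fibre_count S x \<le> emeasure (count_space UNIV) {\<theta> x, y'}"
          unfolding fibre_count_def by (intro emeasure_mono) auto
        also have "\<dots> = of_nat (card {\<theta> x, y'})" by (subst emeasure_count_space) auto
        also have "\<dots> \<le> of_nat 2" by (intro of_nat_mono) (simp add: card_insert_if)
        finally show ?thesis using True by simp
      qed
    qed
  qed
  also have "\<dots> = 2 * emeasure M (defect h)"
    using defect_sets[OF h] by (simp add: nn_integral_cmult)
  also have "\<dots> = ennreal (2 * measure M (defect h))"
    by (simp add: emeasure_eq_measure ennreal_mult)
  finally show ?thesis by (subst (asm) ennreal_le_iff) (simp_all add: h_def)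
qed

text \<open>
  An invariant function \<open>\<eta>\<close> near the graph vector is rounded to the invariant set \<open>E1\<close>, where \<open>\<eta>\<close> is within
  \<open>1/2\<close> of \<open>1\<close> along the whole orbit; \<open>E2\<close> keeps the points of \<open>E1\<close> that are alone in their row and column.
  For almost every \<open>x\<close>, if \<open>(x, \<theta> x)\<close> is not in \<open>E2\<close>, then the symmetric difference \<open>S\<close> of \<open>E1\<close> and
  the graph of \<open>\<theta>\<close> has a point in the row of \<open>x\<close> or in the column of \<open>\<theta> x\<close>. As \<open>S\<close> has measure at most \<open>4 \<delta>\<^sup>2\<close>, counted along rows as well as along
  columns, this happens on a set of measure at most \<open>8 \<delta>\<^sup>2\<close>.
\<close>

lemma near_equivariant_partial_iso:
  assumes K: "kazhdan_pair G F \<epsilon>" and \<delta>: "0 < \<delta>" "\<delta> \<le> 1"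
    and small: "\<And>g. g \<in> F \<Longrightarrow> 2 * measure M (defect (inv g)) < (\<epsilon> * \<delta>)\<^sup>2"
  obtains A B f f' where "partial_iso M N A B f f'"
    "\<And>g x. g \<in> carrier G \<Longrightarrow> x \<in> A \<Longrightarrow> \<sigma> g x \<in> A"
    "\<And>g x. g \<in> carrier G \<Longrightarrow> x \<in> A \<Longrightarrow> f (\<sigma> g x) = \<rho> g (f x)"
    "emeasure M {x \<in> space M. \<not> (x \<in> A \<and> f x = \<theta> x)} \<le> ennreal (8 * \<delta>\<^sup>2)"
proof -
  have F: "F \<subseteq> carrier G" and \<epsilon>: "\<epsilon> > 0" using K by (simp_all add: kazhdan_pair_def)
  have disp: "nrm \<zeta> (\<lambda>z. Z.koopman g graph_vector z - graph_vector z) < \<epsilon> * \<delta>" if g: "g \<in> F" for g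
  proof (rule power2_less_imp_less)
    show "(nrm \<zeta> (\<lambda>z. Z.koopman g graph_vector z - graph_vector z))\<^sup>2 < (\<epsilon> * \<delta>)\<^sup>2"
      using nrm_sq_displacement[of g] small[OF g] g F by auto
  qed (use \<epsilon> \<delta> in simp)
  obtain \<eta> where \<eta>: "\<eta> \<in> sq_int \<zeta>" "nrm \<zeta> (\<lambda>z. graph_vector z - \<eta> z) \<le> \<delta>"
    "\<And>g. g \<in> carrier G \<Longrightarrow> AE z in \<zeta>. \<eta> (T g z) = \<eta> z"
    by (rule Z.almost_invariant_near_invariant[OF countable_carrier K \<delta> sq_int_graph_vector nrm_graph_vector disp]) (assumption, rule that)
  let ?P = "M \<Otimes>\<^sub>M N"
  define E0 where "E0 = {z \<in> space ?P. cmod (\<eta> z - 1) < 1/2}"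
  have \<eta>m: "\<eta> \<in> borel_measurable ?P"
    using sq_int_measurable[OF \<eta>(1)] by (simp cong: measurable_cong_sets)
  then have E0: "E0 \<in> sets ?P" unfolding E0_def by measurable
  define E1 where "E1 = {z \<in> graphs. \<forall>g\<in>carrier G. T g z \<in> E0}"
  have "Measurable.pred ?P (\<lambda>z. z \<in> graphs \<and> (\<forall>g\<in>carrier G. T g z \<in> E0))"
    by (intro pred_intros_logic pred_ball_countable countable_carrier pred_sets2[OF graphs_sets]
        pred_sets2[OF E0] T_meas measurable_ident_sets refl)
  moreover have "E1 = {z \<in> space ?P. z \<in> graphs \<and> (\<forall>g\<in>carrier G. T g z \<in> E0)}"
    using graphs_space by (auto simp: E1_def)
  ultimately have E1: "E1 \<in> sets ?P" by (simp add: pred_def)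
  have E1R: "E1 \<subseteq> graphs" by (auto simp: E1_def)
  have E1_space: "x \<in> space M" "y \<in> space N" if "(x, y) \<in> E1" for x y
    using that E1R graphs_space by (auto simp: space_pair_measure)
  have E1_inv: "T h z \<in> E1" if "h \<in> carrier G" "z \<in> E1" for h z
  proof -
    have z: "z \<in> graphs" "z \<in> space ?P" "\<And>g. g \<in> carrier G \<Longrightarrow> T g z \<in> E0"
      using that(2) graphs_space by (auto simp: E1_def)
    have "T g (T h z) \<in> E0" if "g \<in> carrier G" for g
      using z(3)[of "g \<otimes> h"] T_mult[of g h z] that \<open>h \<in> carrier G\<close> z(2) by simp
    then show ?thesis using graphs_translate[OF that(1) z(1)] by (simp add: E1_def)
  qed
  define S where "S = {z \<in> space ?P. (z \<in> E1) \<noteq> (z \<in> graph_of \<one>)}"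
  have "Measurable.pred ?P (\<lambda>z. (z \<in> E1) \<noteq> (z \<in> graph_of \<one>))"
    by (intro pred_intros_logic pred_sets2[OF E1] pred_sets2[OF graph_of_sets] measurable_ident_sets refl) simp
  then have S: "S \<in> sets ?P" by (simp add: pred_def S_def)
  \<comment> \<open>Chebyshev: at a point of \<open>S\<close> the graph vector and \<open>\<eta>\<close> differ by at least \<open>1/2\<close>.\<close>
  have \<zeta>S: "emeasure \<zeta> S \<le> ennreal (4 * \<delta>\<^sup>2)"
  proof -
    have "AE z in \<zeta>. \<forall>g\<in>carrier G. \<eta> (T g z) = \<eta> z"
      using \<eta>(3) countable_carrier by (simp add: AE_ball_countable)
    then have AE: "AE z in \<zeta>. indicator S z \<le> 4 * ennreal ((cmod (graph_vector z - \<eta> z))\<^sup>2)"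
      using AE_space[of \<zeta>]
    proof eventually_elim
      fix z assume inv: "\<forall>g\<in>carrier G. \<eta> (T g z) = \<eta> z" and z: "z \<in> space \<zeta>"
      show "indicator S z \<le> 4 * ennreal ((cmod (graph_vector z - \<eta> z))\<^sup>2)"
      proof (cases "z \<in> S")
        case True
        have "1/2 \<le> cmod (graph_vector z - \<eta> z)"
        proof (cases "z \<in> E1")
          case True
          then have "T \<one> z \<in> E0" by (auto simp: E1_def)
          then have "cmod (\<eta> z - 1) < 1/2" using z by (simp add: T_one E0_def)
          moreover have "graph_vector z = 0" using True \<open>z \<in> S\<close> by (simp add: S_def graph_vector_def)
          moreover have "1 \<le> cmod (\<eta> z - 1) + cmod (\<eta> z)"
            using norm_triangle_ineq4[of "\<eta> z" "\<eta> z - 1"] by simp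
          ultimately show ?thesis by simp
        next
          case False
          then have graph_of: "z \<in> graph_of \<one>" using \<open>z \<in> S\<close> by (simp add: S_def)
          then have "z \<in> graphs" using graph_of_one_subset_graphs by blast
          then obtain g where g: "g \<in> carrier G" "T g z \<notin> E0" using False by (auto simp: E1_def)
          then have "\<not> cmod (\<eta> z - 1) < 1/2"
            using inv T_space[OF g(1), of z] z by (simp add: E0_def)
          moreover have "graph_vector z = 1" using graph_of by (simp add: graph_vector_def)
          ultimately show ?thesis by (simp add: norm_minus_commute)
        qed
        then have "(1/2)\<^sup>2 \<le> (cmod (graph_vector z - \<eta> z))\<^sup>2" by (intro power_mono) auto
        then have "1 \<le> 4 * (cmod (graph_vector z - \<eta> z))\<^sup>2" by (simp add: power2_eq_square)
        then have "ennreal 1 \<le> ennreal (4 * (cmod (graph_vector z - \<eta> z))\<^sup>2)" by (rule ennreal_leI)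
        then show ?thesis using True by (simp add: ennreal_mult)
      qed simp
    qed
    have sq: "(\<lambda>z. graph_vector z - \<eta> z) \<in> sq_int \<zeta>" by (intro sq_int_diff sq_int_graph_vector \<eta>(1))
    have "emeasure \<zeta> S = (\<integral>\<^sup>+z. indicator S z \<partial>\<zeta>)" using S by simp
    also have "\<dots> \<le> (\<integral>\<^sup>+z. 4 * ennreal ((cmod (graph_vector z - \<eta> z))\<^sup>2) \<partial>\<zeta>)"
      by (rule nn_integral_mono_AE[OF AE])
    also have "\<dots> = 4 * (\<integral>\<^sup>+z. ennreal ((cmod (graph_vector z - \<eta> z))\<^sup>2) \<partial>\<zeta>)"
      by (rule nn_integral_cmult,
          rule measurable_compose[OF sq_int_measurable[OF sq], of "\<lambda>w. ennreal ((cmod w)\<^sup>2)"]) measurable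
    also have "\<dots> = ennreal (4 * (nrm \<zeta> (\<lambda>z. graph_vector z - \<eta> z))\<^sup>2)"
      by (simp add: sq_int_nn_integral[OF sq] ennreal_mult)
    also have "\<dots> \<le> ennreal (4 * \<delta>\<^sup>2)"
      using \<eta>(2) by (intro ennreal_leI mult_left_mono power_mono) auto
    finally show ?thesis .
  qed
  define E2 where "E2 = {(x, y). (x, y) \<in> E1 \<and> (\<forall>y'. (x, y') \<in> E1 \<longrightarrow> y' = y) \<and> (\<forall>x'. (x', y) \<in> E1 \<longrightarrow> x' = x)}"
  have E2_iff: "(x, y) \<in> E2 \<longleftrightarrow> (x, y) \<in> E1 \<and> (\<forall>y'. (x, y') \<in> E1 \<longrightarrow> y' = y) \<and> (\<forall>x'. (x', y) \<in> E1 \<longrightarrow> x' = x)" for x y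
    by (simp only: E2_def mem_Collect_eq prod.case)
  have E2_E1: "(x, y) \<in> E1" and E2_right: "\<And>y'. (x, y') \<in> E1 \<Longrightarrow> y' = y" and E2_left: "\<And>x'. (x', y) \<in> E1 \<Longrightarrow> x' = x"
    if "(x, y) \<in> E2" for x y
    using that unfolding E2_iff by blast+
  have E2: "E2 \<in> sets ?P"
  proof -
    \<comment> \<open>All points of \<open>E1\<close> lie on the graphs, so countably many conditions express uniqueness in rows and columns.\<close>
    have graphs_cases: "\<exists>g\<in>carrier G. translate g x = y \<and> translate_inv g y = x" if "(x, y) \<in> E1" for x y
      using that E1R by (auto simp: graphs_def graph_of_def)
    have "E2 = {z \<in> space ?P. z \<in> E1 \<and>
        (\<forall>g\<in>carrier G. (fst z, translate g (fst z)) \<in> E1 \<longrightarrow> translate g (fst z) = snd z) \<and>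
        (\<forall>g\<in>carrier G. (translate_inv g (snd z), snd z) \<in> E1 \<longrightarrow> translate_inv g (snd z) = fst z)}" (is "_ = ?E")
    proof (rule equalityI; rule subsetI)
      fix z assume z: "z \<in> E2"
      obtain x y where xy: "z = (x, y)" by (cases z)
      note zE = E2_E1[OF z[unfolded xy]] E2_right[OF z[unfolded xy]] E2_left[OF z[unfolded xy]]
      have "z \<in> space ?P" using E1_space[OF zE(1)] by (simp add: xy space_pair_measure)
      then show "z \<in> ?E" unfolding xy mem_Collect_eq fst_conv snd_conv using zE by blast
    next
      fix z assume z: "z \<in> ?E"
      obtain x y where xy: "z = (x, y)" by (cases z)
      have z': "(x, y) \<in> E1" "\<And>g. g \<in> carrier G \<Longrightarrow> (x, translate g x) \<in> E1 \<Longrightarrow> translate g x = y"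
        "\<And>g. g \<in> carrier G \<Longrightarrow> (translate_inv g y, y) \<in> E1 \<Longrightarrow> translate_inv g y = x"
        using z unfolding xy mem_Collect_eq fst_conv snd_conv by blast+
      have "y' = y" if y': "(x, y') \<in> E1" for y'
      proof -
        obtain g where g: "g \<in> carrier G" "translate g x = y'" using graphs_cases[OF y'] by blast
        show ?thesis using z'(2)[OF g(1), unfolded g(2), OF y'] .
      qed
      moreover have "x' = x" if x': "(x', y) \<in> E1" for x'
      proof -
        obtain g where g: "g \<in> carrier G" "translate_inv g y = x'" using graphs_cases[OF x'] by blast
        show ?thesis using z'(3)[OF g(1), unfolded g(2), OF x'] .
      qed
      moreover note z'(1)
      ultimately show "z \<in> E2" unfolding xy E2_iff by blast
    qed
    moreover have "Measurable.pred ?P (\<lambda>z. z \<in> E1 \<and>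
        (\<forall>g\<in>carrier G. (fst z, translate g (fst z)) \<in> E1 \<longrightarrow> translate g (fst z) = snd z) \<and>
        (\<forall>g\<in>carrier G. (translate_inv g (snd z), snd z) \<in> E1 \<longrightarrow> translate_inv g (snd z) = fst z))"
      by (intro pred_intros_logic pred_ball_countable countable_carrier pred_sets2[OF E1]
          measurable_eq_countably_separated[OF sep_M] measurable_eq_countably_separated[OF sep_N]
          measurable_Pair measurable_fst measurable_snd measurable_compose[OF measurable_fst translate_meas]
          measurable_compose[OF measurable_snd translate_inv_meas] measurable_ident_sets refl)
    ultimately show ?thesis by (simp add: pred_def)
  qed
  have E2_unique: "(x, y) \<in> E2 \<Longrightarrow> (x, y') \<in> E2 \<Longrightarrow> y' = y" "(x, y) \<in> E2 \<Longrightarrow> (x', y) \<in> E2 \<Longrightarrow> x' = x" for x x' y y'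
    using E2_E1 E2_right E2_left by blast+
  have E2_inv: "(\<sigma> h x, \<rho> h y) \<in> E2" if h: "h \<in> carrier G" and xy: "(x, y) \<in> E2" for h x y
  proof -
    note E = E2_E1[OF xy] and u1 = E2_right[OF xy] and u2 = E2_left[OF xy]
    note sp = E1_space[OF E]
    have "(\<sigma> h x, \<rho> h y) \<in> E1" using E1_inv[OF h E] by (simp add: T_def)
    moreover have "y' = \<rho> h y" if y': "(\<sigma> h x, y') \<in> E1" for y'
    proof -
      have "(x, \<rho> (inv h) y') \<in> E1"
        using E1_inv[OF X.inv_closed[OF h] y'] sp h by (simp add: T_def X.act_inv_left)
      from u1[OF this] show ?thesis using Y.act_inv_right[OF h E1_space(2)[OF y']] by simp
    qed
    moreover have "x' = \<sigma> h x" if x': "(x', \<rho> h y) \<in> E1" for x'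
    proof -
      have "(\<sigma> (inv h) x', y) \<in> E1"
        using E1_inv[OF X.inv_closed[OF h] x'] sp h by (simp add: T_def Y.act_inv_left)
      from u2[OF this] show ?thesis using X.act_inv_right[OF h E1_space(1)[OF x']] by simp
    qed
    ultimately show ?thesis unfolding E2_iff by blast
  qed
  \<comment> \<open>On each piece the set \<open>E2\<close> is the graph of a restricted translate; these restrictions are glued.\<close>
  define A where "A n = {x \<in> space M. (x, translate (elt n) x) \<in> E2 \<inter> piece n}" for n
  define B where "B n = {y \<in> space N. (translate_inv (elt n) y, y) \<in> E2 \<inter> piece n}" for n
  have piece_graph: "translate (elt n) x = y" "translate_inv (elt n) y = x" "x \<in> space M" "y \<in> space N" if "(x, y) \<in> piece n" for x y n
    using that piece_subset[of n] by (auto simp: graph_of_def)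
  have pieces: "partial_iso M N (A n) (B n) (translate (elt n)) (translate_inv (elt n))" for n
  proof (rule partial_iso_restrict[OF mp_iso_partial_iso[OF translate_mp_isos translate_inverse sep_M sep_N]])
    have "Measurable.pred M (\<lambda>x. (x, translate (elt n) x) \<in> E2 \<inter> piece n)"
      by (intro pred_sets2[OF sets.Int[OF E2 piece_sets]] measurable_Pair measurable_ident_sets refl translate_meas elt_carrier)
    then show "A n \<in> sets M" by (simp add: A_def pred_def)
    show "A n \<subseteq> {x \<in> space M. translate_inv (elt n) (translate (elt n) x) = x}"
      using piece_graph(2) by (simp add: A_def subset_eq)
    show "B n = {y \<in> {y \<in> space N. translate (elt n) (translate_inv (elt n) y) = y}. translate_inv (elt n) y \<in> A n}"
    proof (rule equalityI; rule subsetI)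
      fix y assume y: "y \<in> B n"
      then have p: "(translate_inv (elt n) y, y) \<in> piece n" by (simp add: B_def)
      show "y \<in> {y \<in> {y \<in> space N. translate (elt n) (translate_inv (elt n) y) = y}. translate_inv (elt n) y \<in> A n}"
        using y piece_graph(1,3,4)[OF p] by (simp add: A_def B_def)
    next
      fix y assume "y \<in> {y \<in> {y \<in> space N. translate (elt n) (translate_inv (elt n) y) = y}. translate_inv (elt n) y \<in> A n}"
      then have "y \<in> space N" and y: "translate (elt n) (translate_inv (elt n) y) = y" and "translate_inv (elt n) y \<in> A n" by simp_all
      then show "y \<in> B n" unfolding A_def B_def mem_Collect_eq y by blast
    qed
  qed simp_all
  have index: "m = n" if "z \<in> piece m" "z \<in> piece n" for m n z
    using that disjoint_piece unfolding disjoint_family_on_def by (metis IntI UNIV_I empty_iff)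
  have "A m \<inter> A n = {}" if "m \<noteq> n" for m n
  proof -
    have False if "x \<in> A m" "x \<in> A n" for x
    proof -
      have "translate (elt n) x = translate (elt m) x" using E2_unique(1)[of x] that by (simp add: A_def)
      then show False using index[of "(x, translate (elt n) x)" m n] that \<open>m \<noteq> n\<close> by (simp add: A_def)
    qed
    then show ?thesis by blast
  qed
  then have dA: "disjoint_family A" by (simp add: disjoint_family_on_def)
  have "B m \<inter> B n = {}" if "m \<noteq> n" for m n
  proof -
    have False if "y \<in> B m" "y \<in> B n" for y
    proof -
      have "translate_inv (elt n) y = translate_inv (elt m) y" using E2_unique(2)[of _ y] that by (simp add: B_def)
      then show False using index[of "(translate_inv (elt n) y, y)" m n] that \<open>m \<noteq> n\<close> by (simp add: B_def)
    qed
    then show ?thesis by blast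
  qed
  then have dB: "disjoint_family B" by (simp add: disjoint_family_on_def)
  obtain f f' where f: "partial_iso M N (\<Union>n. A n) (\<Union>n. B n) f f'"
    "\<And>n x. x \<in> A n \<Longrightarrow> f x = translate (elt n) x"
    by (rule partial_iso_glue[OF pieces dA dB]) (rule that)
  have f_E2: "(x, f x) \<in> E2" if x: "x \<in> (\<Union>n. A n)" for x
  proof -
    obtain n where n: "x \<in> A n" using x by blast
    then show ?thesis using f(2)[OF n] by (simp add: A_def)
  qed
  have E2_f: "x \<in> (\<Union>n. A n) \<and> f x = y" if "(x, y) \<in> E2" for x y
  proof -
    have "(x, y) \<in> graphs" using E2_E1[OF that] E1R by blast
    then obtain n where n: "(x, y) \<in> piece n" by (auto simp: graphs_eq)
    then have "x \<in> A n" using piece_graph[OF n] that by (simp add: A_def)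
    then show ?thesis using f(2)[of x n] piece_graph[OF n] by auto
  qed
  have bad: "emeasure M {x \<in> space M. \<not> (x \<in> (\<Union>n. A n) \<and> f x = \<theta> x)} \<le> ennreal (8 * \<delta>\<^sup>2)"
  proof -
    let ?bad = "{x \<in> space M. \<not> (x \<in> (\<Union>n. A n) \<and> f x = \<theta> x)}"
    note p = partial_isoD[OF f(1)]
    have "Measurable.pred M (\<lambda>x. \<not> (x \<in> (\<Union>n. A n) \<and> f x = \<theta> x))"
      by (intro pred_intros_logic pred_sets2[OF p(1)] measurable_ident_sets refl
          measurable_eq_countably_separated[OF sep_N] p(3) \<theta>_meas)
    then have bad_sets: "?bad \<in> sets M" by (simp add: pred_def)
    have count_pos: "1 \<le> emeasure (count_space UNIV) U" if "u \<in> U" for U :: "'w set" and u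
    proof -
      have "emeasure (count_space UNIV) {u} \<le> emeasure (count_space UNIV) U"
        using that by (intro emeasure_mono) auto
      then show ?thesis by simp
    qed
    have "AE x in M. indicator ?bad x \<le> fibre_count S x + cofibre_count S (\<theta> x)"
      using k_\<theta> AE_space
    proof eventually_elim
      fix x assume x: "k (\<theta> x) = x" "x \<in> space M"
      have y: "\<theta> x \<in> space N" by (rule measurable_space[OF \<theta>_meas x(2)])
      have graph_of: "(x, y) \<in> graph_of \<one> \<longleftrightarrow> y = \<theta> x" "(x', \<theta> x) \<in> graph_of \<one> \<longleftrightarrow> x' = x" for x' y
        using x y by (auto simp: in_graph_of_one)
      have SI: "(a, b) \<in> S \<inter> graphs" if "(a, b) \<in> graphs" "((a, b) \<in> E1) \<noteq> ((a, b) \<in> graph_of \<one>)" for a b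
        using that graphs_space by (auto simp: S_def)
      show "indicator ?bad x \<le> fibre_count S x + cofibre_count S (\<theta> x)"
      proof (cases "(x, \<theta> x) \<in> E2")
        case True
        then show ?thesis using E2_f[OF True] by simp
      next
        case False
        then consider "(x, \<theta> x) \<notin> E1" | y' where "(x, y') \<in> E1" "y' \<noteq> \<theta> x" | x' where "(x', \<theta> x) \<in> E1" "x' \<noteq> x"
          unfolding E2_iff by blast
        then have "1 \<le> fibre_count S x \<or> 1 \<le> cofibre_count S (\<theta> x)"
        proof cases
          case 1
          then have "(x, \<theta> x) \<in> S \<inter> graphs" using graph_of(1) graph_of_one_subset_graphs by (intro SI) auto
          then show ?thesis unfolding fibre_count_def by (intro disjI1 count_pos) simp
        next
          case 2
          then have "(x, y') \<in> S \<inter> graphs" using graph_of(1) E1R by (intro SI) auto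
          then show ?thesis unfolding fibre_count_def by (intro disjI1 count_pos) simp
        next
          case 3
          then have "(x', \<theta> x) \<in> S \<inter> graphs" using graph_of(2) E1R by (intro SI) auto
          then show ?thesis unfolding cofibre_count_def by (intro disjI2 count_pos) simp
        qed
        then have "1 \<le> fibre_count S x + cofibre_count S (\<theta> x)"
          by (elim disjE) (rule add_increasing2[OF zero_le], assumption, rule add_increasing[OF zero_le], assumption)
        then show ?thesis by (rule order_trans[rotated]) (simp add: indicator_def)
      qed
    qed
    then have "(\<integral>\<^sup>+x. indicator ?bad x \<partial>M) \<le> (\<integral>\<^sup>+x. fibre_count S x + cofibre_count S (\<theta> x) \<partial>M)"
      by (rule nn_integral_mono_AE)
    also have "\<dots> = (\<integral>\<^sup>+x. fibre_count S x \<partial>M) + (\<integral>\<^sup>+x. cofibre_count S (\<theta> x) \<partial>M)"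
      by (rule nn_integral_add[OF fibre_count_meas[OF S] measurable_compose[OF \<theta>_meas cofibre_count_meas[OF S]]])
    also have "(\<integral>\<^sup>+x. cofibre_count S (\<theta> x) \<partial>M) = (\<integral>\<^sup>+y. cofibre_count S y \<partial>distr M N \<theta>)"
      by (rule nn_integral_distr[symmetric, OF \<theta>_meas]) (simp add: cofibre_count_meas[OF S])
    also have "(\<integral>\<^sup>+x. fibre_count S x \<partial>M) + (\<integral>\<^sup>+y. cofibre_count S y \<partial>distr M N \<theta>) = emeasure \<zeta> S + emeasure \<zeta> S"
      by (simp only: \<theta>_distr emeasure_\<zeta>[OF S, symmetric] emeasure_\<zeta>_cofibre[OF S, symmetric])
    also have "\<dots> \<le> ennreal (4 * \<delta>\<^sup>2) + ennreal (4 * \<delta>\<^sup>2)" by (rule add_mono[OF \<zeta>S \<zeta>S])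
    also have "\<dots> = ennreal (8 * \<delta>\<^sup>2)" by (subst ennreal_plus[symmetric]) simp_all
    finally show ?thesis using bad_sets by simp
  qed
  show ?thesis
  proof (rule that[OF f(1) _ _ bad])
    fix g x assume g: "g \<in> carrier G" and x: "x \<in> (\<Union>n. A n)"
    from E2_f[OF E2_inv[OF g f_E2[OF x]]]
    show "\<sigma> g x \<in> (\<Union>n. A n)" "f (\<sigma> g x) = \<rho> g (f x)" by simp_all
  qed
qed

end

section \<open>Conjugacy and commuting automorphisms\<close>

lemma aut_dist_eq:
  assumes "prob_space M" and sep: "countably_separated M" and \<alpha>: "\<alpha> \<in> M \<rightarrow>\<^sub>M M" and \<beta>: "\<beta> \<in> M \<rightarrow>\<^sub>M M"
  shows "aut_dist M \<alpha> \<beta> = sqrt (2 * measure M {x \<in> space M. \<alpha> x \<noteq> \<beta> x})"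
proof -
  interpret prob_space M by fact
  have "{x \<in> space M. \<alpha> x = \<beta> x} \<in> sets M"
    using measurable_eq_countably_separated[OF sep \<alpha> \<beta>] by (simp add: pred_def)
  from prob_compl[OF this] have "measure M (space M - {x \<in> space M. \<alpha> x = \<beta> x}) = 1 - measure M {x \<in> space M. \<alpha> x = \<beta> x}" .
  also have "space M - {x \<in> space M. \<alpha> x = \<beta> x} = {x \<in> space M. \<alpha> x \<noteq> \<beta> x}" by auto
  finally show ?thesis by (simp add: aut_dist_def)
qed

lemma standard_prob_spaceD:
  assumes "standard_prob_space M"
  shows "prob_space M" "countably_separated M"
  using assms standard_countably_separated by (auto simp: standard_prob_space_def)

text \<open>
  The form in which property (T) is used for both parts: approximate equivariance along a sequence
  produces exact equivariance on a large invariant set.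
\<close>

lemma kazhdan_near_equivariant:
  fixes G (structure)
  assumes K: "kazhdan_pair G F \<epsilon>" and "finite F" and countable: "countable (carrier G)"
    and M: "standard_prob_space M" and N: "standard_prob_space N"
    and s: "strict_action G M s" and r: "strict_action G N r"
    and \<theta>: "\<And>n. \<theta> n \<in> mp_isos M N"
    and lim: "\<forall>g\<in>carrier G. (\<lambda>n::nat. measure M {x \<in> space M. \<theta> n (s g x) \<noteq> r g (\<theta> n x)}) \<longlonglongrightarrow> 0"
    and e: "e > 0"
  shows "eventually (\<lambda>n. \<exists>A B f f'. partial_iso M N A B f f' \<and>
    (\<forall>g\<in>carrier G. \<forall>x\<in>A. s g x \<in> A \<and> f (s g x) = r g (f x)) \<and>
    measure M {x \<in> space M. \<not> (x \<in> A \<and> f x = \<theta> n x)} \<le> e) sequentially"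
proof -
  define \<delta> where "\<delta> = min 1 (e / 8)"
  have \<delta>: "0 < \<delta>" "\<delta> \<le> 1" using e by (auto simp: \<delta>_def)
  have "\<delta> * \<delta> \<le> 1 * \<delta>" using \<delta> by (intro mult_right_mono) auto
  moreover have "8 * \<delta> \<le> e" unfolding \<delta>_def by simp
  ultimately have \<delta>e: "8 * \<delta>\<^sup>2 \<le> e" by (simp add: power2_eq_square)
  have F: "F \<subseteq> carrier G" and \<epsilon>: "\<epsilon> > 0" using K by (simp_all add: kazhdan_pair_def)
  interpret S: strict_action G M s by (rule s)
  interpret prob_space M by (rule standard_prob_spaceD[OF M])
  have "eventually (\<lambda>n. \<forall>g\<in>F. 2 * measure M {x \<in> space M. \<theta> n (s (inv g) x) \<noteq> r (inv g) (\<theta> n x)} < (\<epsilon> * \<delta>)\<^sup>2) sequentially"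
  proof (intro eventually_ball_finite[OF \<open>finite F\<close>] ballI)
    fix g assume "g \<in> F"
    then have "inv g \<in> carrier G" using F by auto
    from tendsto_mult_right_zero[OF bspec[OF lim this], of 2]
    show "eventually (\<lambda>n. 2 * measure M {x \<in> space M. \<theta> n (s (inv g) x) \<noteq> r (inv g) (\<theta> n x)} < (\<epsilon> * \<delta>)\<^sup>2) sequentially"
      by (rule order_tendstoD(2)) (use \<epsilon> \<delta> in simp)
  qed
  then show ?thesis
  proof eventually_elim
    case (elim n)
    interpret near: graph_system G M s N r "\<theta> n" "mp_inv M N (\<theta> n)"
      using s r countable standard_prob_spaceD[OF M] standard_prob_spaceD[OF N] \<theta>[of n] mp_isosD(3)[OF \<theta>[of n]]
      unfolding graph_system_def graph_system_axioms_def by blast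
    have small: "2 * measure M (near.defect (inv g)) < (\<epsilon> * \<delta>)\<^sup>2" if "g \<in> F" for g
      using elim that by (simp add: near.defect_def)
    obtain A B f f' where f: "partial_iso M N A B f f'"
      "\<And>g x. g \<in> carrier G \<Longrightarrow> x \<in> A \<Longrightarrow> s g x \<in> A"
      "\<And>g x. g \<in> carrier G \<Longrightarrow> x \<in> A \<Longrightarrow> f (s g x) = r g (f x)"
      "emeasure M {x \<in> space M. \<not> (x \<in> A \<and> f x = \<theta> n x)} \<le> ennreal (8 * \<delta>\<^sup>2)"
      by (rule near.near_equivariant_partial_iso[OF K \<delta> small]) (assumption, rule that)
    have "measure M {x \<in> space M. \<not> (x \<in> A \<and> f x = \<theta> n x)} \<le> 8 * \<delta>\<^sup>2"
      using f(4) by (simp add: emeasure_eq_measure ennreal_le_iff)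
    with f(1-3) \<delta>e show ?case
      by (intro exI[of _ A] exI[of _ B] exI[of _ f] exI[of _ f'] conjI ballI) auto
  qed
qed

lemma measure_noncommuting_cong:
  assumes M: "standard_prob_space M" and N: "standard_prob_space N" and \<theta>: "\<theta> \<in> mp_isos M N"
    and m: "\<sigma> \<in> M \<rightarrow>\<^sub>M M" "\<rho> \<in> N \<rightarrow>\<^sub>M N" "s \<in> M \<rightarrow>\<^sub>M M" "r \<in> N \<rightarrow>\<^sub>M N"
    and ae: "AE x in M. s x = \<sigma> x" "AE y in N. r y = \<rho> y"
  shows "measure M {x \<in> space M. \<theta> (s x) \<noteq> r (\<theta> x)} = measure M {x \<in> space M. \<theta> (\<sigma> x) \<noteq> \<rho> (\<theta> x)}"
proof -
  note \<theta>m = mp_isosD(1)[OF \<theta>] and sep = standard_prob_spaceD(2)[OF N]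
  have sets: "{x \<in> space M. \<theta> (a x) \<noteq> b (\<theta> x)} \<in> sets M" if "a \<in> M \<rightarrow>\<^sub>M M" "b \<in> N \<rightarrow>\<^sub>M N" for a b
    unfolding pred_def[symmetric]
    by (intro pred_intros_logic measurable_eq_countably_separated[OF sep]
        measurable_compose[OF that(1) \<theta>m] measurable_compose[OF \<theta>m that(2)])
  show ?thesis
  proof (rule measure_eq_AE)
    show "AE x in M. x \<in> {x \<in> space M. \<theta> (s x) \<noteq> r (\<theta> x)} \<longleftrightarrow> x \<in> {x \<in> space M. \<theta> (\<sigma> x) \<noteq> \<rho> (\<theta> x)}"
      using ae(1) AE_mp_compose[OF \<theta>m mp_isosD(2)[OF \<theta>] ae(2)] by eventually_elim simp
  qed (intro sets m)+
qed

text \<open>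
  The change of variables \<open>y = \<theta> x\<close> turns the distance on the target space into the measure of the set on which
  \<open>\<theta>\<close> fails to intertwine the two maps.
\<close>

lemma aut_dist_conjugated:
  assumes M: "standard_prob_space M" and N: "standard_prob_space N" and \<theta>: "\<theta> \<in> mp_isos M N"
    and m: "\<sigma> \<in> M \<rightarrow>\<^sub>M M" "\<rho> \<in> N \<rightarrow>\<^sub>M N"
  shows "aut_dist N (\<theta> \<circ> \<sigma> \<circ> mp_inv M N \<theta>) \<rho> = sqrt (2 * measure M {x \<in> space M. \<theta> (\<sigma> x) \<noteq> \<rho> (\<theta> x)})"
proof -
  note \<theta>m = mp_isosD(1)[OF \<theta>] and sep = standard_prob_spaceD(2)[OF N]
  define k where "k = mp_inv M N \<theta>"
  have k: "k \<in> N \<rightarrow>\<^sub>M M" "AE x in M. k (\<theta> x) = x"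
    using mp_isosD(3)[OF \<theta>] by (auto simp: k_def ae_inverse_def)
  have c: "(\<lambda>y. \<theta> (\<sigma> (k y))) \<in> N \<rightarrow>\<^sub>M N"
    by (rule measurable_compose[OF measurable_compose[OF k(1) m(1)] \<theta>m])
  let ?S = "{y \<in> space N. \<theta> (\<sigma> (k y)) \<noteq> \<rho> y}"
  have S: "?S \<in> sets N"
    unfolding pred_def[symmetric] by (intro pred_intros_logic measurable_eq_countably_separated[OF sep] c m(2))
  have S': "{x \<in> space M. \<theta> (\<sigma> x) \<noteq> \<rho> (\<theta> x)} \<in> sets M"
    unfolding pred_def[symmetric]
    by (intro pred_intros_logic measurable_eq_countably_separated[OF sep]
        measurable_compose[OF m(1) \<theta>m] measurable_compose[OF \<theta>m m(2)])
  have "measure N ?S = measure (distr M N \<theta>) ?S" by (simp add: mp_isosD(2)[OF \<theta>])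
  also have "\<dots> = measure M (\<theta> -` ?S \<inter> space M)" by (rule measure_distr[OF \<theta>m S])
  also have "\<dots> = measure M {x \<in> space M. \<theta> (\<sigma> x) \<noteq> \<rho> (\<theta> x)}"
  proof (rule measure_eq_AE)
    show "AE x in M. x \<in> \<theta> -` ?S \<inter> space M \<longleftrightarrow> x \<in> {x \<in> space M. \<theta> (\<sigma> x) \<noteq> \<rho> (\<theta> x)}"
      using k(2) AE_space by eventually_elim (use measurable_space[OF \<theta>m] in simp)
  qed (use measurable_sets[OF \<theta>m S] S' in simp_all)
  finally have eq: "measure N ?S = measure M {x \<in> space M. \<theta> (\<sigma> x) \<noteq> \<rho> (\<theta> x)}" .
  have "(\<theta> \<circ> \<sigma> \<circ> mp_inv M N \<theta>) \<in> N \<rightarrow>\<^sub>M N" using c by (simp add: comp_def k_def)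
  from aut_dist_eq[OF standard_prob_spaceD[OF N] this m(2)]
  show ?thesis by (simp add: k_def eq[unfolded k_def])
qed

lemma tendsto_sqrt_double_iff:
  assumes nonneg: "\<And>n. 0 \<le> a n"
  shows "(\<lambda>n. sqrt (2 * a n)) \<longlonglongrightarrow> 0 \<longleftrightarrow> a \<longlonglongrightarrow> 0"
proof
  assume "(\<lambda>n. sqrt (2 * a n)) \<longlonglongrightarrow> 0"
  then have "(\<lambda>n. (sqrt (2 * a n))\<^sup>2 / 2) \<longlonglongrightarrow> 0\<^sup>2 / 2" by (intro tendsto_intros) simp_all
  then show "a \<longlonglongrightarrow> 0" by (simp add: nonneg)
next
  assume "a \<longlonglongrightarrow> 0"
  then have "(\<lambda>n. sqrt (2 * a n)) \<longlonglongrightarrow> sqrt (2 * 0)" by (intro tendsto_intros)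
  then show "(\<lambda>n. sqrt (2 * a n)) \<longlonglongrightarrow> 0" by simp
qed

lemma pmp_action_compose_iso:
  assumes "pmp_action G N \<rho>" and \<delta>: "\<delta> \<in> iso G G"
  shows "pmp_action G N (\<lambda>g. \<rho> (\<delta> g))"
proof -
  have c: "\<delta> g \<in> carrier G" if "g \<in> carrier G" for g
    using \<delta> that by (auto simp: iso_def hom_def)
  have m: "\<delta> (g \<otimes>\<^bsub>G\<^esub> h) = \<delta> g \<otimes>\<^bsub>G\<^esub> \<delta> h" if "g \<in> carrier G" "h \<in> carrier G" for g h
    using \<delta> that by (auto simp: iso_def hom_def)
  show ?thesis using assms(1) by (simp add: pmp_action_def c m)
qed

lemma pmp_action_meas: "pmp_action G M \<sigma> \<Longrightarrow> g \<in> carrier G \<Longrightarrow> \<sigma> g \<in> M \<rightarrow>\<^sub>M M"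
  using mp_isosD(1)[of "\<sigma> g" M M] by (simp add: pmp_action_def)

text \<open>
  For large \<open>n\<close> there is an equivariant partial isomorphism whose domain \<open>A\<close> has measure at least \<open>1/2\<close>. The
  domain is invariant, so ergodicity gives it full measure, and then the range has full measure too.
\<close>

theorem approx_conjugate_imp_conjugate:
  fixes G (structure)
  assumes "group G" and countable: "countable (carrier G)" and "property_T G"
    and M: "standard_prob_space M" and \<sigma>: "pmp_action G M \<sigma>" and erg: "ergodic_action G M \<sigma>"
    and N: "standard_prob_space N" and \<rho>: "pmp_action G N \<rho>"
    and approx: "approx_conjugate_actions G M \<sigma> G N \<rho>"
  shows "conjugate_actions G M \<sigma> G N \<rho>"
proof -
  obtain F \<epsilon> where F: "finite F" and K: "kazhdan_pair G F \<epsilon>"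
    by (rule property_T_kazhdan_pair[OF \<open>property_T G\<close>])
  \<comment> \<open>The group automorphism is absorbed into the action on the second space.\<close>
  obtain \<delta> \<theta> where \<delta>: "\<delta> \<in> iso G G" and \<theta>: "\<And>n. \<theta> n \<in> mp_isos M N"
    and lim: "\<And>g. g \<in> carrier G \<Longrightarrow> (\<lambda>n. aut_dist N (\<theta> n \<circ> \<sigma> g \<circ> mp_inv M N (\<theta> n)) (\<rho> (\<delta> g))) \<longlonglongrightarrow> 0"
    using approx unfolding approx_conjugate_actions_def by auto
  have \<rho>': "pmp_action G N (\<lambda>g. \<rho> (\<delta> g))" by (rule pmp_action_compose_iso[OF \<rho> \<delta>])
  obtain s where s: "strict_action G M s" and s_eq: "\<And>g. g \<in> carrier G \<Longrightarrow> AE x in M. s g x = \<sigma> g x"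
    by (rule strict_action_of_pmp_action[OF \<open>group G\<close> countable standard_prob_spaceD(2)[OF M] \<sigma>]) (rule that)
  obtain r where r: "strict_action G N r" and r_eq: "\<And>g. g \<in> carrier G \<Longrightarrow> AE y in N. r g y = \<rho> (\<delta> g) y"
    by (rule strict_action_of_pmp_action[OF \<open>group G\<close> countable standard_prob_spaceD(2)[OF N] \<rho>']) (rule that)
  interpret S: strict_action G M s by (rule s)
  interpret R: strict_action G N r by (rule r)
  interpret prob_space M by (rule standard_prob_spaceD[OF M])
  interpret N: prob_space N by (rule standard_prob_spaceD[OF N])
  have "\<forall>g\<in>carrier G. (\<lambda>n. measure M {x \<in> space M. \<theta> n (s g x) \<noteq> r g (\<theta> n x)}) \<longlonglongrightarrow> 0"
  proof
    fix g assume g: "g \<in> carrier G"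
    note m = pmp_action_meas[OF \<sigma> g] pmp_action_meas[OF \<rho>' g]
    show "(\<lambda>n. measure M {x \<in> space M. \<theta> n (s g x) \<noteq> r g (\<theta> n x)}) \<longlonglongrightarrow> 0"
      using lim[OF g]
      by (simp add: aut_dist_conjugated[OF M N \<theta> m] tendsto_sqrt_double_iff
          measure_noncommuting_cong[OF M N \<theta> m S.meas[OF g] R.meas[OF g] s_eq[OF g] r_eq[OF g]])
  qed
  from kazhdan_near_equivariant[OF K F countable M N s r \<theta> this, of "1/2"]
  obtain n A B f f' where f: "partial_iso M N A B f f'"
    "\<forall>g\<in>carrier G. \<forall>x\<in>A. s g x \<in> A \<and> f (s g x) = r g (f x)"
    "measure M {x \<in> space M. \<not> (x \<in> A \<and> f x = \<theta> n x)} \<le> 1/2"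
    by (auto simp: eventually_sequentially)
  note p = partial_isoD[OF f(1)]
  have "measure M (space M - A) \<le> 1/2"
  proof -
    have "{x \<in> space M. \<not> (x \<in> A \<and> f x = \<theta> n x)} \<in> sets M"
      unfolding pred_def[symmetric]
      by (intro pred_intros_logic pred_sets2[OF p(1)] measurable_ident_sets refl
          measurable_eq_countably_separated[OF standard_prob_spaceD(2)[OF N]] p(3) mp_isosD(1)[OF \<theta>])
    then have "measure M (space M - A) \<le> measure M {x \<in> space M. \<not> (x \<in> A \<and> f x = \<theta> n x)}"
      by (intro finite_measure_mono) auto
    then show ?thesis using f(3) by simp
  qed
  then have "measure M A \<noteq> 0" using prob_compl[OF p(1)] by simp
  moreover have "AE x in M. \<sigma> g x \<in> A \<longleftrightarrow> x \<in> A" if g: "g \<in> carrier G" for g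
    using s_eq[OF g] AE_space
  proof eventually_elim
    case (elim x)
    have "x \<in> A" if "s g x \<in> A"
    proof -
      have "s (inv g) (s g x) \<in> A" using f(2) that S.inv_closed[OF g] by blast
      then show ?thesis using S.act_inv_left[OF g elim(2)] by simp
    qed
    moreover have "s g x \<in> A" if "x \<in> A" using f(2) g that by blast
    ultimately show ?case unfolding elim(1)[symmetric] by blast
  qed
  ultimately have "measure M A = 1"
    using erg p(1) unfolding ergodic_action_def by blast
  then have A: "AE x in M. x \<in> A" using AE_in_set_eq_1[OF p(1)] by simp
  have "measure N B = 1"
    using partial_iso_emeasure_eq[OF f(1)] \<open>measure M A = 1\<close> by (simp add: measure_def)
  then have B: "AE y in N. y \<in> B" using N.AE_in_set_eq_1[OF p(2)] by simp
  have iso: "f \<in> mp_isos M N" by (rule partial_iso_imp_mp_iso[OF f(1) A B])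
  have "AE x in M. f (\<sigma> g x) = \<rho> (\<delta> g) (f x)" if g: "g \<in> carrier G" for g
    using s_eq[OF g] AE_mp_compose[OF mp_isosD(1,2)[OF iso] r_eq[OF g]] A
    by eventually_elim (use f(2) g in metis)
  then show ?thesis
    unfolding conjugate_actions_def using iso \<delta> by blast
qed

theorem conjugate_imp_approx_conjugate:
  assumes M: "standard_prob_space M" and \<sigma>: "pmp_action G M \<sigma>"
    and N: "standard_prob_space N" and \<rho>: "pmp_action G N \<rho>"
    and conj: "conjugate_actions G M \<sigma> G N \<rho>"
  shows "approx_conjugate_actions G M \<sigma> G N \<rho>"
proof -
  obtain \<Delta> \<delta> where \<Delta>: "\<Delta> \<in> mp_isos M N" and \<delta>: "\<delta> \<in> iso G G"
    and eq: "\<And>g. g \<in> carrier G \<Longrightarrow> AE x in M. \<Delta> (\<sigma> g x) = \<rho> (\<delta> g) (\<Delta> x)"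
    using conj unfolding conjugate_actions_def by auto
  note \<rho>' = pmp_action_compose_iso[OF \<rho> \<delta>]
  have "aut_dist N (\<Delta> \<circ> \<sigma> g \<circ> mp_inv M N \<Delta>) (\<rho> (\<delta> g)) = 0" if g: "g \<in> carrier G" for g
  proof -
    have "measure M {x \<in> space M. \<Delta> (\<sigma> g x) \<noteq> \<rho> (\<delta> g) (\<Delta> x)} = measure M {}"
    proof (rule measure_eq_AE)
      show "{x \<in> space M. \<Delta> (\<sigma> g x) \<noteq> \<rho> (\<delta> g) (\<Delta> x)} \<in> sets M"
        unfolding pred_def[symmetric]
        by (intro pred_intros_logic measurable_eq_countably_separated[OF standard_prob_spaceD(2)[OF N]]
            measurable_compose[OF pmp_action_meas[OF \<sigma> g] mp_isosD(1)[OF \<Delta>]]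
            measurable_compose[OF mp_isosD(1)[OF \<Delta>] pmp_action_meas[OF \<rho>' g]])
      show "AE x in M. x \<in> {x \<in> space M. \<Delta> (\<sigma> g x) \<noteq> \<rho> (\<delta> g) (\<Delta> x)} \<longleftrightarrow> x \<in> {}"
        using eq[OF g] by eventually_elim simp
    qed simp
    then show ?thesis
      by (simp add: aut_dist_conjugated[OF M N \<Delta> pmp_action_meas[OF \<sigma> g] pmp_action_meas[OF \<rho>' g]])
  qed
  then show ?thesis
    unfolding approx_conjugate_actions_def
    by (intro bexI[OF _ \<delta>] exI[of _ "\<lambda>_. \<Delta>"]) (simp add: \<Delta>)
qed

text \<open>
  For every \<open>e > 0\<close> all but finitely many \<open>\<theta> n\<close> agree with some automorphism in the commutant \<open>C\<close> of the action
  off a set of measure at most \<open>e\<close>. A single sequence is obtained by choosing for each \<open>n\<close> an element of \<open>C\<close> whose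
  distance to \<open>\<theta> n\<close> exceeds the infimum by less than \<open>1 / (n + 1)\<close>.
\<close>

theorem almost_commuting_near_commuting:
  fixes G (structure)
  assumes "group G" and countable: "countable (carrier G)" and "property_T G"
    and M: "standard_prob_space M" and \<sigma>: "pmp_action G M \<sigma>" and \<theta>: "\<And>n::nat. \<theta> n \<in> mp_isos M M"
    and lim: "\<And>g. g \<in> carrier G \<Longrightarrow> (\<lambda>n. aut_dist M (\<theta> n \<circ> \<sigma> g) (\<sigma> g \<circ> \<theta> n)) \<longlonglongrightarrow> 0"
  obtains \<theta>' where "\<And>n::nat. \<theta>' n \<in> mp_isos M M"
    "\<And>n g. g \<in> carrier G \<Longrightarrow> AE x in M. \<theta>' n (\<sigma> g x) = \<sigma> g (\<theta>' n x)"
    "(\<lambda>n. aut_dist M (\<theta>' n) (\<theta> n)) \<longlonglongrightarrow> 0"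
proof -
  obtain F \<epsilon> where F: "finite F" and K: "kazhdan_pair G F \<epsilon>"
    by (rule property_T_kazhdan_pair[OF \<open>property_T G\<close>])
  note MD = standard_prob_spaceD[OF M]
  obtain s where s: "strict_action G M s" and s_eq: "\<And>g. g \<in> carrier G \<Longrightarrow> AE x in M. s g x = \<sigma> g x"
    by (rule strict_action_of_pmp_action[OF \<open>group G\<close> countable MD(2) \<sigma>]) (rule that)
  interpret S: strict_action G M s by (rule s)
  interpret prob_space M by (rule MD)
  have lim': "\<forall>g\<in>carrier G. (\<lambda>n. measure M {x \<in> space M. \<theta> n (s g x) \<noteq> s g (\<theta> n x)}) \<longlonglongrightarrow> 0"
  proof
    fix g assume g: "g \<in> carrier G"
    note m = pmp_action_meas[OF \<sigma> g]
    have "aut_dist M (\<theta> n \<circ> \<sigma> g) (\<sigma> g \<circ> \<theta> n) = sqrt (2 * measure M {x \<in> space M. \<theta> n (\<sigma> g x) \<noteq> \<sigma> g (\<theta> n x)})" for n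
      using aut_dist_eq[OF MD measurable_comp[OF m mp_isosD(1)[OF \<theta>]] measurable_comp[OF mp_isosD(1)[OF \<theta>] m]]
      by simp
    then show "(\<lambda>n. measure M {x \<in> space M. \<theta> n (s g x) \<noteq> s g (\<theta> n x)}) \<longlonglongrightarrow> 0"
      using lim[OF g]
      by (simp add: tendsto_sqrt_double_iff measure_noncommuting_cong[OF M M \<theta> m m S.meas[OF g] S.meas[OF g] s_eq[OF g] s_eq[OF g]])
  qed
  define C where "C = {h \<in> mp_isos M M. \<forall>g\<in>carrier G. AE x in M. h (\<sigma> g x) = \<sigma> g (h x)}"
  define d where "d n h = measure M {x \<in> space M. h x \<noteq> \<theta> n x}" for n h
  have near: "eventually (\<lambda>n. \<exists>h\<in>C. d n h \<le> e) sequentially" if e: "e > 0" for e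
    using kazhdan_near_equivariant[OF K F countable M M s s \<theta> lim' e]
  proof eventually_elim
    case (elim n)
    then obtain A B f f' where f: "partial_iso M M A B f f'"
      "\<forall>g\<in>carrier G. \<forall>x\<in>A. s g x \<in> A \<and> f (s g x) = s g (f x)"
      "measure M {x \<in> space M. \<not> (x \<in> A \<and> f x = \<theta> n x)} \<le> e" by blast
    obtain h where h: "h \<in> mp_isos M M" "\<And>x. x \<in> A \<Longrightarrow> h x = f x"
      "\<And>g. g \<in> carrier G \<Longrightarrow> AE x in M. h (s g x) = s g (h x)"
      by (rule extend_equivariant_partial_iso[OF s MD(1) f(1)]) (use f(2) that in auto)
    note p = partial_isoD[OF f(1)]
    have "h \<in> C"
      unfolding C_def
    proof (intro CollectI conjI ballI h(1))
      fix g assume g: "g \<in> carrier G"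
      show "AE x in M. h (\<sigma> g x) = \<sigma> g (h x)"
        using s_eq[OF g] AE_mp_compose[OF mp_isosD(1,2)[OF h(1)] s_eq[OF g]] h(3)[OF g]
        by eventually_elim simp
    qed
    moreover have "d n h \<le> e"
    proof -
      have "{x \<in> space M. \<not> (x \<in> A \<and> f x = \<theta> n x)} \<in> sets M"
        unfolding pred_def[symmetric]
        by (intro pred_intros_logic pred_sets2[OF p(1)] measurable_ident_sets refl
            measurable_eq_countably_separated[OF MD(2)] p(3) mp_isosD(1)[OF \<theta>])
      then have "d n h \<le> measure M {x \<in> space M. \<not> (x \<in> A \<and> f x = \<theta> n x)}"
        unfolding d_def by (intro finite_measure_mono) (auto simp: h(2))
      then show ?thesis using f(3) by simp
    qed
    ultimately show ?case by blast
  qed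
  have "(\<lambda>x. x) \<in> C"
    by (auto simp: C_def mp_isos_def ae_inverse_def distr_id[unfolded id_def] intro!: exI[of _ "\<lambda>x. x"])
  then have ne: "C \<noteq> {}" by blast
  have bdd: "bdd_below (d n ` C)" for n by (intro bdd_belowI[of _ 0]) (auto simp: d_def)
  define I where "I n = Inf (d n ` C)" for n
  have "\<exists>h\<in>C. d n h < I n + 1 / Suc n" for n
  proof -
    have "Inf (d n ` C) < I n + 1 / Suc n" by (simp add: I_def)
    then show ?thesis using cInf_less_iff[OF _ bdd[of n]] ne by auto
  qed
  then obtain \<theta>' where \<theta>': "\<And>n. \<theta>' n \<in> C" "\<And>n. d n (\<theta>' n) < I n + 1 / Suc n" by metis
  have "(\<lambda>n. d n (\<theta>' n)) \<longlonglongrightarrow> 0"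
  proof (rule order_tendstoI)
    fix a :: real assume "a < 0"
    moreover have "0 \<le> d n (\<theta>' n)" for n by (simp add: d_def)
    ultimately show "eventually (\<lambda>n. a < d n (\<theta>' n)) sequentially"
      by (intro always_eventually allI) (rule less_le_trans)
  next
    fix a :: real assume a: "0 < a"
    have "eventually (\<lambda>n. 1 / real (Suc n) < a / 2) sequentially"
      by (rule order_tendstoD(2)[OF LIMSEQ_Suc[OF lim_1_over_n]]) (use a in simp)
    moreover have "eventually (\<lambda>n. \<exists>h\<in>C. d n h \<le> a / 2) sequentially" using near[of "a/2"] a by simp
    ultimately show "eventually (\<lambda>n. d n (\<theta>' n) < a) sequentially"
    proof eventually_elim
      case (elim n)
      then obtain h where "h \<in> C" "d n h \<le> a / 2" by blast
      then have "I n \<le> a / 2" unfolding I_def using cInf_lower[OF _ bdd[of n], of "d n h"] by auto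
      then show ?case using \<theta>'(2)[of n] elim(1) by linarith
    qed
  qed
  moreover have "aut_dist M (\<theta>' n) (\<theta> n) = sqrt (2 * d n (\<theta>' n))" for n
    unfolding d_def using \<theta>'(1)[of n]
    by (intro aut_dist_eq MD mp_isosD(1)[OF \<theta>]) (auto simp: C_def intro: mp_isosD(1))
  ultimately have "(\<lambda>n. aut_dist M (\<theta>' n) (\<theta> n)) \<longlonglongrightarrow> 0"
    by (simp add: tendsto_sqrt_double_iff d_def)
  then show ?thesis using \<theta>'(1) by (intro that[of \<theta>']) (auto simp: C_def)
qed

theorem corollary3p11:
  fixes G :: "('g, 'm) monoid_scheme"
  assumes "group G" and "countable (carrier G)" and "property_T G"
  shows
    "(\<forall>(M :: 'a measure) (N :: 'b measure) \<sigma> \<rho>.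
        standard_prob_space M \<and> pmp_action G M \<sigma> \<and> free_action G M \<sigma> \<and> ergodic_action G M \<sigma> \<and>
        standard_prob_space N \<and> pmp_action G N \<rho> \<and> free_action G N \<rho> \<and> ergodic_action G N \<rho> \<longrightarrow>
        (approx_conjugate_actions G M \<sigma> G N \<rho> \<longleftrightarrow> conjugate_actions G M \<sigma> G N \<rho>)) \<and>
     (\<forall>(M :: 'c measure) \<sigma> (\<theta> :: nat \<Rightarrow> 'c \<Rightarrow> 'c).
        standard_prob_space M \<and> pmp_action G M \<sigma> \<and> (\<forall>n. \<theta> n \<in> mp_auts M) \<and>
        (\<forall>g\<in>carrier G. (\<lambda>n. aut_dist M (\<theta> n \<circ> \<sigma> g) (\<sigma> g \<circ> \<theta> n)) \<longlonglongrightarrow> 0) \<longrightarrow>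
        (\<exists>\<theta>' :: nat \<Rightarrow> 'c \<Rightarrow> 'c.
           (\<forall>n. \<theta>' n \<in> mp_auts M) \<and>
           (\<forall>n. \<forall>g\<in>carrier G. AE x in M. \<theta>' n (\<sigma> g x) = \<sigma> g (\<theta>' n x)) \<and>
           (\<lambda>n. aut_dist M (\<theta>' n) (\<theta> n)) \<longlonglongrightarrow> 0))"
proof (intro conjI allI impI; elim conjE)
  fix M :: "'a measure" and N :: "'b measure" and \<sigma> \<rho>
  assume M: "standard_prob_space M" "pmp_action G M \<sigma>" "ergodic_action G M \<sigma>"
    and N: "standard_prob_space N" "pmp_action G N \<rho>"
  show "approx_conjugate_actions G M \<sigma> G N \<rho> \<longleftrightarrow> conjugate_actions G M \<sigma> G N \<rho>"
    using approx_conjugate_imp_conjugate[OF assms M N] conjugate_imp_approx_conjugate[OF M(1,2) N] by (rule iffI)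
next
  fix M :: "'c measure" and \<sigma> and \<theta> :: "nat \<Rightarrow> 'c \<Rightarrow> 'c"
  assume M: "standard_prob_space M" "pmp_action G M \<sigma>" and \<theta>: "\<forall>n. \<theta> n \<in> mp_auts M"
    and lim: "\<forall>g\<in>carrier G. (\<lambda>n. aut_dist M (\<theta> n \<circ> \<sigma> g) (\<sigma> g \<circ> \<theta> n)) \<longlonglongrightarrow> 0"
  obtain \<theta>' where \<theta>': "\<And>n::nat. \<theta>' n \<in> mp_isos M M"
    "\<And>n g. g \<in> carrier G \<Longrightarrow> AE x in M. \<theta>' n (\<sigma> g x) = \<sigma> g (\<theta>' n x)"
    "(\<lambda>n. aut_dist M (\<theta>' n) (\<theta> n)) \<longlonglongrightarrow> 0"
    by (rule almost_commuting_near_commuting[OF assms M \<theta>[rule_format] lim[rule_format]]) (assumption, rule that)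
  show "\<exists>\<theta>' :: nat \<Rightarrow> 'c \<Rightarrow> 'c. (\<forall>n. \<theta>' n \<in> mp_auts M) \<and>
      (\<forall>n. \<forall>g\<in>carrier G. AE x in M. \<theta>' n (\<sigma> g x) = \<sigma> g (\<theta>' n x)) \<and>
      (\<lambda>n. aut_dist M (\<theta>' n) (\<theta> n)) \<longlonglongrightarrow> 0"
    using \<theta>' by (intro exI[of _ \<theta>'] conjI allI ballI)
qed

end
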